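(* Let $l\ge3$ and let $\mathbf{t}=(t_1,\ldots,t_l)\in\mathbb{R}^l$ be fixed. For $\mathbb{P}_{Z(\mathbf{t})}$-a.e. $\mathbf{z}=(z_1,\ldots,z_l)>\mathbf{0}$ the following holds. Suppose $I_{\{1,\ldots,l\}}(\mathbf{z})=\{(s_1,u_1,f_1),\ldots,(s_k,u_k,f_k)\}$ (with $k\ge1$), where $f_1,\ldots,f_k:\mathbb{R}\to[0,\infty)$ are continuously differentiable in a neighbourhood of $t_i-s_j$, $i=1,\ldots,l$, $j=1,\ldots,k$, and $$z_1f_j'(t_2-s_j)\ne z_2f_j'(t_1-s_j),\qquad j=1,\ldots,k.$$ Then, for every $(t_0,y_0,f)\in I_{\{1,\ldots,l\}}(\mathbf{z})$, $$\mathbb{P}\big((t_0,y_0,f)\in\Pi\ \big|\ |\Pi\cap I_{\{1,\ldots,l\}}(Z(\mathbf{t}))|=1,\ Z(\mathbf{t})=\mathbf{z}\big)=\frac{y_0^{-2}\,\mathbb{P}_F(\{f\})}{|z_1f'(t_2-t_0)-z_2f'(t_1-t_0)|}\left(\sum_{j=1}^k\frac{u_j^{-2}\,\mathbb{P}_F(\{f_j\})}{|z_1f_j'(t_2-s_j)-z_2f_j'(t_1-s_j)|}\right)^{-1}.$$ Furthermore, for $\mathbb{P}_{Z(\mathbf{t})}$-a.e. $\mathbf{z}>\mathbf{0}$, the right-hand side does not depend on the choice of the labelling of the pairs $(t_1,z_1),\ldots,(t_l,z_l)$ (i.e. on which two of them carry the indices $1$ and $2$).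
   Context: Let $G$ be a finite set of measurable functions $f:\mathbb{R}\to[0,\infty)$ such that for all $f\in G$, $c>0$ and $t_0\in\mathbb{R}\setminus\{0\}$ the set $\{t\in\mathbb{R}: f(t)=c f(t_0+t),\ f(t)>0\}$ is finite. Let $F$ be a $G$-valued random function with law $\mathbb{P}_F$, $\mathbb{P}_F(\{f\})>0$ for all $f\in G$, and $\mathbb{E}\left(\int_{\mathbb{R}}F(x)\,\mathrm{d}x\right)=1$. Let $\Pi$ be a Poisson point process on $S=\mathbb{R}\times(0,\infty)\times G$ with intensity measure $\Lambda(A\times B\times C)=\mu(A)\,\mathbb{P}_F(C)\int_B u^{-2}\,\mathrm{d}u$, where $\mu$ is Lebesgue measure, and let $Z(t)=\max_{(s,u,f)\in\Pi}u f(t-s)$, $Z(\mathbf{t})=(Z(t_1),\ldots,Z(t_l))$ with law $\mathbb{P}_{Z(\mathbf{t})}$. Conditional probabilities given $Z(\mathbf{t})=\mathbf{z}$ refer to a regular conditional probability on $\sigma(\Pi)$ given $Z(\mathbf{t})$; conditioning additionally on an event is elementary conditioning under that measure. $|\cdot|$ denotes the number of points. Here $I_{\{1,\ldots,l\}}(\mathbf{z})=\{(x,y,f)\in S: y f(t_i-x)=z_i,\ i=1,\ldots,l\}$. *)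

theory Defs
  imports "HOL-Probability.Probability"
begin

type_synonym storm = "real \<times> real \<times> (real \<Rightarrow> real)"

text \<open>The mark space carries the discrete sigma-algebra: \<open>PF\<close> will be a measure
  on \<open>count_space G\<close>, so that the space of \<open>storm_intensity PF\<close> is
  \<open>UNIV \<times> {0<..} \<times> G\<close>.\<close>

definition storm_intensity :: "(real \<Rightarrow> real) measure \<Rightarrow> storm measure" where
  "storm_intensity PF =
     lborel \<Otimes>\<^sub>M density (restrict_space lborel {0<..}) (\<lambda>u. ennreal (1 / u\<^sup>2)) \<Otimes>\<^sub>M PF"

definition num_points :: "'b set \<Rightarrow> ennreal" where
  "num_points X = emeasure (count_space UNIV) X"

text \<open>A Poisson point process, as a random set of points (its intensity has no atoms in our
  application, so no multiplicities are needed). On sets of infinite intensity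
  the number of points is almost surely infinite.\<close>

definition poisson_process :: "'a measure \<Rightarrow> 'b measure \<Rightarrow> ('a \<Rightarrow> 'b set) \<Rightarrow> bool" where
  "poisson_process M \<Lambda> \<Phi> \<longleftrightarrow>
     prob_space M \<and>
     (\<forall>\<omega>\<in>space M. \<Phi> \<omega> \<subseteq> space \<Lambda> \<and> countable (\<Phi> \<omega>)) \<and>
     (\<forall>A\<in>sets \<Lambda>. (\<lambda>\<omega>. num_points (\<Phi> \<omega> \<inter> A)) \<in> borel_measurable M) \<and>
     (\<forall>A\<in>sets \<Lambda>. emeasure \<Lambda> A < \<infinity> \<longrightarrow>
        (\<forall>n::nat. measure M {\<omega>\<in>space M. num_points (\<Phi> \<omega> \<inter> A) = of_nat n}
           = measure \<Lambda> A ^ n / fact n * exp (- measure \<Lambda> A))) \<and>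
     (\<forall>A\<in>sets \<Lambda>. emeasure \<Lambda> A = \<infinity> \<longrightarrow> (AE \<omega> in M. num_points (\<Phi> \<omega> \<inter> A) = \<infinity>)) \<and>
     (\<forall>A :: nat \<Rightarrow> 'b set. range A \<subseteq> sets \<Lambda> \<longrightarrow> disjoint_family A \<longrightarrow>
        prob_space.indep_vars M (\<lambda>_. borel) (\<lambda>i \<omega>. num_points (\<Phi> \<omega> \<inter> A i)) UNIV)"

text \<open>Local finiteness in the topology of \<open>\<real> \<times> (0,\<infinity>) \<times> G\<close> with \<open>G\<close> finite discrete.
  Compact subsets of \<open>\<real> \<times> (0,\<infinity>)\<close> stay away from height 0.\<close>

definition locally_finite_storms :: "storm set \<Rightarrow> bool" where
  "locally_finite_storms X \<longleftrightarrow>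
     (\<forall>C. compact C \<longrightarrow> C \<subseteq> UNIV \<times> {0<..} \<longrightarrow> finite {(s, u, f) \<in> X. (s, u) \<in> C})"

definition sigma_process :: "'a measure \<Rightarrow> 'b measure \<Rightarrow> ('a \<Rightarrow> 'b set) \<Rightarrow> 'a measure" where
  "sigma_process M \<Lambda> \<Phi> = sigma (space M)
     {(\<lambda>\<omega>. num_points (\<Phi> \<omega> \<inter> A)) -` B \<inter> space M | A B. A \<in> sets \<Lambda> \<and> B \<in> sets borel}"

text \<open>\<open>K\<close> is a regular version of the conditional probability on the sub-sigma-algebra \<open>A\<close>
  given the \<open>V\<close>-valued variable \<open>X\<close>.\<close>

definition regular_cond_prob ::
  "'a measure \<Rightarrow> 'a measure \<Rightarrow> 'v measure \<Rightarrow> ('a \<Rightarrow> 'v) \<Rightarrow> ('v \<Rightarrow> 'a measure) \<Rightarrow> bool" where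
  "regular_cond_prob M A V X K \<longleftrightarrow>
     K \<in> measurable V (prob_algebra A) \<and>
     (\<forall>E\<in>sets A. \<forall>B\<in>sets V.
        emeasure M (E \<inter> (X -` B \<inter> space M)) = (\<integral>\<^sup>+z\<in>B. emeasure (K z) E \<partial>distr M V X))"

text \<open>The maximum over a configuration is rendered as a supremum. It is almost surely attained,
  since for every \<open>\<epsilon> > 0\<close> only finitely many storms contribute more than \<open>\<epsilon>\<close> at \<open>t\<close>.\<close>

definition max_field :: "storm set \<Rightarrow> real \<Rightarrow> real" where
  "max_field X t = (SUP (s, u, f) \<in> X. u * f (t - s))"

definition max_vec :: "nat \<Rightarrow> (nat \<Rightarrow> real) \<Rightarrow> storm set \<Rightarrow> nat \<Rightarrow> real" where
  "max_vec l t X = (\<lambda>i\<in>{1..l}. max_field X (t i))"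

definition vec_space :: "nat \<Rightarrow> (nat \<Rightarrow> real) measure" where
  "vec_space l = PiM {1..l} (\<lambda>_. borel)"

definition I_set ::
  "(real \<Rightarrow> real) set \<Rightarrow> nat \<Rightarrow> (nat \<Rightarrow> real) \<Rightarrow> (nat \<Rightarrow> real) \<Rightarrow> storm set" where
  "I_set G l t z = {(x, y, f). y > 0 \<and> f \<in> G \<and> (\<forall>i\<in>{1..l}. y * f (t i - x) = z i)}"

definition C1_near :: "(real \<Rightarrow> real) \<Rightarrow> real \<Rightarrow> bool" where
  "C1_near f x \<longleftrightarrow> (\<exists>U. open U \<and> x \<in> U \<and> f C1_differentiable_on U)"

text \<open>At points \<open>(s, u, f)\<close> of \<open>I_set\<close> this is the determinant of the derivative of
  \<open>(s, u) \<mapsto> (u * f (t 1 - s), u * f (t 2 - s))\<close>.\<close>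

definition jac :: "(nat \<Rightarrow> real) \<Rightarrow> (nat \<Rightarrow> real) \<Rightarrow> real \<Rightarrow> (real \<Rightarrow> real) \<Rightarrow> real" where
  "jac t z s f = z 1 * deriv f (t 2 - s) - z 2 * deriv f (t 1 - s)"

definition storm_weight ::
  "(real \<Rightarrow> real) measure \<Rightarrow> (nat \<Rightarrow> real) \<Rightarrow> (nat \<Rightarrow> real) \<Rightarrow> storm \<Rightarrow> real" where
  "storm_weight PF t z = (\<lambda>(s, u, f). (1 / u\<^sup>2) * measure PF {f} / \<bar>jac t z s f\<bar>)"

end

theory Submission
  imports Defs "HOL-Analysis.Lebesgue_Integral_Substitution"
begin


text \<open>Let \<open>\<Lambda>\<close> be the intensity of the process, and let \<open>heights p\<close> be the vector of the values of a storm \<open>p\<close> at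
  \<open>t 1, \<dots>, t l\<close>. Then \<open>I_set G l t z\<close> is the fibre of \<open>heights\<close> over \<open>z\<close>. If exactly one storm of the
  configuration lies in the fibre over the vector \<open>Z\<close> of maxima, it is called the leader; so \<open>Z\<close> consists of the
  heights of the leader. The theorem describes the leader given \<open>Z\<close>.

  The law of the leader. A storm \<open>p\<close> is the leader if no other storm reaches any of its heights, which has
  probability \<open>exp (- excess (heights p))\<close>, where \<open>excess z\<close> is the intensity of the storms that reach \<open>z\<close>
  somewhere. Hence on storms with positive heights the law of the leader has the density
  \<open>exp (- excess (heights p))\<close> with respect to \<open>\<Lambda>\<close> (\<open>leader_law_eq_density\<close>). The density is constant on fibres,
  so it does not favour any of the candidates for the leader.

  Charts. What distinguishes the candidates is the geometry of \<open>heights\<close>. Fix a profile \<open>f\<close> and let the shift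
  \<open>s\<close> vary in a small interval where \<open>f\<close> is continuously differentiable near \<open>t a - s\<close> and \<open>t b - s\<close>, is positive at
  \<open>t a - s\<close>, and has a Wronskian at these two points that does not vanish. On such a strip of storms
  the numbers \<open>v = z\<^sub>a\<close> and \<open>r = z\<^sub>b / z\<^sub>a\<close>, computed from the heights \<open>z\<close>, are coordinates, and by a change of
  variables \<open>\<Lambda>\<close> has the density \<open>weight a b p = u\<^sup>-\<^sup>2 P\<^sub>F{f} / \<bar>Jacobian\<bar>\<close> with respect to \<open>v dv dr\<close>
  (\<open>strip_integral\<close>). The measure \<open>v dv dr\<close> does not know the strip. Therefore the laws of the maxima on the
  events that the leader lies in one or in another strip have densities in the ratio of the weights, on vectors that
  both strips attain (\<open>weight_exchange\<close>). Disintegrated along \<open>Z\<close>, this is the ratio of the conditional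
  probabilities of two candidates (\<open>mass_exchange\<close>), and normalising yields the formula
  (\<open>conditional_weight\<close>). Another pair of indices relates the same two laws, so it yields the same ratios
  (\<open>weight_ratio_independent\<close>, \<open>labelling_independent\<close>).

  Null sets. The laws on strips are only part of the law of \<open>Z\<close>, which also sees configurations without a
  single leader. So both the positivity of the conditioning event and the independence of the labelling require the
  following: if \<open>D\<close> is a set of vectors attained in a strip and null for the law on this strip, then for almost
  every \<open>z\<close> in \<open>D\<close> the fibre contains a storm that lies in no strip, which the hypotheses on \<open>I_set G l t z\<close>
  exclude (\<open>AE_irregular_of_null_image\<close>). First, \<open>Z\<close> almost surely avoids \<open>D\<close> if there is no single leader
  (\<open>AE_single_of_null_image\<close>): a storm attaining the maximum at \<open>t a\<close> leaves some maximum to the others, whose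
  suprema are independent of it and have no atoms and no singular part. Second, if there is a single leader,
  it lies in no strip, as \<open>weight_exchange\<close> transports the null set. Since the vectors attained by such
  storms form an analytic rather than a Borel set, the passage from configurations to vectors uses inner
  regularity (\<open>leader_image_cover\<close>).\<close>

section \<open>Ratios of heights as a change of variables\<close>

lemma C1_near_D:
  assumes "C1_near f x"
  shows "\<forall>\<^sub>F y in nhds x. C1_near f y \<and> (f has_real_derivative deriv f y) (at y)"
    and "isCont (deriv f) x"
proof -
  obtain U D where U: "open U" "x \<in> U" and D: "\<And>y. y \<in> U \<Longrightarrow> (f has_vector_derivative D y) (at y)"
    and cont: "continuous_on U D"
    using assms unfolding C1_near_def C1_differentiable_on_def by blast
  have der: "(f has_real_derivative D y) (at y)" if "y \<in> U" for y
    using D[OF that] by (simp add: has_real_derivative_iff_has_vector_derivative)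
  have eq: "deriv f y = D y" if "y \<in> U" for y
    using der[OF that] by (rule DERIV_imp_deriv)
  have "f C1_differentiable_on U"
    unfolding C1_differentiable_on_def using D cont by (intro exI[where x = D] conjI ballI)
  then have "C1_near f y" if "y \<in> U" for y
    unfolding C1_near_def using U(1) that by (intro exI[where x = U] conjI)
  then show "\<forall>\<^sub>F y in nhds x. C1_near f y \<and> (f has_real_derivative deriv f y) (at y)"
    unfolding eventually_nhds using U der eq by (intro exI[where x = U]) simp
  have "continuous_on U (deriv f)" using cont by (rule continuous_on_eq) (simp add: eq)
  then show "isCont (deriv f) x" using U by (simp add: continuous_on_eq_continuous_at)
qed

lemma C1_near_has_derivative: "C1_near f x \<Longrightarrow> (f has_real_derivative deriv f x) (at x)"
  by (drule C1_near_D(1), drule eventually_nhds_x_imp_x) simp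

text \<open>For a storm \<open>(s, u, f)\<close> with heights \<open>z\<^sub>a = u f (ta - s)\<close>, \<open>z\<^sub>b = u f (tb - s)\<close>, the number
  \<open>u * wronskian f ta tb s\<close> is the Jacobian determinant of \<open>(s, u) \<mapsto> (z\<^sub>a, z\<^sub>b)\<close>. At the same time the
  Wronskian is, up to the factor \<open>- 1 / (f (ta - s))\<^sup>2\<close>, the derivative of the ratio of the heights.\<close>

definition wronskian :: "(real \<Rightarrow> real) \<Rightarrow> real \<Rightarrow> real \<Rightarrow> real \<Rightarrow> real" where
  "wronskian f ta tb s = f (ta - s) * deriv f (tb - s) - f (tb - s) * deriv f (ta - s)"

text \<open>The constant sign of the Wronskian makes the ratio of the heights strictly monotone in the
  shift, so that on such an interval the ratio can replace the shift as a coordinate.\<close>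

definition branch_interval :: "(real \<Rightarrow> real) \<Rightarrow> real \<Rightarrow> real \<Rightarrow> real \<Rightarrow> real \<Rightarrow> bool" where
  "branch_interval f ta tb j1 j2 \<longleftrightarrow> j1 < j2 \<and>
     (\<forall>s\<in>{j1..j2}. C1_near f (ta - s) \<and> C1_near f (tb - s) \<and> f (ta - s) > 0) \<and>
     ((\<forall>s\<in>{j1..j2}. wronskian f ta tb s > 0) \<or> (\<forall>s\<in>{j1..j2}. wronskian f ta tb s < 0))"

definition height_ratio :: "(real \<Rightarrow> real) \<Rightarrow> real \<Rightarrow> real \<Rightarrow> real \<Rightarrow> real" where
  "height_ratio f ta tb s = f (tb - s) / f (ta - s)"

text \<open>The value \<open>j1\<close> for numbers that are no ratio keeps the inverse total, measurable and inside the
  interval, which spares side conditions below integral signs.\<close>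

definition branch_inv :: "(real \<Rightarrow> real) \<Rightarrow> real \<Rightarrow> real \<Rightarrow> real \<Rightarrow> real \<Rightarrow> real \<Rightarrow> real" where
  "branch_inv f ta tb j1 j2 r =
     (if r \<in> height_ratio f ta tb ` {j1..j2} then inv_into {j1..j2} (height_ratio f ta tb) r else j1)"

lemma isCont_shift: 
  assumes "isCont g (c - s)" shows "isCont (\<lambda>s. g (c - s)) (s::real)"
  by (rule isCont_o2[of s "\<lambda>s. c - s"]) (use assms in \<open>auto intro: continuous_intros\<close>)

lemma isCont_wronskian:
  assumes "C1_near f (ta - s)" "C1_near f (tb - s)"
  shows "isCont (wronskian f ta tb) s"
proof -
  have "isCont f (ta - s)" "isCont f (tb - s)"
    using assms by (auto dest: C1_near_has_derivative DERIV_isCont)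
  then show ?thesis
    unfolding wronskian_def [abs_def] using C1_near_D(2)[OF assms(1)] C1_near_D(2)[OF assms(2)]
    by (auto intro!: continuous_intros isCont_shift[where g = f] isCont_shift[where g = "deriv f"])
qed

text \<open>Continuity of the Wronskian and of the profile lets every regular shift be enclosed in a
  rational interval on which the sign conditions persist.\<close>

lemma branch_interval_exists:
  assumes C1: "C1_near f (ta - s)" "C1_near f (tb - s)" and pos: "f (ta - s) > 0"
    and nz: "wronskian f ta tb s \<noteq> 0"
  shows "\<exists>e>0. \<forall>j1 j2. s - e < j1 \<longrightarrow> j1 < s \<longrightarrow> s < j2 \<longrightarrow> j2 < s + e \<longrightarrow> branch_interval f ta tb j1 j2"
proof -
  have lim: "((\<lambda>s. c - s) \<longlongrightarrow> c - s) (nhds s)" for c :: real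
    by (intro tendsto_intros) (simp add: filterlim_ident)
  have 1: "\<forall>\<^sub>F y in nhds s. C1_near f (ta - y)" "\<forall>\<^sub>F y in nhds s. C1_near f (tb - y)"
    using eventually_compose_filterlim[OF C1_near_D(1)[OF C1(1)] lim]
      eventually_compose_filterlim[OF C1_near_D(1)[OF C1(2)] lim] by (auto elim: eventually_mono)
  have "isCont f (ta - s)" using C1(1) by (auto dest: C1_near_has_derivative DERIV_isCont)
  then have "isCont (\<lambda>y. f (ta - y)) s" by (rule isCont_shift)
  then have 2: "\<forall>\<^sub>F y in nhds s. f (ta - y) > 0"
    using pos by (intro order_tendstoD(1)[of "\<lambda>y. f (ta - y)" "f (ta - s)"])
      (simp_all add: isCont_def tendsto_at_iff_tendsto_nhds[of "\<lambda>y. f (ta - y)"])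
  have W: "((wronskian f ta tb) \<longlongrightarrow> wronskian f ta tb s) (nhds s)"
    using isCont_wronskian[OF C1] by (simp add: isCont_def tendsto_at_iff_tendsto_nhds)
  define P where "P = (\<lambda>w::real. if wronskian f ta tb s > 0 then w > 0 else w < 0)"
  have 3: "\<forall>\<^sub>F y in nhds s. P (wronskian f ta tb y)"
    unfolding P_def using nz order_tendstoD[OF W, of 0] by (cases "wronskian f ta tb s > 0") auto
  have "\<forall>\<^sub>F y in nhds s. C1_near f (ta - y) \<and> C1_near f (tb - y) \<and> f (ta - y) > 0 \<and> P (wronskian f ta tb y)"
    using 1 2 3 by eventually_elim auto
  then obtain e where e: "e > 0" "\<And>y. dist y s < e \<Longrightarrow> C1_near f (ta - y) \<and> C1_near f (tb - y) \<and> f (ta - y) > 0 \<and> P (wronskian f ta tb y)"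
    unfolding eventually_nhds_metric by auto
  show ?thesis
  proof (intro exI[of _ e] conjI allI impI)
    fix j1 j2 assume j: "s - e < j1" "j1 < s" "s < j2" "j2 < s + e"
    have *: "C1_near f (ta - y) \<and> C1_near f (tb - y) \<and> f (ta - y) > 0 \<and> P (wronskian f ta tb y)"
      if "y \<in> {j1..j2}" for y using that j by (intro e(2)) (auto simp: dist_real_def)
    then show "branch_interval f ta tb j1 j2"
      unfolding branch_interval_def using j by (cases "wronskian f ta tb s > 0") (auto simp: P_def)
  qed (fact e)
qed

locale branch =
  fixes f :: "real \<Rightarrow> real" and ta tb j1 j2 :: real
  assumes f_measurable [measurable]: "f \<in> borel_measurable borel"
    and br: "branch_interval f ta tb j1 j2"
begin

abbreviation "J \<equiv> {j1..j2}"
abbreviation "q \<equiv> height_ratio f ta tb"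
abbreviation "d \<equiv> wronskian f ta tb"
abbreviation "\<sigma> \<equiv> branch_inv f ta tb j1 j2"

lemma j_less: "j1 < j2" using br by (simp add: branch_interval_def)

lemma f_pos: "s \<in> J \<Longrightarrow> f (ta - s) > 0" using br by (simp add: branch_interval_def)

lemma q_measurable [measurable]: "q \<in> borel_measurable borel"
  unfolding height_ratio_def[abs_def] by measurable

lemma d_cont: "continuous_on J d"
  using br by (intro continuous_at_imp_continuous_on ballI isCont_wronskian) (auto simp: branch_interval_def)

lemma q_deriv:
  assumes "s \<in> J" shows "(q has_real_derivative - d s / (f (ta - s))\<^sup>2) (at s)"
proof -
  have der: "((\<lambda>s. f (c - s)) has_real_derivative - deriv f (c - s)) (at s)" if "C1_near f (c - s)" for c
    by (rule DERIV_cong, rule DERIV_chain2[where f = f and g = "\<lambda>s. c - s", OF C1_near_has_derivative[OF that]])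
       (auto intro!: derivative_eq_intros)
  have C: "C1_near f (ta - s)" "C1_near f (tb - s)" "f (ta - s) > 0"
    using assms br by (auto simp: branch_interval_def)
  show ?thesis unfolding height_ratio_def[abs_def]
    using C(3) by (auto intro!: derivative_eq_intros der C simp: wronskian_def field_simps power2_eq_square)
qed

lemma q_cont: "continuous_on J q"
  by (intro continuous_at_imp_continuous_on ballI) (use q_deriv in \<open>auto dest: DERIV_isCont\<close>)

lemma d_sign: "(\<forall>s\<in>J. d s > 0) \<or> (\<forall>s\<in>J. d s < 0)"
  using br by (simp add: branch_interval_def)

lemma q_strict:
  "(\<forall>s\<in>J. \<forall>s'\<in>J. s < s' \<longrightarrow> q s < q s') \<or> (\<forall>s\<in>J. \<forall>s'\<in>J. s < s' \<longrightarrow> q s > q s')"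
  using d_sign
proof (elim disjE)
  assume *: "\<forall>s\<in>J. d s > 0"
  have "q s > q s'" if "s \<in> J" "s' \<in> J" "s < s'" for s s'
  proof (rule DERIV_neg_imp_decreasing[OF that(3)])
    fix x assume "s \<le> x" "x \<le> s'"
    then have "x \<in> J" using that by auto
    then show "\<exists>y. (q has_real_derivative y) (at x) \<and> y < 0"
      using q_deriv[of x] * f_pos[of x]
        by (intro exI[of _ "- d x / (f (ta - x))\<^sup>2"]) (auto intro!: divide_neg_pos)
  qed
  then show ?thesis by blast
next
  assume *: "\<forall>s\<in>J. d s < 0"
  have "q s < q s'" if "s \<in> J" "s' \<in> J" "s < s'" for s s'
  proof (rule DERIV_pos_imp_increasing[OF that(3)])
    fix x assume "s \<le> x" "x \<le> s'"
    then have "x \<in> J" using that by auto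
    then show "\<exists>y. (q has_real_derivative y) (at x) \<and> y > 0"
      using q_deriv[of x] * f_pos[of x]
        by (intro exI[of _ "- d x / (f (ta - x))\<^sup>2"]) (auto intro!: divide_neg_pos)
  qed
  then show ?thesis by blast
qed

lemma q_inj: "inj_on q J"
proof (rule inj_onI)
  fix s s' assume "s \<in> J" "s' \<in> J" "q s = q s'"
  then show "s = s'" using q_strict by (cases s s' rule: linorder_cases) force+
qed

lemma \<sigma>_q [simp]: "s \<in> J \<Longrightarrow> \<sigma> (q s) = s"
  by (auto simp: branch_inv_def q_inj)

lemma \<sigma>_in [simp]: "\<sigma> r \<in> J"
proof (cases "r \<in> q ` J")
  case True
  then show ?thesis by (simp add: branch_inv_def inv_into_into del: atLeastAtMost_iff)
qed (use j_less in \<open>simp add: branch_inv_def\<close>)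

lemma q_\<sigma>: "r \<in> q ` J \<Longrightarrow> q (\<sigma> r) = r"
  by (auto simp: branch_inv_def f_inv_into_f q_inj simp del: atLeastAtMost_iff)

lemma qJ_sets [measurable]: "q ` J \<in> sets borel"
  using compact_continuous_image[OF q_cont] by (simp add: borel_compact)

lemma \<sigma>_measurable [measurable]: "\<sigma> \<in> borel_measurable borel"
proof -
  have "continuous_on (q ` J) (inv_into J q)"
    by (rule continuous_on_inv[OF q_cont]) (auto simp: q_inj)
  then have "(\<lambda>r. if r \<in> q ` J then inv_into J q r else j1) \<in> borel_measurable borel"
    by (intro borel_measurable_continuous_on_if qJ_sets continuous_on_const)
  then show ?thesis by (simp add: branch_inv_def[abs_def])
qed

lemma qJ_interval: "q ` J = {min (q j1) (q j2)..max (q j1) (q j2)}"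
proof
  show "q ` J \<subseteq> {min (q j1) (q j2)..max (q j1) (q j2)}"
  proof
    fix r assume "r \<in> q ` J"
    then obtain s where s: "s \<in> J" "r = q s" by auto
    have J: "j1 \<in> J" "j2 \<in> J" using j_less by auto
    from q_strict show "r \<in> {min (q j1) (q j2)..max (q j1) (q j2)}"
    proof
      assume "\<forall>s\<in>J. \<forall>s'\<in>J. s < s' \<longrightarrow> q s < q s'"
      then have "q j1 \<le> q s" "q s \<le> q j2" using s J by (metis atLeastAtMost_iff order_le_less)+
      then show ?thesis using s by auto
    next
      assume "\<forall>s\<in>J. \<forall>s'\<in>J. s < s' \<longrightarrow> q s > q s'"
      then have "q j2 \<le> q s" "q s \<le> q j1" using s J by (metis atLeastAtMost_iff order_le_less)+
      then show ?thesis using s by auto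
    qed
  qed
  show "{min (q j1) (q j2)..max (q j1) (q j2)} \<subseteq> q ` J"
  proof
    fix r assume r: "r \<in> {min (q j1) (q j2)..max (q j1) (q j2)}"
    show "r \<in> q ` J"
    proof (cases "q j1 \<le> q j2")
      case True
      then obtain x where "j1 \<le> x" "x \<le> j2" "q x = r"
        using IVT'[of q j1 r j2] r j_less q_cont by auto
      then show ?thesis by auto
    next
      case False
      then obtain x where "j1 \<le> x" "x \<le> j2" "q x = r"
        using IVT2'[of q j2 r j1] r j_less q_cont by auto
      then show ?thesis by auto
    qed
  qed
qed

text \<open>Substitution of \<open>r = q s\<close>, whose derivative has absolute value \<open>\<bar>d s\<bar> / (f (ta - s))\<^sup>2\<close>.\<close>

lemma q_substitution:
  assumes [measurable]: "h \<in> borel_measurable borel"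
  shows "(\<integral>\<^sup>+s. indicator J s * (h (q s) * ennreal (\<bar>d s\<bar> / (f (ta - s))\<^sup>2)) \<partial>lborel)
       = (\<integral>\<^sup>+r. indicator (q ` J) r * h r \<partial>lborel)"
proof -
  define dq where "dq s = - d s / (f (ta - s))\<^sup>2" for s
  have "continuous_on J (\<lambda>s. f (ta - s))"
    using br by (intro continuous_at_imp_continuous_on ballI isCont_shift)
      (auto simp: branch_interval_def dest!: C1_near_has_derivative DERIV_isCont)
  then have dq_cont: "continuous_on J dq" unfolding dq_def[abs_def]
    using f_pos by (intro continuous_intros d_cont) force+
  have dq: "(q has_real_derivative dq s) (at s)" if "s \<in> J" for s
    using q_deriv[OF that] by (simp add: dq_def)
  from d_sign show ?thesis
  proof
    assume neg: "\<forall>s\<in>J. d s < 0"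
    then have nn: "dq s \<ge> 0" if "s \<in> J" for s using that by (auto simp: dq_def divide_nonpos_nonneg less_imp_le)
    have mono: "q j1 < q j2"
      using DERIV_pos_imp_increasing[OF j_less, of q] q_deriv neg f_pos
      by (metis atLeastAtMost_iff divide_neg_pos minus_divide_left neg_0_less_iff_less zero_less_power)
    have "(\<integral>\<^sup>+r. indicator (q ` J) r * h r \<partial>lborel) = (\<integral>\<^sup>+r. h r * indicator {q j1..q j2} r \<partial>lborel)"
      using mono by (simp add: qJ_interval mult.commute)
    also have "\<dots> = (\<integral>\<^sup>+s. h (q s) * ennreal (dq s) * indicator J s \<partial>lborel)"
      by (rule nn_integral_substitution_aux[OF _ _ dq dq_cont nn j_less]) auto
    also have "\<dots> = (\<integral>\<^sup>+s. indicator J s * (h (q s) * ennreal (\<bar>d s\<bar> / (f (ta - s))\<^sup>2)) \<partial>lborel)"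
      using neg by (intro nn_integral_cong)
        (auto simp: dq_def mult_ac abs_of_neg abs_of_pos split: split_indicator)
    finally show ?thesis ..
  next
    \<comment> \<open>The ratio decreases; reflecting the line turns it into an increasing substitution.\<close>
    assume neg: "\<forall>s\<in>J. d s > 0"
    then have nn: "- dq s \<ge> 0" if "s \<in> J" for s using that by (auto simp: dq_def less_imp_le)
    have mono: "q j2 < q j1"
      using DERIV_neg_imp_decreasing[OF j_less, of q] q_deriv neg f_pos
      by (metis atLeastAtMost_iff divide_pos_pos minus_divide_left neg_less_0_iff_less zero_less_power)
    have "(\<integral>\<^sup>+r. indicator (q ` J) r * h r \<partial>lborel) = (\<integral>\<^sup>+r. indicator (q ` J) (-r) * h (-r) \<partial>lborel)"
      using nn_integral_real_affine[of "\<lambda>r. indicator (q ` J) r * h r" "-1" 0] by simp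
    also have "\<dots> = (\<integral>\<^sup>+r. h (- r) * indicator {- q j1..- q j2} r \<partial>lborel)"
      using mono by (intro nn_integral_cong) (auto simp: qJ_interval split: split_indicator)
    also have "\<dots> = (\<integral>\<^sup>+s. h (- (- q s)) * ennreal (- dq s) * indicator J s \<partial>lborel)"
      by (rule nn_integral_substitution_aux[where f = "\<lambda>r. h (- r)" and g = "\<lambda>s. - q s"])
         (use nn j_less in \<open>auto intro!: derivative_eq_intros dq continuous_intros dq_cont\<close>)
    also have "\<dots> = (\<integral>\<^sup>+s. indicator J s * (h (q s) * ennreal (\<bar>d s\<bar> / (f (ta - s))\<^sup>2)) \<partial>lborel)"
      using neg by (intro nn_integral_cong)
        (auto simp: dq_def mult_ac abs_of_neg abs_of_pos split: split_indicator)
    finally show ?thesis ..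
  qed
qed

lemma indicator_d_measurable [measurable]: "(\<lambda>s. indicator J s * \<bar>d s\<bar>) \<in> borel_measurable borel"
proof -
  have "(\<lambda>s. indicator J s *\<^sub>R \<bar>d s\<bar>) \<in> borel_measurable borel"
    by (intro borel_measurable_continuous_on_indicator continuous_intros d_cont) auto
  then show ?thesis by simp
qed

text \<open>The heights are \<open>v\<close> at \<open>ta\<close> and \<open>v r\<close> at \<open>tb\<close>, so \<open>u \<bar>d s\<bar> ds du = dv d(v r) = v dv dr\<close>. It is proved
  one variable at a time: \<open>v = u f (ta - s)\<close> for fixed \<open>s\<close>, then \<open>r = q s\<close> for fixed \<open>v\<close>. The point of these
  coordinates is that the measure \<open>v dv dr\<close> refers neither to the profile nor to the interval.\<close>

lemma area_formula:
  assumes [measurable]: "h \<in> borel_measurable (borel \<Otimes>\<^sub>M borel)"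
  shows "(\<integral>\<^sup>+s. indicator J s * (\<integral>\<^sup>+u. indicator {0<..} u * (h (s, u) * ennreal (u * \<bar>d s\<bar>)) \<partial>lborel) \<partial>lborel)
       = (\<integral>\<^sup>+v. indicator {0<..} v *
            (\<integral>\<^sup>+r. indicator (q ` J) r * (h (\<sigma> r, v / f (ta - \<sigma> r)) * ennreal v) \<partial>lborel) \<partial>lborel)"
proof -
  \<comment> \<open>Cut off outside \<open>J\<close>, since continuity makes the Wronskian measurable only on \<open>J\<close>.\<close>
  let ?D = "\<lambda>s. indicator J s * \<bar>d s\<bar>"
  let ?G = "\<lambda>s v. indicator J s * (indicator {0<..} v * (h (s, v / f (ta - s)) *
      (ennreal v * ennreal (?D s / (f (ta - s))\<^sup>2))))"
  have inner: "indicator J s * (\<integral>\<^sup>+u. indicator {0<..} u * (h (s, u) * ennreal (u * \<bar>d s\<bar>)) \<partial>lborel)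
      = (\<integral>\<^sup>+v. ?G s v \<partial>lborel)" for s
  proof (cases "s \<in> J")
    case True
    have pos: "f (ta - s) > 0" using f_pos[OF True] .
    have "(\<integral>\<^sup>+u. indicator {0<..} u * (h (s, u) * ennreal (u * \<bar>d s\<bar>)) \<partial>lborel)
        = ennreal (1 / f (ta - s)) * (\<integral>\<^sup>+v. indicator {0<..} (v / f (ta - s)) *
             (h (s, v / f (ta - s)) * ennreal (v / f (ta - s) * \<bar>d s\<bar>)) \<partial>lborel)"
      using pos by (subst nn_integral_real_affine[where c = "1 / f (ta - s)" and t = 0]) auto
    also have "\<dots> = (\<integral>\<^sup>+v. ennreal (1 / f (ta - s)) * (indicator {0<..} (v / f (ta - s)) *
             (h (s, v / f (ta - s)) * ennreal (v / f (ta - s) * \<bar>d s\<bar>))) \<partial>lborel)"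
      by (rule nn_integral_cmult[symmetric]) measurable
    also have "\<dots> = (\<integral>\<^sup>+v. ?G s v \<partial>lborel)"
    proof (intro nn_integral_cong)
      fix v :: real
      show "ennreal (1 / f (ta - s)) * (indicator {0<..} (v / f (ta - s)) *
             (h (s, v / f (ta - s)) * ennreal (v / f (ta - s) * \<bar>d s\<bar>))) = ?G s v"
      proof (cases "v > 0")
        case True
        have "ennreal (1 / f (ta - s)) * ennreal (v / f (ta - s) * \<bar>d s\<bar>)
            = ennreal v * ennreal (\<bar>d s\<bar> / (f (ta - s))\<^sup>2)"
          using pos True by (simp add: ennreal_mult[symmetric] power2_eq_square)
        then have "ennreal (1 / f (ta - s)) * (h (s, v / f (ta - s)) * ennreal (v / f (ta - s) * \<bar>d s\<bar>))
            = h (s, v / f (ta - s)) * (ennreal v * ennreal (\<bar>d s\<bar> / (f (ta - s))\<^sup>2))"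
          by (metis mult.left_commute)
        then show ?thesis using pos True \<open>s \<in> J\<close> by simp
      qed (use pos in \<open>simp add: zero_less_divide_iff\<close>)
    qed
    finally show ?thesis using True by simp
  qed simp
  have "(\<integral>\<^sup>+s. indicator J s * (\<integral>\<^sup>+u. indicator {0<..} u * (h (s, u) * ennreal (u * \<bar>d s\<bar>)) \<partial>lborel) \<partial>lborel)
      = (\<integral>\<^sup>+s. (\<integral>\<^sup>+v. ?G s v \<partial>lborel) \<partial>lborel)"
    by (simp only: inner)
  also have "\<dots> = (\<integral>\<^sup>+v. (\<integral>\<^sup>+s. ?G s v \<partial>lborel) \<partial>lborel)"
    by (rule lborel_pair.Fubini') measurable
  also have "\<dots> = (\<integral>\<^sup>+v. indicator {0<..} v *
            (\<integral>\<^sup>+r. indicator (q ` J) r * (h (\<sigma> r, v / f (ta - \<sigma> r)) * ennreal v) \<partial>lborel) \<partial>lborel)"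
  proof (rule nn_integral_cong)
    fix v :: real
    show "(\<integral>\<^sup>+s. ?G s v \<partial>lborel) = indicator {0<..} v *
            (\<integral>\<^sup>+r. indicator (q ` J) r * (h (\<sigma> r, v / f (ta - \<sigma> r)) * ennreal v) \<partial>lborel)"
    proof (cases "v > 0")
      case True
      have "(\<integral>\<^sup>+s. ?G s v \<partial>lborel) = (\<integral>\<^sup>+s. indicator J s *
          ((\<lambda>r. h (\<sigma> r, v / f (ta - \<sigma> r)) * ennreal v) (q s) * ennreal (\<bar>d s\<bar> / (f (ta - s))\<^sup>2)) \<partial>lborel)"
        using True by (intro nn_integral_cong) (auto simp: mult_ac split: split_indicator)
      also have "\<dots> = (\<integral>\<^sup>+r. indicator (q ` J) r * (h (\<sigma> r, v / f (ta - \<sigma> r)) * ennreal v) \<partial>lborel)"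
        by (rule q_substitution) measurable
      finally show ?thesis using True by simp
    qed simp
  qed
  finally show ?thesis .
qed

end


section \<open>The intensity measure\<close>

text \<open>The tail of \<open>u\<^sup>-\<^sup>2 du\<close> beyond \<open>1 / c\<close> is linear in \<open>c\<close>, which turns intensities of exceedance
  sets into integrals of profiles.\<close>

lemma tail_integral:
  assumes "c \<ge> 0"
  shows "(\<integral>\<^sup>+u. indicator {0<..} u * (indicator {u. u * c \<ge> 1} u * ennreal (1 / u\<^sup>2)) \<partial>lborel) = ennreal c"
proof (cases "c = 0")
  case False
  then have c: "c > 0" using assms by simp
  have "(\<integral>\<^sup>+u. indicator {0<..} u * (indicator {u. u * c \<ge> 1} u * ennreal (1 / u\<^sup>2)) \<partial>lborel)
      = (\<integral>\<^sup>+u. ennreal (1 / u\<^sup>2) * indicator {1 / c..} u \<partial>lborel)"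
  proof (intro nn_integral_cong)
    fix u :: real
    have "0 < u \<and> 1 \<le> u * c \<longleftrightarrow> 1 / c \<le> u"
      using c by (auto simp: field_simps) (smt (verit) mult_nonneg_nonpos)
    then show "indicator {0<..} u * (indicator {u. u * c \<ge> 1} u * ennreal (1 / u\<^sup>2))
        = ennreal (1 / u\<^sup>2) * indicator {1 / c..} u"
      by (auto split: split_indicator)
  qed
  also have "\<dots> = ennreal (0 - (- (1 / (1 / c))))"
  proof (rule nn_integral_FTC_atLeast)
    show "((\<lambda>x. - (1 / x)) has_real_derivative 1 / x\<^sup>2) (at x)" if "1 / c \<le> x" for x :: real
    proof -
      have "0 < 1 / c" using c by simp
      then have "x > 0" using that by linarith
      then show ?thesis by (auto intro!: derivative_eq_intros simp: power2_eq_square)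
    qed
    show "((\<lambda>x. - (1 / x)) \<longlongrightarrow> 0) (at_top :: real filter)" 
      using tendsto_minus[OF tendsto_inverse_0_at_top[OF filterlim_ident]] by (simp add: inverse_eq_divide)
  qed auto
  finally show ?thesis by simp
qed simp

locale storm_model =
  fixes G :: "(real \<Rightarrow> real) set" and PF :: "(real \<Rightarrow> real) measure"
    and l :: nat and t :: "nat \<Rightarrow> real"
  assumes G_fin: "finite G"
    and G_meas: "\<And>f. f \<in> G \<Longrightarrow> f \<in> borel_measurable borel"
    and G_nonneg: "\<And>f x. f \<in> G \<Longrightarrow> f x \<ge> 0"
    and PF_prob: "prob_space PF"
    and sets_PF: "sets PF = Pow G"
    and PF_pos: "\<And>f. f \<in> G \<Longrightarrow> measure PF {f} > 0"
    and F_mean: "(\<integral>\<^sup>+f. (\<integral>\<^sup>+x. ennreal (f x) \<partial>lborel) \<partial>PF) = 1"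
    and l_pos: "l \<ge> 1"
begin

(* Storms stay unsplit: most facts are about \<open>height p i\<close> for a variable \<open>p\<close>. *)
declare split_paired_All [simp del] split_paired_Ex [simp del]

abbreviation "\<Lambda> \<equiv> storm_intensity PF"
abbreviation "V \<equiv> vec_space l"
abbreviation "L \<equiv> {1..l}"
abbreviation "uspace \<equiv> density (restrict_space lborel {0<..}) (\<lambda>u::real. ennreal (1 / u\<^sup>2))"

definition height :: "storm \<Rightarrow> nat \<Rightarrow> real" where
  "height p i = (case p of (s, u, f) \<Rightarrow> u * f (t i - s))"

definition heights :: "storm \<Rightarrow> nat \<Rightarrow> real" where
  "heights p = (\<lambda>i\<in>L. height p i)"

lemma height_simp [simp]: "height (s, u, f) i = u * f (t i - s)"
  by (simp add: height_def)

lemma heights_apply [simp]: "i \<in> L \<Longrightarrow> heights p i = height p i"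
  by (simp add: heights_def)

lemma space_PF: "space PF = G"
  using sets_PF by (metis Pow_top Pow_iff sets.sets_into_space sets.top subset_antisym)

lemma sets_PF_count: "sets PF = sets (count_space G)"
  by (simp add: sets_PF)

lemma measurable_PF: "(\<And>f. f \<in> G \<Longrightarrow> h f \<in> space N) \<Longrightarrow> h \<in> measurable PF N"
  by (subst measurable_cong_sets[OF sets_PF_count refl]) auto

lemma space_\<Lambda>: "space \<Lambda> = UNIV \<times> {0<..} \<times> G"
  by (simp add: storm_intensity_def space_pair_measure space_PF space_restrict_space)

lemma in_space_\<Lambda> [simp]: "(s, u, f) \<in> space \<Lambda> \<longleftrightarrow> u > 0 \<and> f \<in> G"
  by (auto simp: space_\<Lambda>)

lemma height_nonneg: "p \<in> space \<Lambda> \<Longrightarrow> height p i \<ge> 0"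
  by (cases p) (simp add: G_nonneg)

lemma sigma_finite_uspace: "sigma_finite_measure uspace"
proof -
  interpret sigma_finite_measure "restrict_space lborel {0<..} :: real measure"
    by (rule sigma_finite_measure_restrict_space) (auto intro: lborel.sigma_finite_measure_axioms)
  show ?thesis
    by (subst sigma_finite_iff_density_finite) (auto intro!: measurable_restrict_space1)
qed

lemma sigma_finite_PF: "sigma_finite_measure PF"
  using PF_prob prob_space_imp_sigma_finite by blast

lemma sigma_finite_\<Lambda>: "sigma_finite_measure \<Lambda>"
  unfolding storm_intensity_def
  by (intro sigma_finite_pair_measure sigma_finite_uspace sigma_finite_PF lborel.sigma_finite_measure_axioms)

lemma measurable_shift [measurable]: "fst \<in> borel_measurable \<Lambda>"
  unfolding storm_intensity_def by measurable

lemma measurable_amplitude [measurable]: "(\<lambda>p. fst (snd p)) \<in> borel_measurable \<Lambda>"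
proof -
  have "(\<lambda>p. fst (snd p)) \<in> measurable \<Lambda> uspace"
    unfolding storm_intensity_def by measurable
  moreover have "(\<lambda>x. x) \<in> measurable uspace borel"
    by (auto intro!: measurable_restrict_space1)
  ultimately show ?thesis by (rule measurable_compose)
qed

lemma measurable_mark [measurable]: "(\<lambda>p. snd (snd p)) \<in> measurable \<Lambda> (count_space G)"
proof -
  have "(\<lambda>p. snd (snd p)) \<in> measurable \<Lambda> PF"
    unfolding storm_intensity_def by measurable
  then show ?thesis by (subst measurable_cong_sets[OF refl sets_PF_count[symmetric]])
qed

text \<open>A function of storms may be treated mark by mark, since the mark space is finite and discrete.\<close>

lemma measurable_markwise:
  assumes "\<And>f. f \<in> G \<Longrightarrow> (\<lambda>p. h f p) \<in> measurable \<Lambda> N"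
  shows "(\<lambda>p. h (snd (snd p)) p) \<in> measurable \<Lambda> N"
  by (rule measurable_compose_countable'[where g = "\<lambda>p. snd (snd p)" and I = G])
     (use assms G_fin in \<open>auto intro: countable_finite\<close>)

lemma height_measurable [measurable]: "(\<lambda>p. height p i) \<in> borel_measurable \<Lambda>"
proof -
  have "(\<lambda>p. fst (snd p) * f (t i - fst p)) \<in> borel_measurable \<Lambda>" if "f \<in> G" for f
    using G_meas[OF that] by measurable
  from measurable_markwise[OF this] show ?thesis
    by (simp add: height_def case_prod_beta)
qed

lemma heights_measurable [measurable]: "heights \<in> measurable \<Lambda> V"
  unfolding heights_def[abs_def] vec_space_def by measurable

lemma nn_integral_uspace:
  assumes "(\<lambda>u. h u) \<in> borel_measurable uspace"
  shows "(\<integral>\<^sup>+u. h u \<partial>uspace) = (\<integral>\<^sup>+u. indicator {0<..} u * (h u * ennreal (1 / u\<^sup>2)) \<partial>lborel)"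
proof -
  have "h \<in> borel_measurable (restrict_space lborel {0<..})" using assms by simp
  then have "(\<integral>\<^sup>+u. h u \<partial>uspace) = (\<integral>\<^sup>+u. ennreal (1 / u\<^sup>2) * h u \<partial>restrict_space lborel {0<..})"
    by (subst nn_integral_density) (auto intro!: measurable_restrict_space1)
  also have "\<dots> = (\<integral>\<^sup>+u. indicator {0<..} u * (h u * ennreal (1 / u\<^sup>2)) \<partial>lborel)"
    by (subst nn_integral_restrict_space) (auto intro!: nn_integral_cong simp: mult_ac)
  finally show ?thesis .
qed

text \<open>The mark is integrated last: all later computations fix the profile first.\<close>

lemma nn_integral_intensity:
  assumes h [measurable]: "h \<in> borel_measurable \<Lambda>"
  shows "(\<integral>\<^sup>+p. h p \<partial>\<Lambda>) = (\<integral>\<^sup>+f. (\<integral>\<^sup>+s. (\<integral>\<^sup>+u. indicator {0<..} u * (h (s, u, f) * ennreal (1 / u\<^sup>2)) \<partial>lborel) \<partial>lborel) \<partial>PF)"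
proof -
  interpret U: sigma_finite_measure uspace by (rule sigma_finite_uspace)
  interpret P: prob_space PF by (rule PF_prob)
  interpret UP: pair_sigma_finite uspace PF ..
  interpret LP: pair_sigma_finite "lborel :: real measure" PF ..
  have h': "h \<in> borel_measurable (lborel \<Otimes>\<^sub>M (uspace \<Otimes>\<^sub>M PF))"
    using h by (simp add: storm_intensity_def)
  note [measurable] = h'
  have "(\<integral>\<^sup>+p. h p \<partial>\<Lambda>) = (\<integral>\<^sup>+s. (\<integral>\<^sup>+y. h (s, y) \<partial>(uspace \<Otimes>\<^sub>M PF)) \<partial>lborel)"
    unfolding storm_intensity_def 
    by (rule sigma_finite_measure.nn_integral_fst[symmetric, OF sigma_finite_pair_measure[OF sigma_finite_uspace sigma_finite_PF] h'])
  also have "\<dots> = (\<integral>\<^sup>+s. (\<integral>\<^sup>+f. (\<integral>\<^sup>+u. h (s, u, f) \<partial>uspace) \<partial>PF) \<partial>lborel)"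
  proof (rule nn_integral_cong)
    fix s :: real
    show "(\<integral>\<^sup>+y. h (s, y) \<partial>(uspace \<Otimes>\<^sub>M PF)) = (\<integral>\<^sup>+f. (\<integral>\<^sup>+u. h (s, u, f) \<partial>uspace) \<partial>PF)"
      by (rule UP.nn_integral_snd[symmetric, of "\<lambda>y. h (s, y)"]) measurable
  qed
  also have "\<dots> = (\<integral>\<^sup>+f. (\<integral>\<^sup>+s. (\<integral>\<^sup>+u. h (s, u, f) \<partial>uspace) \<partial>lborel) \<partial>PF)"
    by (rule LP.Fubini'[symmetric]) measurable
  also have "\<dots> = (\<integral>\<^sup>+f. (\<integral>\<^sup>+s. (\<integral>\<^sup>+u. indicator {0<..} u * (h (s, u, f) * ennreal (1 / u\<^sup>2)) \<partial>lborel) \<partial>lborel) \<partial>PF)"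
    by (intro nn_integral_cong nn_integral_uspace) measurable
  finally show ?thesis .
qed

lemma AE_intensityI:
  assumes [measurable]: "Measurable.pred \<Lambda> P"
    and "\<And>f s. f \<in> G \<Longrightarrow> AE u in lborel. u > 0 \<longrightarrow> P (s, u, f)"
  shows "AE p in \<Lambda>. P p"
proof -
  have "emeasure \<Lambda> {p \<in> space \<Lambda>. \<not> P p} = (\<integral>\<^sup>+p. indicator {p \<in> space \<Lambda>. \<not> P p} p \<partial>\<Lambda>)"
    by (rule nn_integral_indicator[symmetric]) measurable
  also have "\<dots> = (\<integral>\<^sup>+f. (\<integral>\<^sup>+s. (\<integral>\<^sup>+u. indicator {0<..} u * (indicator {p \<in> space \<Lambda>. \<not> P p} (s, u, f) * ennreal (1 / u\<^sup>2)) \<partial>lborel) \<partial>lborel) \<partial>PF)"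
    by (rule nn_integral_intensity) measurable
  also have "\<dots> = (\<integral>\<^sup>+f. (\<integral>\<^sup>+s. 0 \<partial>(lborel :: real measure)) \<partial>PF)"
  proof (rule nn_integral_cong, rule nn_integral_cong)
    fix f and s :: real assume "f \<in> space PF"
    then have f: "f \<in> G" by (simp add: space_PF)
    have "(\<integral>\<^sup>+u. indicator {0<..} u * (indicator {p \<in> space \<Lambda>. \<not> P p} (s, u, f) * ennreal (1 / u\<^sup>2)) \<partial>lborel)
      = (\<integral>\<^sup>+u. 0 \<partial>(lborel :: real measure))"
      using assms(2)[OF f, of s] by (intro nn_integral_cong_AE) (auto split: split_indicator)
    then show "(\<integral>\<^sup>+u. indicator {0<..} u * (indicator {p \<in> space \<Lambda>. \<not> P p} (s, u, f) * ennreal (1 / u\<^sup>2)) \<partial>lborel) = 0"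
      by simp
  qed
  also have "\<dots> = 0" by simp
  finally show ?thesis by (subst AE_iff_measurable[OF _ refl]) auto
qed

text \<open>For fixed shift and profile a positive height is a nonzero multiple of the amplitude, whose law
  has a Lebesgue density.\<close>

lemma AE_height:
  assumes [measurable]: "Measurable.pred borel Q" and ae: "AE x in lborel. Q x"
  shows "AE p in \<Lambda>. height p i > 0 \<longrightarrow> Q (height p i)"
proof (rule AE_intensityI)
  fix f and s :: real assume f: "f \<in> G"
  show "AE u in lborel. u > 0 \<longrightarrow> height (s, u, f) i > 0 \<longrightarrow> Q (height (s, u, f) i)"
  proof (cases "f (t i - s) = 0")
    case False
    from AE_borel_affine[OF this _ ae, of 0] show ?thesis by (auto simp: mult.commute)
  qed simp
qed measurable

lemma emeasure_tail:
  assumes r: "\<And>f. f \<in> G \<Longrightarrow> (\<lambda>s. r f s) \<in> borel_measurable borel" and nn: "\<And>f s. f \<in> G \<Longrightarrow> r f s \<ge> 0"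
  shows "emeasure \<Lambda> {p \<in> space \<Lambda>. fst (snd p) * r (snd (snd p)) (fst p) \<ge> 1}
    = (\<integral>\<^sup>+f. (\<integral>\<^sup>+s. ennreal (r f s) \<partial>lborel) \<partial>PF)"
proof -
  have [measurable]: "(\<lambda>p. r (snd (snd p)) (fst p)) \<in> borel_measurable \<Lambda>"
    using measurable_compose[OF measurable_shift r] by (rule measurable_markwise)
  let ?A = "{p \<in> space \<Lambda>. fst (snd p) * r (snd (snd p)) (fst p) \<ge> 1}"
  have [measurable]: "?A \<in> sets \<Lambda>" by measurable
  have "emeasure \<Lambda> ?A = (\<integral>\<^sup>+p. indicator ?A p \<partial>\<Lambda>)" by (rule nn_integral_indicator[symmetric]) measurable
  also have "\<dots> = (\<integral>\<^sup>+f. (\<integral>\<^sup>+s. (\<integral>\<^sup>+u. indicator {0<..} u * (indicator ?A (s, u, f) * ennreal (1 / u\<^sup>2)) \<partial>lborel) \<partial>lborel) \<partial>PF)"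
    by (rule nn_integral_intensity) measurable
  also have "\<dots> = (\<integral>\<^sup>+f. (\<integral>\<^sup>+s. ennreal (r f s) \<partial>lborel) \<partial>PF)"
  proof (rule nn_integral_cong, rule nn_integral_cong)
    fix f and s :: real assume "f \<in> space PF"
    then have f: "f \<in> G" by (simp add: space_PF)
    have "(\<integral>\<^sup>+u. indicator {0<..} u * (indicator ?A (s, u, f) * ennreal (1 / u\<^sup>2)) \<partial>lborel)
       = (\<integral>\<^sup>+u. indicator {0<..} u * (indicator {u. u * r f s \<ge> 1} u * ennreal (1 / u\<^sup>2)) \<partial>lborel)"
      using f by (intro nn_integral_cong) (auto split: split_indicator)
    also have "\<dots> = ennreal (r f s)" by (rule tail_integral) (use f nn in auto)
    finally show "(\<integral>\<^sup>+u. indicator {0<..} u * (indicator ?A (s, u, f) * ennreal (1 / u\<^sup>2)) \<partial>lborel) = ennreal (r f s)" .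
  qed
  finally show ?thesis .
qed

lemma integral_profile_shift:
  assumes "f \<in> G"
  shows "(\<integral>\<^sup>+s. ennreal (f (c - s)) \<partial>lborel) = (\<integral>\<^sup>+x. ennreal (f x) \<partial>lborel)"
  using nn_integral_real_affine[of "\<lambda>x. ennreal (f x)" "-1" c] G_meas[OF assms] by simp

definition exceed :: "(nat \<Rightarrow> real) \<Rightarrow> storm set" where
  "exceed z = {p \<in> space \<Lambda>. \<exists>i\<in>L. height p i \<ge> z i}"

lemma exceed_sets [measurable]: "exceed z \<in> sets \<Lambda>"
  unfolding exceed_def by measurable

lemma L_ne: "L \<noteq> {}" using l_pos by auto

text \<open>A storm \<open>(s, u, f)\<close> reaches \<open>z\<close> somewhere if and only if
  \<open>u * (MAX i. f (t i - s) / z i) \<ge> 1\<close>.\<close>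

lemma emeasure_exceed:
  assumes z: "\<And>i. i \<in> L \<Longrightarrow> z i > 0"
  shows "emeasure \<Lambda> (exceed z) = (\<integral>\<^sup>+f. (\<integral>\<^sup>+s. ennreal (Max ((\<lambda>i. f (t i - s) / z i) ` L)) \<partial>lborel) \<partial>PF)"
proof -
  have nn: "Max ((\<lambda>i. f (t i - s) / z i) ` L) \<ge> 0" if "f \<in> G" for f s
  proof -
    have "Max ((\<lambda>i. f (t i - s) / z i) ` L) \<in> (\<lambda>i. f (t i - s) / z i) ` L"
      using L_ne by (intro Max_in) auto
    then show ?thesis using that G_nonneg z by (auto intro!: divide_nonneg_pos)
  qed
  have "exceed z = {p \<in> space \<Lambda>. fst (snd p) * (\<lambda>f s. Max ((\<lambda>i. f (t i - s) / z i) ` L)) (snd (snd p)) (fst p) \<ge> 1}"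
  proof -
    have "(\<exists>i\<in>L. u * f (t i - s) \<ge> z i) \<longleftrightarrow> u * Max ((\<lambda>i. f (t i - s) / z i) ` L) \<ge> 1" if u: "u > 0" for u s f
    proof -
      have "u * Max ((\<lambda>i. f (t i - s) / z i) ` L) \<ge> 1 \<longleftrightarrow> Max ((\<lambda>i. f (t i - s) / z i) ` L) \<ge> 1 / u"
        using u by (simp add: field_simps)
      also have "\<dots> \<longleftrightarrow> (\<exists>i\<in>L. f (t i - s) / z i \<ge> 1 / u)"
        using L_ne by (subst Max_ge_iff) auto
      also have "\<dots> \<longleftrightarrow> (\<exists>i\<in>L. u * f (t i - s) \<ge> z i)"
        using u z by (intro bex_cong) (auto simp: field_simps)
      finally show ?thesis ..
    qed
    note eq = this
    show ?thesis unfolding exceed_def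
    proof (intro Collect_cong conj_cong refl)
      fix p assume "p \<in> space \<Lambda>"
      then obtain s u f where p: "p = (s, u, f)" "u > 0" by (cases p) auto
      show "(\<exists>i\<in>L. height p i \<ge> z i) \<longleftrightarrow> fst (snd p) * Max ((\<lambda>i. snd (snd p) (t i - fst p) / z i) ` L) \<ge> 1"
        using eq[OF p(2), of f s] unfolding p by (simp del: One_nat_def)
    qed
  qed
  also have "emeasure \<Lambda> \<dots> = (\<integral>\<^sup>+f. (\<integral>\<^sup>+s. ennreal (Max ((\<lambda>i. f (t i - s) / z i) ` L)) \<partial>lborel) \<partial>PF)"
  proof (rule emeasure_tail)
    fix f assume "f \<in> G"
    note [measurable] = G_meas[OF this]
    show "(\<lambda>s. Max ((\<lambda>i. f (t i - s) / z i) ` L)) \<in> borel_measurable borel"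
      by measurable
  qed (fact nn)
  finally show ?thesis .
qed

text \<open>The normalisation of the mean profile enters here: it makes every coordinate of the field
  standard Frechet.\<close>

lemma emeasure_height_tail:
  assumes "c > 0"
  shows "emeasure \<Lambda> {p \<in> space \<Lambda>. height p i \<ge> c} = ennreal (1 / c)"
proof -
  have "{p \<in> space \<Lambda>. height p i \<ge> c} = {p \<in> space \<Lambda>. fst (snd p) * (\<lambda>f s. f (t i - s) / c) (snd (snd p)) (fst p) \<ge> 1}"
    using assms by (auto simp: space_\<Lambda> field_simps)
  also have "emeasure \<Lambda> \<dots> = (\<integral>\<^sup>+f. (\<integral>\<^sup>+s. ennreal (f (t i - s) / c) \<partial>lborel) \<partial>PF)"
  proof (rule emeasure_tail)
    fix f assume "f \<in> G"
    note [measurable] = G_meas[OF this]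
    show "(\<lambda>s. f (t i - s) / c) \<in> borel_measurable borel" by measurable
  qed (use assms G_nonneg in auto)
  also have "\<dots> = (\<integral>\<^sup>+f. ennreal (1 / c) * (\<integral>\<^sup>+x. ennreal (f x) \<partial>lborel) \<partial>PF)"
  proof (rule nn_integral_cong)
    fix f assume "f \<in> space PF"
    then have f: "f \<in> G" by (simp add: space_PF)
    note [measurable] = G_meas[OF f]
    have "(\<integral>\<^sup>+s. ennreal (f (t i - s) / c) \<partial>lborel) = (\<integral>\<^sup>+s. ennreal (1 / c) * ennreal (f (t i - s)) \<partial>lborel)"
      using assms f G_nonneg by (intro nn_integral_cong) (simp add: ennreal_mult[symmetric])
    also have "\<dots> = ennreal (1 / c) * (\<integral>\<^sup>+s. ennreal (f (t i - s)) \<partial>lborel)"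
      by (rule nn_integral_cmult) measurable
    finally show "(\<integral>\<^sup>+s. ennreal (f (t i - s) / c) \<partial>lborel) = ennreal (1 / c) * (\<integral>\<^sup>+x. ennreal (f x) \<partial>lborel)"
      using integral_profile_shift[OF f] by simp
  qed
  also have "\<dots> = ennreal (1 / c) * (\<integral>\<^sup>+f. (\<integral>\<^sup>+x. ennreal (f x) \<partial>lborel) \<partial>PF)"
    by (rule nn_integral_cmult) (simp add: measurable_PF)
  finally show ?thesis by (simp add: F_mean)
qed

lemma emeasure_exceed_finite:
  assumes z: "\<And>i. i \<in> L \<Longrightarrow> z i > 0"
  shows "emeasure \<Lambda> (exceed z) < \<infinity>"
proof -
  have "emeasure \<Lambda> (exceed z) \<le> (\<Sum>i\<in>L. emeasure \<Lambda> {p \<in> space \<Lambda>. height p i \<ge> z i})"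
  proof -
    have "exceed z = (\<Union>i\<in>L. {p \<in> space \<Lambda>. height p i \<ge> z i})" by (auto simp: exceed_def)
    then show ?thesis by (simp add: emeasure_subadditive_finite image_subset_iff)
  qed
  also have "\<dots> = (\<Sum>i\<in>L. ennreal (1 / z i))" using z by (simp add: emeasure_height_tail)
  also have "\<dots> < \<infinity>" by simp
  finally show ?thesis .
qed

text \<open>The exponent function of the field at \<open>t 1, \<dots>, t l\<close>: the maxima stay below a positive vector \<open>z\<close>
  with probability \<open>exp (- excess z)\<close>.\<close>

definition excess :: "(nat \<Rightarrow> real) \<Rightarrow> real" where
  "excess z = measure \<Lambda> (exceed z)"

text \<open>Rescaling the amplitudes by \<open>c\<close> turns the measure \<open>u\<^sup>-\<^sup>2 du\<close> into \<open>c\<close> times itself,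
  so thresholds that are \<open>c\<close> times as high are exceeded with intensity \<open>1 / c\<close> times as large. Together with
  monotonicity this controls \<open>excess\<close> on small windows.\<close>

lemma excess_scale:
  assumes z: "\<And>i. i \<in> L \<Longrightarrow> z i > 0" and c: "c > 0"
  shows "excess (\<lambda>i. c * z i) = excess z / c"
proof -
  have "emeasure \<Lambda> (exceed (\<lambda>i. c * z i))
      = (\<integral>\<^sup>+f. ennreal (1 / c) * (\<integral>\<^sup>+s. ennreal (Max ((\<lambda>i. f (t i - s) / z i) ` L)) \<partial>lborel) \<partial>PF)"
  proof (subst emeasure_exceed)
    show "(\<integral>\<^sup>+f. (\<integral>\<^sup>+s. ennreal (Max ((\<lambda>i. f (t i - s) / (c * z i)) ` L)) \<partial>lborel) \<partial>PF)
      = (\<integral>\<^sup>+f. ennreal (1 / c) * (\<integral>\<^sup>+s. ennreal (Max ((\<lambda>i. f (t i - s) / z i) ` L)) \<partial>lborel) \<partial>PF)"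
    proof (rule nn_integral_cong)
      fix f assume "f \<in> space PF"
      then have f: "f \<in> G" by (simp add: space_PF)
      note [measurable] = G_meas[OF f]
      have "ennreal (Max ((\<lambda>i. f (t i - s) / (c * z i)) ` L)) = ennreal (1 / c) * ennreal (Max ((\<lambda>i. f (t i - s) / z i) ` L))" for s
      proof -
        have "mono (\<lambda>x::real. x / c)" using c by (intro monoI divide_right_mono) auto
        from mono_Max_commute[OF this, of "(\<lambda>i. f (t i - s) / z i) ` L"]
        have "Max ((\<lambda>i. f (t i - s) / (c * z i)) ` L) = Max ((\<lambda>i. f (t i - s) / z i) ` L) / c"
          using L_ne by (simp add: image_image field_simps)
        then show ?thesis using c by (simp add: ennreal_mult'[symmetric])
      qed
      then show "(\<integral>\<^sup>+s. ennreal (Max ((\<lambda>i. f (t i - s) / (c * z i)) ` L)) \<partial>lborel)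
          = ennreal (1 / c) * (\<integral>\<^sup>+s. ennreal (Max ((\<lambda>i. f (t i - s) / z i) ` L)) \<partial>lborel)"
        by (simp add: nn_integral_cmult)
    qed
  qed (use z c in auto)
  also have "\<dots> = ennreal (1 / c) * emeasure \<Lambda> (exceed z)"
    by (subst emeasure_exceed[OF z], assumption, rule nn_integral_cmult)
       (simp add: measurable_PF)
  finally show ?thesis using c by (simp add: excess_def measure_def enn2real_mult)
qed

lemma excess_antimono:
  assumes "\<And>i. i \<in> L \<Longrightarrow> z i > 0" "\<And>i. i \<in> L \<Longrightarrow> z i \<le> z' i"
  shows "excess z' \<le> excess z"
  unfolding excess_def
proof (rule measure_mono_fmeasurable)
  show "exceed z \<in> fmeasurable \<Lambda>" using emeasure_exceed_finite[of z] assms(1) by (simp add: fmeasurable_def)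
  show "exceed z' \<subseteq> exceed z" using assms(2) by (force simp: exceed_def)
qed measurable

lemma excess_nonneg: "excess z \<ge> 0" by (simp add: excess_def)

definition positive_heights :: "storm set" where
  "positive_heights = {p \<in> space \<Lambda>. \<forall>i\<in>L. height p i > 0}"

lemma positive_heights_sets [measurable]: "positive_heights \<in> sets \<Lambda>"
  unfolding positive_heights_def by measurable

lemma excess_cong: "(\<And>i. i \<in> L \<Longrightarrow> z i = z' i) \<Longrightarrow> excess z = excess z'"
  by (simp add: excess_def exceed_def)

text \<open>A section of a measurable set of pairs, measured by a \<open>\<sigma>\<close>-finite measure.\<close>

lemma excess_measurable [measurable]: "excess \<in> borel_measurable V"
proof -
  let ?Q = "{x \<in> space (V \<Otimes>\<^sub>M \<Lambda>). \<exists>i\<in>L. height (snd x) i \<ge> fst x i}"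
  have [measurable]: "(\<lambda>x. fst x i) \<in> borel_measurable (V \<Otimes>\<^sub>M \<Lambda>)" if "i \<in> L" for i
    using that unfolding vec_space_def by measurable
  have "?Q \<in> sets (V \<Otimes>\<^sub>M \<Lambda>)" by measurable
  from sigma_finite_measure.measurable_emeasure_Pair[OF sigma_finite_\<Lambda> this]
  have "(\<lambda>z. enn2real (emeasure \<Lambda> (Pair z -` ?Q))) \<in> borel_measurable V" by measurable
  moreover have "excess z = enn2real (emeasure \<Lambda> (Pair z -` ?Q))" if "z \<in> space V" for z
    unfolding excess_def measure_def exceed_def using that
    by (intro arg_cong[where f = "\<lambda>A. enn2real (emeasure \<Lambda> A)"]) (auto simp: space_pair_measure)
  ultimately show ?thesis by (subst measurable_cong) auto
qed

end


section \<open>Measurability of counts, maxima and leaders\<close>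

lemma num_points_finite: "finite X \<Longrightarrow> num_points X = of_nat (card X)"
  by (simp add: num_points_def emeasure_count_space_finite)

lemma num_points_eq_top_iff: "num_points X = \<infinity> \<longleftrightarrow> infinite X"
  by (cases "finite X") (simp_all add: num_points_def emeasure_count_space)

lemma num_points_eq_0_iff: "num_points X = 0 \<longleftrightarrow> X = {}"
  by (cases "finite X") (auto simp: num_points_def emeasure_count_space)

lemma num_points_eq_1_iff: "num_points X = 1 \<longleftrightarrow> card X = 1"
proof (cases "finite X")
  case True
  have "of_nat (card X) = (1 :: ennreal) \<longleftrightarrow> card X = 1" by (metis of_nat_1 of_nat_eq_iff)
  then show ?thesis using True by (simp add: num_points_finite)
qed (simp add: num_points_def emeasure_count_space)

lemma card_1_the_elem: "card X = 1 \<Longrightarrow> X = {the_elem X}"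
  by (auto simp: card_1_singleton_iff)

text \<open>Only the counts of storms are assumed measurable, and no probability is involved. The locale thus
  applies both to the probability space itself and to the \<open>\<sigma>\<close>-algebra generated by the process, on
  which the conditional probabilities live.\<close>

locale counting = storm_model +
  fixes \<Omega> :: "'a measure" and \<Phi> :: "'a \<Rightarrow> storm set" and Z :: "'a \<Rightarrow> nat \<Rightarrow> real"
  defines "Z \<equiv> \<lambda>\<omega>. max_vec l t (\<Phi> \<omega>)"
  assumes \<Phi>_space: "\<And>\<omega>. \<omega> \<in> space \<Omega> \<Longrightarrow> \<Phi> \<omega> \<subseteq> space \<Lambda>"
    and lf: "\<And>\<omega>. \<omega> \<in> space \<Omega> \<Longrightarrow> locally_finite_storms (\<Phi> \<omega>)"
    and counts: "\<And>A. A \<in> sets \<Lambda> \<Longrightarrow> (\<lambda>\<omega>. num_points (\<Phi> \<omega> \<inter> A)) \<in> borel_measurable \<Omega>"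
begin

text \<open>Local finiteness bounds the number of storms only where shifts and amplitudes stay in a
  compact set; these regions exhaust the space of storms.\<close>

definition bounded_region :: "nat \<Rightarrow> storm set" where
  "bounded_region n = {p \<in> space \<Lambda>. \<bar>fst p\<bar> \<le> n \<and> 1 / (real n + 1) \<le> fst (snd p) \<and> fst (snd p) \<le> n}"

lemma bounded_region_sets [measurable]: "bounded_region n \<in> sets \<Lambda>"
  unfolding bounded_region_def by measurable

lemma bounded_region_incseq: "incseq bounded_region"
proof (rule incseq_SucI)
  fix n show "bounded_region n \<le> bounded_region (Suc n)"
  proof
    fix p assume p: "p \<in> bounded_region n"
    have "1 / (real (Suc n) + 1) \<le> 1 / (real n + 1)" by (intro divide_left_mono) auto
    then show "p \<in> bounded_region (Suc n)" using p by (auto simp: bounded_region_def)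
  qed
qed

lemma UN_bounded_region: "(\<Union>n. bounded_region n) = space \<Lambda>"
proof
  show "space \<Lambda> \<subseteq> (\<Union>n. bounded_region n)"
  proof
    fix p assume p: "p \<in> space \<Lambda>"
    then obtain s u f where *: "p = (s, u, f)" "u > 0" by (cases p) auto
    obtain n :: nat where n: "real n \<ge> max \<bar>s\<bar> (max u (1 / u))" using real_arch_simple by blast
    have "1 / (real n + 1) \<le> u"
    proof -
      have "1 \<le> u * real n" using n * by (simp add: field_simps)
      also have "\<dots> \<le> u * (real n + 1)" using * by simp
      finally show ?thesis by (simp add: field_simps)
    qed
    then have "p \<in> bounded_region n" using p n unfolding bounded_region_def * by auto
    then show "p \<in> (\<Union>n. bounded_region n)" by blast
  qed
qed (auto simp: bounded_region_def)

lemma finite_compact: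
  assumes "\<omega> \<in> space \<Omega>" "compact C" "C \<subseteq> UNIV \<times> {0<..}"
  shows "finite {p \<in> \<Phi> \<omega>. (fst p, fst (snd p)) \<in> C}"
proof -
  have "finite {(s, u, f) \<in> \<Phi> \<omega>. (s, u) \<in> C}"
    using lf[OF assms(1)] assms(2,3) by (simp add: locally_finite_storms_def)
  moreover have "{(s, u, f) \<in> \<Phi> \<omega>. (s, u) \<in> C} = {p \<in> \<Phi> \<omega>. (fst p, fst (snd p)) \<in> C}" by auto
  ultimately show ?thesis by simp
qed

lemma finite_bounded_region: "\<omega> \<in> space \<Omega> \<Longrightarrow> finite (\<Phi> \<omega> \<inter> bounded_region n)"
proof -
  assume \<omega>: "\<omega> \<in> space \<Omega>"
  have "finite {p \<in> \<Phi> \<omega>. (fst p, fst (snd p)) \<in> {- real n..real n} \<times> {1 / (real n + 1)..real n}}"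
  proof (rule finite_compact[OF \<omega>])
    have "0 < 1 / (real n + 1)" by simp
    then show "{- real n..real n} \<times> {1 / (real n + 1)..real n} \<subseteq> UNIV \<times> {0<..}"
      using less_le_trans[of 0 "1 / (real n + 1)"] by auto
  qed (intro compact_Times compact_Icc)
  then show ?thesis by (rule rev_finite_subset) (auto simp: bounded_region_def)
qed

text \<open>The set of storms that attain the maxima depends itself on the configuration, so counts in
  random regions are needed. For rectangles they are counts in fixed regions, rectangles generate, and in a
  bounded region the counts are finite, hence subtractive under complements.\<close>

lemma counts_random_region:
  assumes X [measurable]: "X \<in> measurable \<Omega> N" and H: "H \<in> sets (N \<Otimes>\<^sub>M \<Lambda>)"
  shows "(\<lambda>\<omega>. num_points (\<Phi> \<omega> \<inter> {p. (X \<omega>, p) \<in> H})) \<in> borel_measurable \<Omega>"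
proof -
  have in_bounded_region: "(\<lambda>\<omega>. num_points (\<Phi> \<omega> \<inter> bounded_region n \<inter> {p. (X \<omega>, p) \<in> H})) \<in> borel_measurable \<Omega>" for n
  proof -
    have "Int_stable {a \<times> b |a b. a \<in> sets N \<and> b \<in> sets \<Lambda>}" by (rule Int_stable_pair_measure_generator)
    moreover have "{a \<times> b |a b. a \<in> sets N \<and> b \<in> sets \<Lambda>} \<subseteq> Pow (space N \<times> space \<Lambda>)"
      by (rule pair_measure_closed)
    moreover have "H \<in> sigma_sets (space N \<times> space \<Lambda>) {a \<times> b |a b. a \<in> sets N \<and> b \<in> sets \<Lambda>}"
      using H by (simp add: sets_pair_measure)
    ultimately show ?thesis
    proof (induction rule: sigma_sets_induct_disjoint)
      case (basic A)
      then obtain a b where A: "A = a \<times> b" "a \<in> sets N" "b \<in> sets \<Lambda>" by auto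
      have [measurable]: "(\<lambda>\<omega>. num_points (\<Phi> \<omega> \<inter> (bounded_region n \<inter> b))) \<in> borel_measurable \<Omega>"
        by (rule counts) (use A in auto)
      note [measurable] = A(2)
      have "(\<lambda>\<omega>. indicator a (X \<omega>) * num_points (\<Phi> \<omega> \<inter> (bounded_region n \<inter> b))) \<in> borel_measurable \<Omega>"
        by measurable
      also have "(\<lambda>\<omega>. indicator a (X \<omega>) * num_points (\<Phi> \<omega> \<inter> (bounded_region n \<inter> b)))
          = (\<lambda>\<omega>. num_points (\<Phi> \<omega> \<inter> bounded_region n \<inter> {p. (X \<omega>, p) \<in> A}))"
        by (auto simp: fun_eq_iff A indicator_def num_points_def Int_assoc)
      finally show ?case .
    next
      case empty
      then show ?case by (simp add: num_points_def)
    next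
      case (compl A)
      have [measurable]: "(\<lambda>\<omega>. num_points (\<Phi> \<omega> \<inter> bounded_region n)) \<in> borel_measurable \<Omega>"
        by (rule counts) auto
      note [measurable] = compl(2)
      have "num_points (\<Phi> \<omega> \<inter> bounded_region n \<inter> {p. (X \<omega>, p) \<in> space N \<times> space \<Lambda> - A})
          = num_points (\<Phi> \<omega> \<inter> bounded_region n) - num_points (\<Phi> \<omega> \<inter> bounded_region n \<inter> {p. (X \<omega>, p) \<in> A})"
        if \<omega>: "\<omega> \<in> space \<Omega>" for \<omega>
      proof -
        have "\<Phi> \<omega> \<inter> bounded_region n \<inter> {p. (X \<omega>, p) \<in> space N \<times> space \<Lambda> - A}
            = (\<Phi> \<omega> \<inter> bounded_region n) - (\<Phi> \<omega> \<inter> bounded_region n \<inter> {p. (X \<omega>, p) \<in> A})"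
          using measurable_space[OF X \<omega>] by (auto simp: bounded_region_def)
        then show ?thesis unfolding num_points_def
          using finite_bounded_region[OF \<omega>, of n] by (subst emeasure_Diff[symmetric]) (auto simp: emeasure_count_space)
      qed
      then show ?case by (subst measurable_cong) (assumption, measurable)
    next
      case (union A)
      note [measurable] = union(3)
      have "num_points (\<Phi> \<omega> \<inter> bounded_region n \<inter> {p. (X \<omega>, p) \<in> \<Union> (range A)})
          = (\<Sum>i. num_points (\<Phi> \<omega> \<inter> bounded_region n \<inter> {p. (X \<omega>, p) \<in> A i}))" for \<omega>
      proof -
        have "disjoint_family (\<lambda>i. \<Phi> \<omega> \<inter> bounded_region n \<inter> {p. (X \<omega>, p) \<in> A i})"
          using union(1) by (auto simp: disjoint_family_on_def)
        then show ?thesis unfolding num_points_def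
          by (subst suminf_emeasure) (auto intro!: arg_cong[where f = "emeasure _"])
      qed
      then show ?case by simp
    qed
  qed
  have "num_points (\<Phi> \<omega> \<inter> {p. (X \<omega>, p) \<in> H}) = (SUP n. num_points (\<Phi> \<omega> \<inter> bounded_region n \<inter> {p. (X \<omega>, p) \<in> H}))"
    if \<omega>: "\<omega> \<in> space \<Omega>" for \<omega>
  proof -
    have "(SUP n. num_points (\<Phi> \<omega> \<inter> bounded_region n \<inter> {p. (X \<omega>, p) \<in> H})) = num_points (\<Union>n. \<Phi> \<omega> \<inter> bounded_region n \<inter> {p. (X \<omega>, p) \<in> H})"
      unfolding num_points_def using bounded_region_incseq
      by (intro SUP_emeasure_incseq) (auto simp: incseq_def)
    also have "(\<Union>n. \<Phi> \<omega> \<inter> bounded_region n \<inter> {p. (X \<omega>, p) \<in> H}) = \<Phi> \<omega> \<inter> {p. (X \<omega>, p) \<in> H}"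
      using \<Phi>_space[OF \<omega>] UN_bounded_region by blast
    finally show ?thesis ..
  qed
  then show ?thesis using in_bounded_region by (subst measurable_cong) (assumption, measurable)
qed

lemma pred_count_0 [measurable]: "A \<in> sets \<Lambda> \<Longrightarrow> Measurable.pred \<Omega> (\<lambda>\<omega>. num_points (\<Phi> \<omega> \<inter> A) = 0)"
  using counts[of A] by measurable

text \<open>The supremum of a set of reals without upper bound is one fixed number, so degenerate
  configurations contribute only a constant to the maxima.\<close>

lemma Sup_unbounded: 
  assumes "\<not> bdd_above S" shows "Sup S = Sup (UNIV :: real set)"
proof -
  have "(\<lambda>z. \<forall>x\<in>S. x \<le> z) = (\<lambda>z. False)"
    using assms by (simp add: bdd_above_def fun_eq_iff)
  moreover have "(\<lambda>z. \<forall>x\<in>(UNIV :: real set). x \<le> z) = (\<lambda>z. False)" 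
    by (simp add: fun_eq_iff not_le gt_ex)
  ultimately show ?thesis unfolding Sup_real_def by simp
qed

lemma max_field_eq: "max_field (\<Phi> \<omega>) (t i) = Sup ((\<lambda>p. height p i) ` \<Phi> \<omega>)"
  unfolding max_field_def height_def[abs_def] by simp

text \<open>Whether the heights are empty, bounded, or exceed a level are statements about counts; on
  empty or unbounded sets of heights the supremum is a constant.\<close>

lemma max_field_measurable [measurable]: "(\<lambda>\<omega>. max_field (\<Phi> \<omega>) (t i)) \<in> borel_measurable \<Omega>"
proof (rule borel_measurableI_greater)
  fix a :: real
  define above where "above c = {p \<in> space \<Lambda>. height p i > c}" for c :: real
  have [measurable]: "above c \<in> sets \<Lambda>" for c unfolding above_def by measurable
  define ne where "ne \<omega> \<longleftrightarrow> num_points (\<Phi> \<omega> \<inter> space \<Lambda>) \<noteq> 0" for \<omega>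
  define bdd where "bdd \<omega> \<longleftrightarrow> (\<exists>n::nat. num_points (\<Phi> \<omega> \<inter> above (real n)) = 0)" for \<omega>
  have [measurable]: "Measurable.pred \<Omega> ne" "Measurable.pred \<Omega> bdd" unfolding ne_def[abs_def] bdd_def[abs_def] by measurable
  have "{\<omega> \<in> space \<Omega>. a < max_field (\<Phi> \<omega>) (t i)} =
     {\<omega> \<in> space \<Omega>. (ne \<omega> \<and> bdd \<omega> \<and> num_points (\<Phi> \<omega> \<inter> above a) \<noteq> 0)
        \<or> (ne \<omega> \<and> \<not> bdd \<omega> \<and> a < Sup (UNIV :: real set)) \<or> (\<not> ne \<omega> \<and> a < Sup ({} :: real set))}"
  proof (rule Collect_cong, rule conj_cong[OF refl])
    fix \<omega> assume \<omega>: "\<omega> \<in> space \<Omega>"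
    let ?S = "(\<lambda>p. height p i) ` \<Phi> \<omega>"
    have ne: "ne \<omega> \<longleftrightarrow> ?S \<noteq> {}" using \<Phi>_space[OF \<omega>] by (auto simp: ne_def num_points_eq_0_iff)
    have ab: "num_points (\<Phi> \<omega> \<inter> above c) = 0 \<longleftrightarrow> (\<forall>x\<in>?S. x \<le> c)" for c
      using \<Phi>_space[OF \<omega>] by (auto simp: above_def num_points_eq_0_iff not_less)
    have bd: "bdd \<omega> \<longleftrightarrow> bdd_above ?S"
    proof
      assume "bdd_above ?S"
      then obtain c where "\<And>x. x \<in> ?S \<Longrightarrow> x \<le> c" by (auto simp: bdd_above_def)
      moreover obtain n :: nat where "c \<le> real n" using real_arch_simple by blast
      ultimately show "bdd \<omega>" unfolding bdd_def ab by (meson order_trans)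
    qed (auto simp: bdd_def ab bdd_above_def)
    show "a < max_field (\<Phi> \<omega>) (t i) \<longleftrightarrow> (ne \<omega> \<and> bdd \<omega> \<and> num_points (\<Phi> \<omega> \<inter> above a) \<noteq> 0)
        \<or> (ne \<omega> \<and> \<not> bdd \<omega> \<and> a < Sup (UNIV :: real set)) \<or> (\<not> ne \<omega> \<and> a < Sup ({} :: real set))"
    proof (cases "?S = {}")
      case False
      show ?thesis
      proof (cases "bdd_above ?S")
        case True
        then have "a < max_field (\<Phi> \<omega>) (t i) \<longleftrightarrow> (\<exists>x\<in>?S. a < x)"
          unfolding max_field_eq using False by (intro less_cSup_iff)
        then show ?thesis using True False by (auto simp: ne bd ab not_le)
      next
        case unb: False
        then show ?thesis using False Sup_unbounded[OF unb] by (simp add: ne bd max_field_eq)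
      qed
    next
      case True
      then show ?thesis unfolding max_field_eq ne by simp
    qed
  qed
  also have "\<dots> \<in> sets \<Omega>" by measurable
  finally show "{\<omega> \<in> space \<Omega>. a < max_field (\<Phi> \<omega>) (t i)} \<in> sets \<Omega>" .
qed

lemma Z_measurable [measurable]: "Z \<in> measurable \<Omega> V"
  unfolding Z_def max_vec_def vec_space_def by measurable

lemma Z_eq: "i \<in> L \<Longrightarrow> Z \<omega> i = Sup ((\<lambda>p. height p i) ` \<Phi> \<omega>)"
  by (simp add: Z_def max_vec_def max_field_eq)

lemma I_set_eq: "I_set G l t z = {p \<in> space \<Lambda>. \<forall>i\<in>L. height p i = z i}"
  by (auto simp: I_set_def space_\<Lambda>)

definition hits :: "'a \<Rightarrow> storm set" where
  "hits \<omega> = \<Phi> \<omega> \<inter> I_set G l t (Z \<omega>)"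

lemma hits_subset: "\<omega> \<in> space \<Omega> \<Longrightarrow> hits \<omega> \<subseteq> space \<Lambda>"
  using \<Phi>_space by (auto simp: hits_def)

lemma hits_count_measurable:
  assumes [measurable]: "A \<in> sets \<Lambda>"
  shows "(\<lambda>\<omega>. num_points (hits \<omega> \<inter> A)) \<in> borel_measurable \<Omega>"
proof -
  define H where "H = {x \<in> space (V \<Otimes>\<^sub>M \<Lambda>). snd x \<in> A \<and> (\<forall>i\<in>L. height (snd x) i = fst x i)}"
  have [measurable]: "(\<lambda>x. fst x i) \<in> borel_measurable (V \<Otimes>\<^sub>M \<Lambda>)" if "i \<in> L" for i
    using that unfolding vec_space_def by measurable
  have "H \<in> sets (V \<Otimes>\<^sub>M \<Lambda>)" unfolding H_def by measurable
  from counts_random_region[OF Z_measurable this]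
  have "(\<lambda>\<omega>. num_points (\<Phi> \<omega> \<inter> {p. (Z \<omega>, p) \<in> H})) \<in> borel_measurable \<Omega>" .
  moreover have "hits \<omega> \<inter> A = \<Phi> \<omega> \<inter> {p. (Z \<omega>, p) \<in> H}" if "\<omega> \<in> space \<Omega>" for \<omega>
    using measurable_space[OF Z_measurable that] \<Phi>_space[OF that]
    by (auto simp: hits_def I_set_eq H_def space_pair_measure)
  ultimately show ?thesis by (subst measurable_cong) auto
qed

definition single :: "'a \<Rightarrow> bool" where "single \<omega> \<longleftrightarrow> card (hits \<omega>) = 1"

definition leader :: "'a \<Rightarrow> storm" where "leader \<omega> = the_elem (hits \<omega>)"

lemma hits_single: "single \<omega> \<Longrightarrow> hits \<omega> = {leader \<omega>}"
  by (simp add: single_def leader_def card_1_the_elem)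

lemma single_leader_iff:
  "single \<omega> \<and> leader \<omega> \<in> A \<longleftrightarrow> single \<omega> \<and> num_points (hits \<omega> \<inter> A) = 1"
  using hits_single[of \<omega>] by (cases "leader \<omega> \<in> A") (auto simp: num_points_eq_1_iff)

lemma single_measurable [measurable]: "Measurable.pred \<Omega> single"
proof -
  have "Measurable.pred \<Omega> (\<lambda>\<omega>. num_points (hits \<omega> \<inter> space \<Lambda>) = 1)"
    using hits_count_measurable[of "space \<Lambda>"] by measurable
  moreover have "single \<omega> \<longleftrightarrow> num_points (hits \<omega> \<inter> space \<Lambda>) = 1" if "\<omega> \<in> space \<Omega>" for \<omega>
    using hits_subset[OF that] by (simp add: single_def num_points_eq_1_iff Int_absorb2)
  ultimately show ?thesis by (subst measurable_cong) auto
qed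

lemma single_leader_measurable [measurable (raw)]:
  assumes "A \<in> sets \<Lambda>"
  shows "Measurable.pred \<Omega> (\<lambda>\<omega>. single \<omega> \<and> leader \<omega> \<in> A)"
  unfolding single_leader_iff using hits_count_measurable[OF assms] by measurable

lemma leader_in: 
  assumes "single \<omega>" "\<omega> \<in> space \<Omega>"
  shows "leader \<omega> \<in> \<Phi> \<omega>" "leader \<omega> \<in> space \<Lambda>" "heights (leader \<omega>) = Z \<omega>"
proof -
  have "leader \<omega> \<in> hits \<omega>" using hits_single[OF assms(1)] by blast
  then show "leader \<omega> \<in> \<Phi> \<omega>" "leader \<omega> \<in> space \<Lambda>" "heights (leader \<omega>) = Z \<omega>"
    by (auto simp: hits_def I_set_eq heights_def Z_def max_vec_def fun_eq_iff)
qed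

lemma leader_measurable: "leader \<in> measurable (restrict_space \<Omega> {\<omega> \<in> space \<Omega>. single \<omega>}) \<Lambda>"
proof (rule measurableI)
  fix \<omega> assume "\<omega> \<in> space (restrict_space \<Omega> {\<omega> \<in> space \<Omega>. single \<omega>})"
  then show "leader \<omega> \<in> space \<Lambda>" by (auto simp: space_restrict_space leader_in)
next
  fix A assume [measurable]: "A \<in> sets \<Lambda>"
  have "{\<omega> \<in> space \<Omega>. single \<omega> \<and> leader \<omega> \<in> A} \<in> sets \<Omega>" by measurable
  then show "leader -` A \<inter> space (restrict_space \<Omega> {\<omega> \<in> space \<Omega>. single \<omega>})
      \<in> sets (restrict_space \<Omega> {\<omega> \<in> space \<Omega>. single \<omega>})"
    by (subst sets_restrict_space_iff) (auto simp: space_restrict_space Int_def vimage_def conj_commute conj_left_commute elim!: back_subst[of "\<lambda>x. x \<in> sets \<Omega>"])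
qed

end


section \<open>Poisson counts and regular configurations\<close>

text \<open>An inequality between measures that holds inside each member of a countable cover holds everywhere:
  cut the set along the disjointed cover and add up.\<close>

lemma emeasure_le_by_cover:
  assumes sets: "sets \<mu> = sets \<nu>" and C: "countable \<C>" "\<C> \<subseteq> sets \<mu>" and H: "H \<in> sets \<mu>" "H \<subseteq> \<Union>\<C>"
    and le: "\<And>C A. C \<in> \<C> \<Longrightarrow> A \<in> sets \<mu> \<Longrightarrow> A \<subseteq> C \<Longrightarrow> A \<subseteq> H \<Longrightarrow> emeasure \<mu> A \<le> k * emeasure \<nu> A"
  shows "emeasure \<mu> H \<le> k * emeasure \<nu> H"
proof (cases "\<C> = {}")
  case False
  define A where "A n = H \<inter> disjointed (from_nat_into \<C>) n" for n
  have range: "range (from_nat_into \<C>) = \<C>" using False C(1) by (rule range_from_nat_into)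
  then have "disjointed (from_nat_into \<C>) n \<in> sets \<mu>" for n
    using sets.range_disjointed_sets[of "from_nat_into \<C>" \<mu>] C(2) by auto
  then have A: "A n \<in> sets \<mu>" for n using H(1) by (auto simp: A_def)
  have disj: "disjoint_family A"
    using disjoint_family_disjointed[of "from_nat_into \<C>"] by (auto simp: A_def disjoint_family_on_def)
  have UN: "(\<Union>n. A n) = H"
    using H(2) range UN_disjointed_eq[of "from_nat_into \<C>"] by (auto simp: A_def)
  have "emeasure \<mu> H = (\<Sum>n. emeasure \<mu> (A n))"
    using A disj by (subst suminf_emeasure) (auto simp: UN)
  also have "\<dots> \<le> (\<Sum>n. k * emeasure \<nu> (A n))"
  proof (intro suminf_le le)
    show "from_nat_into \<C> n \<in> \<C>" for n using False by (rule from_nat_into)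
    show "A n \<subseteq> from_nat_into \<C> n" for n
      unfolding A_def by (rule le_infI2[OF disjointed_subset])
  qed (auto simp: A[unfolded A_def] A_def)
  also have "\<dots> = k * emeasure \<nu> H"
    using A disj sets by (subst ennreal_suminf_cmult) (simp add: suminf_emeasure image_subset_iff UN)
  finally show ?thesis .
qed (use H in simp)

lemma le_if_le_exp_mult:
  assumes "y < \<infinity>" and "\<And>e::real. e > 0 \<Longrightarrow> x \<le> ennreal (exp e) * y"
  shows "x \<le> (y :: ennreal)"
proof (rule LIMSEQ_le_const)
  have "(\<lambda>n. ennreal (exp (1 / Suc n))) \<longlonglongrightarrow> ennreal (exp 0)"
    by (intro tendsto_ennrealI tendsto_exp LIMSEQ_Suc[OF lim_1_over_n])
  then have "(\<lambda>n. y * ennreal (exp (1 / Suc n))) \<longlonglongrightarrow> y * ennreal (exp 0)"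
    using assms(1) by (intro ennreal_tendsto_cmult) auto
  then show "(\<lambda>n. ennreal (exp (1 / Suc n)) * y) \<longlonglongrightarrow> y" by (simp add: mult.commute)
  show "\<exists>N. \<forall>n\<ge>N. x \<le> ennreal (exp (1 / Suc n)) * y"
    using assms(2)[of "1 / Suc _"] by (intro exI[of _ 0] allI impI assms(2)) simp
qed

lemma emeasure_finite_subset:
  "A \<subseteq> B \<Longrightarrow> B \<in> sets M \<Longrightarrow> emeasure M B < \<infinity> \<Longrightarrow> emeasure M A < \<infinity>"
  by (rule le_less_trans[OF emeasure_mono])

locale storm_process = counting +
  assumes PPP: "poisson_process \<Omega> \<Lambda> \<Phi>"
begin

sublocale prob_space \<Omega> using PPP by (simp add: poisson_process_def)

abbreviation "cnt A \<omega> \<equiv> num_points (\<Phi> \<omega> \<inter> A)"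

lemma cnt_measurable [measurable (raw)]: "A \<in> sets \<Lambda> \<Longrightarrow> cnt A \<in> borel_measurable \<Omega>"
  by (rule counts)

lemma prob_cnt:
  assumes "A \<in> sets \<Lambda>" "emeasure \<Lambda> A < \<infinity>"
  shows "prob {\<omega> \<in> space \<Omega>. cnt A \<omega> = of_nat n} = measure \<Lambda> A ^ n / fact n * exp (- measure \<Lambda> A)"
  using PPP assms unfolding poisson_process_def by blast

lemma prob_cnt_0: "A \<in> sets \<Lambda> \<Longrightarrow> emeasure \<Lambda> A < \<infinity> \<Longrightarrow> prob {\<omega> \<in> space \<Omega>. cnt A \<omega> = 0} = exp (- measure \<Lambda> A)"
  using prob_cnt[of A 0] by simp

lemma prob_cnt_1:
  "A \<in> sets \<Lambda> \<Longrightarrow> emeasure \<Lambda> A < \<infinity> \<Longrightarrow> prob {\<omega> \<in> space \<Omega>. cnt A \<omega> = 1} = measure \<Lambda> A * exp (- measure \<Lambda> A)"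
  using prob_cnt[of A 1] by simp

text \<open>The Poisson weights sum up to one, so nothing is left for the value \<open>\<infinity>\<close>.\<close>

lemma AE_cnt_finite:
  assumes A [measurable]: "A \<in> sets \<Lambda>" and fin: "emeasure \<Lambda> A < \<infinity>"
  shows "AE \<omega> in \<Omega>. finite (\<Phi> \<omega> \<inter> A)"
proof -
  let ?E = "\<lambda>n::nat. {\<omega> \<in> space \<Omega>. cnt A \<omega> = of_nat n}"
  have E: "?E n \<in> sets \<Omega>" for n by measurable
  have "(\<lambda>n. prob (?E n)) sums prob (\<Union>n. ?E n)"
    by (intro finite_measure_UNION) (use E in \<open>auto simp: disjoint_family_on_def\<close>)
  moreover have "(\<lambda>n. prob (?E n)) sums (exp (measure \<Lambda> A) * exp (- measure \<Lambda> A))"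
    unfolding prob_cnt[OF A fin] using exp_converges[of "measure \<Lambda> A"]
    by (intro sums_mult2) (simp add: scaleR_conv_of_real divide_inverse mult.commute)
  ultimately have "prob (\<Union>n. ?E n) = 1" by (simp add: sums_iff exp_minus)
  then have "AE \<omega> in \<Omega>. \<omega> \<in> (\<Union>n. ?E n)" using E by (subst (asm) prob_eq_1) auto
  then show ?thesis
  proof eventually_elim
    case (elim \<omega>)
    then show ?case using num_points_eq_top_iff[of "\<Phi> \<omega> \<inter> A"] by (auto simp: ennreal_of_nat_neq_top)
  qed
qed

lemma AE_cnt_null:
  assumes A: "A \<in> sets \<Lambda>" and null: "emeasure \<Lambda> A = 0"
  shows "AE \<omega> in \<Omega>. \<Phi> \<omega> \<inter> A = {}"
proof -
  have "prob {\<omega> \<in> space \<Omega>. cnt A \<omega> = 0} = 1"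
    using prob_cnt_0[OF A] null by (simp add: measure_def)
  then have "AE \<omega> in \<Omega>. cnt A \<omega> = 0" using A by (subst (asm) prob_Collect_eq_1) auto
  then show ?thesis by eventually_elim (simp add: num_points_eq_0_iff)
qed

lemma indep3:
  assumes [measurable]: "A \<in> sets \<Lambda>" "B \<in> sets \<Lambda>" "C \<in> sets \<Lambda>"
    and disj: "A \<inter> B = {}" "A \<inter> C = {}" "B \<inter> C = {}"
    and E: "E1 \<in> sets borel" "E2 \<in> sets borel" "E3 \<in> sets borel"
  shows "prob {\<omega> \<in> space \<Omega>. cnt A \<omega> \<in> E1 \<and> cnt B \<omega> \<in> E2 \<and> cnt C \<omega> \<in> E3} =
    prob {\<omega> \<in> space \<Omega>. cnt A \<omega> \<in> E1} * prob {\<omega> \<in> space \<Omega>. cnt B \<omega> \<in> E2} * prob {\<omega> \<in> space \<Omega>. cnt C \<omega> \<in> E3}"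
proof -
  define D where "D = (\<lambda>i::nat. if i = 0 then A else if i = 1 then B else if i = 2 then C else {})"
  define E where "E = (\<lambda>i::nat. if i = 0 then E1 else if i = 1 then E2 else E3)"
  have "range D \<subseteq> sets \<Lambda>" by (auto simp: D_def)
  moreover have "disjoint_family D" using disj by (auto simp: D_def disjoint_family_on_def)
  ultimately have "indep_vars (\<lambda>_. borel) (\<lambda>i \<omega>. cnt (D i) \<omega>) UNIV"
    using PPP unfolding poisson_process_def by blast
  then have "prob (\<Inter>i\<in>{0,1,2}. cnt (D i) -` E i \<inter> space \<Omega>) = (\<Prod>i\<in>{0,1,2}. prob (cnt (D i) -` E i \<inter> space \<Omega>))"
    by (rule indep_varsD) (use assms in \<open>auto simp: E_def\<close>)
  also have "\<dots> = prob (cnt A -` E1 \<inter> space \<Omega>) * prob (cnt B -` E2 \<inter> space \<Omega>) * prob (cnt C -` E3 \<inter> space \<Omega>)"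
    by (simp add: D_def E_def)
  also have "(\<Inter>i\<in>{0,1,2}. cnt (D i) -` E i \<inter> space \<Omega>) = {\<omega> \<in> space \<Omega>. cnt A \<omega> \<in> E1 \<and> cnt B \<omega> \<in> E2 \<and> cnt C \<omega> \<in> E3}"
    by (auto simp: D_def E_def)
  finally show ?thesis by (simp add: vimage_def Int_def conj_commute)
qed

lemma indep2:
  assumes "A \<in> sets \<Lambda>" "B \<in> sets \<Lambda>" "A \<inter> B = {}" "E1 \<in> sets borel" "E2 \<in> sets borel"
  shows "prob {\<omega> \<in> space \<Omega>. cnt A \<omega> \<in> E1 \<and> cnt B \<omega> \<in> E2} =
    prob {\<omega> \<in> space \<Omega>. cnt A \<omega> \<in> E1} * prob {\<omega> \<in> space \<Omega>. cnt B \<omega> \<in> E2}"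
  using indep3[of A B "{}" E1 E2 UNIV] assms by (simp add: prob_space)

text \<open>Configurations of this kind have finite maxima, and positive maxima are attained: only finitely
  many storms are higher than any given positive level at \<open>t i\<close>.\<close>

definition regular_config :: "'a \<Rightarrow> bool" where
  "regular_config \<omega> \<longleftrightarrow> \<Phi> \<omega> \<noteq> {} \<and> \<Phi> \<omega> \<subseteq> space \<Lambda> \<and>
     (\<forall>i\<in>L. \<forall>n::nat. finite (\<Phi> \<omega> \<inter> {p \<in> space \<Lambda>. height p i \<ge> 1 / Suc n}))"

lemma emeasure_space_\<Lambda>: "emeasure \<Lambda> (space \<Lambda>) = \<infinity>"
proof (rule ccontr)
  assume "emeasure \<Lambda> (space \<Lambda>) \<noteq> \<infinity>"
  then obtain c where c: "emeasure \<Lambda> (space \<Lambda>) = ennreal c" "c \<ge> 0"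
    by (cases "emeasure \<Lambda> (space \<Lambda>)") auto
  have "ennreal (c + 1) = emeasure \<Lambda> {p \<in> space \<Lambda>. height p 0 \<ge> 1 / (c + 1)}"
    using c by (subst emeasure_height_tail) auto
  also have "\<dots> \<le> ennreal c" unfolding c(1)[symmetric] by (intro emeasure_mono) auto
  finally show False using c by (simp add: ennreal_le_iff)
qed

lemma AE_regular_config: "AE \<omega> in \<Omega>. regular_config \<omega>"
proof -
  have "AE \<omega> in \<Omega>. cnt (space \<Lambda>) \<omega> = \<infinity>"
    using PPP emeasure_space_\<Lambda> unfolding poisson_process_def by blast
  then have "AE \<omega> in \<Omega>. \<Phi> \<omega> \<noteq> {}" by eventually_elim (auto simp: num_points_def)
  moreover have "AE \<omega> in \<Omega>. \<forall>i\<in>L. \<forall>n::nat. finite (\<Phi> \<omega> \<inter> {p \<in> space \<Lambda>. height p i \<ge> 1 / Suc n})"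
    by (intro AE_finite_allI AE_all_countable[THEN iffD2] allI AE_cnt_finite)
       (auto simp: emeasure_height_tail simp del: of_nat_Suc)
  ultimately show ?thesis using AE_space
    by eventually_elim (use \<Phi>_space in \<open>auto simp: regular_config_def\<close>)
qed

lemma regular_config_le:
  assumes "regular_config \<omega>" "i \<in> L" "p \<in> \<Phi> \<omega>"
  shows "height p i \<le> Z \<omega> i"
proof -
  let ?F = "\<Phi> \<omega> \<inter> {p \<in> space \<Lambda>. height p i \<ge> 1 / Suc 0}"
  have "finite ?F" using assms unfolding regular_config_def by blast
  then have b: "bdd_above ((\<lambda>p. height p i) ` ?F)" by simp
  have "bdd_above ((\<lambda>p. height p i) ` \<Phi> \<omega>)"
  proof -
    obtain c where c: "\<forall>x\<in>(\<lambda>p. height p i) ` ?F. x \<le> c" using b unfolding bdd_above_def by blast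
    have "height q i \<le> max 1 c" if "q \<in> \<Phi> \<omega>" for q
    proof (cases "height q i \<ge> 1")
      case True
      then have "q \<in> ?F" using that assms by (auto simp: regular_config_def simp del: split_paired_All)
      then have "height q i \<le> c" using c by blast
      then show ?thesis by simp
    qed simp
    then show ?thesis by (rule bdd_aboveI2)
  qed
  then show ?thesis unfolding Z_eq[OF assms(2)] using assms(3) by (intro cSup_upper) auto
qed

lemma regular_config_attained:
  assumes r: "regular_config \<omega>" and i: "i \<in> L" and pos: "Z \<omega> i > 0"
  obtains p where "p \<in> \<Phi> \<omega>" "height p i = Z \<omega> i"
proof -
  obtain n where n: "1 / Suc n < Z \<omega> i" using pos reals_Archimedean[of "Z \<omega> i"] by (auto simp: inverse_eq_divide)
  let ?F = "\<Phi> \<omega> \<inter> {p \<in> space \<Lambda>. height p i \<ge> 1 / Suc n}"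
  have fin: "finite ?F" using r i unfolding regular_config_def by blast
  have ne\<Phi>: "\<Phi> \<omega> \<noteq> {}" and sp: "\<Phi> \<omega> \<subseteq> space \<Lambda>" using r by (auto simp: regular_config_def)
  from ne\<Phi> have "(\<lambda>p. height p i) ` \<Phi> \<omega> \<noteq> {}" by simp
  from less_cSupD[OF this n[unfolded Z_eq[OF i]]]
  obtain q where "q \<in> \<Phi> \<omega>" "1 / Suc n < height q i" by blast
  then have "q \<in> ?F" using sp by auto
  then have ne: "?F \<noteq> {}" by blast
  have "Max ((\<lambda>p. height p i) ` ?F) \<in> (\<lambda>p. height p i) ` ?F" using fin ne by (intro Max_in) auto
  then obtain p where p: "p \<in> ?F" "height p i = Max ((\<lambda>p. height p i) ` ?F)" by auto
  have "height q i \<le> height p i" if "q \<in> \<Phi> \<omega>" for q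
  proof (cases "height q i \<ge> 1 / Suc n")
    case True
    then have "q \<in> ?F" using that r by (auto simp: regular_config_def)
    then show ?thesis unfolding p(2) using fin by (intro Max_ge) auto
  next
    case False
    then show ?thesis using p(1) by auto
  qed
  then have "Z \<omega> i = height p i" unfolding Z_eq[OF i] using p(1) by (intro cSup_eq_maximum) auto
  then show thesis using that[of p] p(1) by simp
qed

section \<open>The law of the leading storm\<close>

text \<open>A single leader in \<open>H\<close> means that \<open>H\<close> contains a point and that no point reaches \<open>b\<close> anywhere, as
  all of them stay below the leader. The set \<open>H\<close> and the storms that reach \<open>b\<close> are disjoint, so the two
  events are independent.\<close>

lemma single_leader_upper:
  assumes H [measurable]: "H \<in> sets \<Lambda>" and fin: "emeasure \<Lambda> H < \<infinity>"
    and b: "\<And>i. i \<in> L \<Longrightarrow> b i > 0" "\<And>p i. p \<in> H \<Longrightarrow> i \<in> L \<Longrightarrow> height p i < b i"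
  shows "prob {\<omega> \<in> space \<Omega>. single \<omega> \<and> leader \<omega> \<in> H} \<le> measure \<Lambda> H * exp (- excess b)"
proof -
  have "prob {\<omega> \<in> space \<Omega>. single \<omega> \<and> leader \<omega> \<in> H}
      \<le> prob {\<omega> \<in> space \<Omega>. cnt H \<omega> \<in> UNIV - {0} \<and> cnt (exceed b) \<omega> \<in> {0}}"
  proof (rule finite_measure_mono_AE)
    show "AE \<omega> in \<Omega>. \<omega> \<in> {\<omega> \<in> space \<Omega>. single \<omega> \<and> leader \<omega> \<in> H}
        \<longrightarrow> \<omega> \<in> {\<omega> \<in> space \<Omega>. cnt H \<omega> \<in> UNIV - {0} \<and> cnt (exceed b) \<omega> \<in> {0}}"
      using AE_regular_config
    proof eventually_elim
      case (elim \<omega>)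
      show ?case
      proof
        assume "\<omega> \<in> {\<omega> \<in> space \<Omega>. single \<omega> \<and> leader \<omega> \<in> H}"
        then have \<omega>: "\<omega> \<in> space \<Omega>" "single \<omega>" "leader \<omega> \<in> H" by auto
        note lead = leader_in[OF \<omega>(2,1)]
        have "q \<notin> exceed b" if q: "q \<in> \<Phi> \<omega>" for q
        proof -
          have "height q i < b i" if i: "i \<in> L" for i
          proof -
            have "height q i \<le> Z \<omega> i" by (rule regular_config_le[OF elim i q])
            also have "\<dots> = height (leader \<omega>) i" using lead(3) i heights_apply by metis
            also have "\<dots> < b i" using b(2) \<omega>(3) i by blast
            finally show ?thesis .
          qed
          then show ?thesis by (auto simp: exceed_def not_le)
        qed
        then show "\<omega> \<in> {\<omega> \<in> space \<Omega>. cnt H \<omega> \<in> UNIV - {0} \<and> cnt (exceed b) \<omega> \<in> {0}}"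
          using lead \<omega> by (auto simp: num_points_eq_0_iff)
      qed
    qed
  qed measurable
  also have "\<dots> = prob {\<omega> \<in> space \<Omega>. cnt H \<omega> \<in> UNIV - {0}} * prob {\<omega> \<in> space \<Omega>. cnt (exceed b) \<omega> \<in> {0}}"
    by (rule indep2) (use b in \<open>force simp: exceed_def\<close>)+
  also have "prob {\<omega> \<in> space \<Omega>. cnt (exceed b) \<omega> \<in> {0}} = exp (- excess b)"
    using prob_cnt_0[of "exceed b"] emeasure_exceed_finite[of b] b(1) by (simp add: excess_def)
  also have "prob {\<omega> \<in> space \<Omega>. cnt H \<omega> \<in> UNIV - {0}} = 1 - exp (- measure \<Lambda> H)"
    using prob_neg[of "\<lambda>\<omega>. cnt H \<omega> = 0"] prob_cnt_0[OF H fin] by simp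
  also have "\<dots> \<le> measure \<Lambda> H" using exp_ge_add_one_self[of "- measure \<Lambda> H"] by simp
  finally show ?thesis by (simp add: mult_right_mono)
qed

text \<open>If exactly one of the storms that reach \<open>a\<close> somewhere exists, and it lies in \<open>H\<close>, then it dominates
  all others at every \<open>t i\<close> and is the single leader.\<close>

lemma single_leader_lower:
  assumes H [measurable]: "H \<in> sets \<Lambda>"
    and a: "\<And>i. i \<in> L \<Longrightarrow> a i > 0" "\<And>p i. p \<in> H \<Longrightarrow> i \<in> L \<Longrightarrow> a i \<le> height p i"
  shows "measure \<Lambda> H * exp (- excess a) \<le> prob {\<omega> \<in> space \<Omega>. single \<omega> \<and> leader \<omega> \<in> H}"
proof -
  have 1: "1 \<in> L" using l_pos by auto
  have sub: "H \<subseteq> exceed a" using a(2) 1 sets.sets_into_space[OF H] by (auto simp: exceed_def)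
  have exfin: "emeasure \<Lambda> (exceed a) < \<infinity>" using a(1) by (rule emeasure_exceed_finite)
  then have Hfin: "emeasure \<Lambda> H < \<infinity>" by (rule emeasure_finite_subset[OF sub exceed_sets])
  have Dfin: "emeasure \<Lambda> (exceed a - H) < \<infinity>"
    using exfin by (rule emeasure_finite_subset[OF Diff_subset exceed_sets])
  have "measure \<Lambda> (exceed a - H) = excess a - measure \<Lambda> H"
    unfolding excess_def using exfin sub by (intro measure_Diff) auto
  then have "measure \<Lambda> H * exp (- excess a) = (measure \<Lambda> H * exp (- measure \<Lambda> H)) * exp (- measure \<Lambda> (exceed a - H))"
    by (simp add: exp_add[symmetric])
  also have "\<dots> = prob {\<omega> \<in> space \<Omega>. cnt H \<omega> \<in> {1}} * prob {\<omega> \<in> space \<Omega>. cnt (exceed a - H) \<omega> \<in> {0}}"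
    using prob_cnt_1[OF H Hfin] prob_cnt_0[OF _ Dfin] by simp
  also have "\<dots> = prob {\<omega> \<in> space \<Omega>. cnt H \<omega> \<in> {1} \<and> cnt (exceed a - H) \<omega> \<in> {0}}"
    by (rule indep2[symmetric]) auto
  also have "\<dots> \<le> prob {\<omega> \<in> space \<Omega>. single \<omega> \<and> leader \<omega> \<in> H}"
  proof (rule finite_measure_mono)
    show "{\<omega> \<in> space \<Omega>. cnt H \<omega> \<in> {1} \<and> cnt (exceed a - H) \<omega> \<in> {0}} \<subseteq> {\<omega> \<in> space \<Omega>. single \<omega> \<and> leader \<omega> \<in> H}"
    proof safe
      fix \<omega> assume \<omega>: "\<omega> \<in> space \<Omega>" and "cnt H \<omega> = 1" "cnt (exceed a - H) \<omega> = 0"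
      then obtain p where p: "\<Phi> \<omega> \<inter> H = {p}" and rest: "\<Phi> \<omega> \<inter> (exceed a - H) = {}"
        using card_1_the_elem[of "\<Phi> \<omega> \<inter> H"] by (auto simp: num_points_eq_1_iff num_points_eq_0_iff)
      have less: "height q i < height p i" if "q \<in> \<Phi> \<omega>" "q \<noteq> p" "i \<in> L" for q i
      proof -
        have "q \<notin> exceed a" "q \<in> space \<Lambda>" using that p rest \<Phi>_space[OF \<omega>] by auto
        then have "height q i < a i" using that by (auto simp: exceed_def not_le)
        also have "\<dots> \<le> height p i" using a(2)[of p i] p that by blast
        finally show ?thesis .
      qed
      have Zp: "Z \<omega> i = height p i" if "i \<in> L" for i
        unfolding Z_eq[OF that]
      proof (rule cSup_eq_maximum)
        show "height p i \<in> (\<lambda>p. height p i) ` \<Phi> \<omega>" using p by blast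
        fix x assume "x \<in> (\<lambda>p. height p i) ` \<Phi> \<omega>"
        then obtain q where "q \<in> \<Phi> \<omega>" "x = height q i" by blast
        then show "x \<le> height p i" using less[of q i] that by (cases "q = p") (simp_all add: less_imp_le)
      qed
      have "hits \<omega> = {p}"
      proof (rule equalityI; rule subsetI)
        fix q assume "q \<in> hits \<omega>"
        then have "q \<in> \<Phi> \<omega>" "height q 1 = height p 1" using Zp[OF 1] 1 by (auto simp: hits_def I_set_eq)
        then show "q \<in> {p}" using less[of q 1] 1 by (cases "q = p") simp_all
      next
        fix q assume "q \<in> {p}"
        then have "q = p" "p \<in> \<Phi> \<omega>" using p by auto
        moreover have "p \<in> space \<Lambda>" using \<Phi>_space[OF \<omega>] \<open>p \<in> \<Phi> \<omega>\<close> by (rule subsetD)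
        ultimately show "q \<in> hits \<omega>" using Zp by (simp add: hits_def I_set_eq)
      qed
      then show "single \<omega>" "leader \<omega> \<in> H" using p by (auto simp: single_def leader_def)
    qed
  qed measurable
  finally show ?thesis .
qed

text \<open>Rational corners leave countably many windows \<open>[a, b)\<close>. A window inside \<open>[z / c, c z]\<close> with \<open>c\<close> close to one
  has nearly constant \<open>excess\<close>, by scaling and monotonicity.\<close>

lemma good_window:
  assumes e: "e > 0" and z: "\<And>i. i \<in> L \<Longrightarrow> z i > 0"
  shows "\<exists>a\<in>PiE L (\<lambda>_. \<rat>). \<exists>b\<in>PiE L (\<lambda>_. \<rat>).
    (\<forall>i\<in>L. 0 < a i \<and> a i \<le> z i \<and> z i < b i) \<and> excess a \<le> excess b + e"
proof -
  \<comment> \<open>With \<open>c = 1 + \<delta>\<close> the excess varies by at most \<open>excess z * (c - 1 / c) \<le> 2 * \<delta> * excess z \<le> e\<close>; the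
    summand \<open>1\<close> avoids division by zero.\<close>
  define \<delta> where "\<delta> = e / (2 * (excess z + 1))"
  define c where "c = 1 + \<delta>"
  have \<delta>: "\<delta> > 0" using e excess_nonneg[of z] by (simp add: \<delta>_def)
  then have c: "c > 1" by (simp add: c_def)
  have "\<forall>i\<in>L. \<exists>q\<in>\<rat>. z i / c < q \<and> q < z i"
  proof
    fix i assume "i \<in> L"
    then have "z i / c < z i" using c z by (simp add: field_simps)
    then show "\<exists>q\<in>\<rat>. z i / c < q \<and> q < z i" by (rule Rats_dense_in_real)
  qed
  then obtain a where a: "\<And>i. i \<in> L \<Longrightarrow> a i \<in> \<rat> \<and> z i / c < a i \<and> a i < z i" by metis
  have "\<forall>i\<in>L. \<exists>q\<in>\<rat>. z i < q \<and> q < c * z i"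
  proof
    fix i assume "i \<in> L"
    then have "z i < c * z i" using c z by simp
    then show "\<exists>q\<in>\<rat>. z i < q \<and> q < c * z i" by (rule Rats_dense_in_real)
  qed
  then obtain b where b: "\<And>i. i \<in> L \<Longrightarrow> b i \<in> \<rat> \<and> z i < b i \<and> b i < c * z i" by metis
  have a0: "a i > 0" if "i \<in> L" for i
  proof -
    have "0 < z i / c" using z[OF that] c by simp
    then show ?thesis using a[OF that] by linarith
  qed
  have b0: "b i > 0" if "i \<in> L" for i using b[OF that] z[OF that] by linarith
  have "excess a \<le> excess (\<lambda>i. (1 / c) * z i)"
    using a z c by (intro excess_antimono) (auto intro: less_imp_le)
  also have "\<dots> = excess z * c" using c z by (subst excess_scale) auto
  finally have Va: "excess a \<le> excess z * c" .
  have "excess z / c = excess (\<lambda>i. c * z i)" using c z by (subst excess_scale) auto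
  also have "\<dots> \<le> excess b" using b b0 by (intro excess_antimono) (auto intro: less_imp_le)
  finally have Vb: "excess z / c \<le> excess b" .
  have "c - 1 / c \<le> 2 * \<delta>"
  proof -
    have "1 - \<delta> \<le> 1 / c" using c \<delta> by (simp add: c_def field_simps)
    then show ?thesis by (simp add: c_def)
  qed
  then have "excess z * (c - 1 / c) \<le> excess z * (2 * \<delta>)" using excess_nonneg by (rule mult_left_mono)
  also have "\<dots> \<le> (excess z + 1) * (2 * \<delta>)" using \<delta> by (intro mult_right_mono) auto
  also have "\<dots> = e" using excess_nonneg[of z] by (simp add: \<delta>_def field_simps add_nonneg_eq_0_iff)
  finally have "excess z * c - excess z / c \<le> e" by (simp add: right_diff_distrib)
  then have "excess a \<le> excess b + e" using Va Vb by linarith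
  moreover have "excess (restrict a L) = excess a" "excess (restrict b L) = excess b"
    by (auto intro!: excess_cong)
  ultimately show ?thesis
    using a b a0 by (intro bexI[of _ "restrict a L"] bexI[of _ "restrict b L"]) (auto intro: less_imp_le)
qed

definition leader_law :: "storm measure" where
  "leader_law = distr (restrict_space \<Omega> {\<omega> \<in> space \<Omega>. single \<omega>}) \<Lambda> leader"

lemma sets_leader_law [simp]: "sets leader_law = sets \<Lambda>" by (simp add: leader_law_def)

lemma emeasure_leader_law:
  assumes "A \<in> sets \<Lambda>"
  shows "emeasure leader_law A = emeasure \<Omega> {\<omega> \<in> space \<Omega>. single \<omega> \<and> leader \<omega> \<in> A}"
  unfolding leader_law_def using assms leader_measurable
  by (simp add: emeasure_distr emeasure_restrict_space space_restrict_space)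
     (auto intro!: arg_cong[where f = "emeasure \<Omega>"])

definition leader_density :: "storm measure" where
  "leader_density = density \<Lambda> (\<lambda>p. ennreal (exp (- excess (heights p))))"

lemma sets_leader_density [simp]: "sets leader_density = sets \<Lambda>" by (simp add: leader_density_def)

lemma emeasure_leader_density:
  "A \<in> sets \<Lambda> \<Longrightarrow> emeasure leader_density A = (\<integral>\<^sup>+p. ennreal (exp (- excess (heights p))) * indicator A p \<partial>\<Lambda>)"
  unfolding leader_density_def by (rule emeasure_density) measurable

text \<open>A storm \<open>p\<close> of the process is the single leader if no other storm reaches one of its heights, which
  has probability \<open>exp (- excess (heights p))\<close>. To make this precise without Palm calculus, the two measures are
  compared on small windows of heights: there both lie between \<open>\<Lambda> A * exp (- excess a)\<close> and
  \<open>\<Lambda> A * exp (- excess b)\<close>, which differ by a factor of at most \<open>exp e\<close>. Countably many windows cover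
  \<open>H\<close>, and \<open>e\<close> is arbitrary.\<close>

lemma leader_law_eq_density:
  assumes H: "H \<in> sets \<Lambda>" "H \<subseteq> positive_heights"
  shows "emeasure leader_law H = emeasure leader_density H"
proof -
  define win where "win a b = {p \<in> space \<Lambda>. \<forall>i\<in>L. a i \<le> height p i \<and> height p i < b i}" for a b
  have [measurable]: "win a b \<in> sets \<Lambda>" for a b unfolding win_def by measurable
  define \<C> where "\<C> e = (\<lambda>(a, b). win a b) ` {(a, b). a \<in> PiE L (\<lambda>_. \<rat>) \<and> b \<in> PiE L (\<lambda>_. \<rat>)
      \<and> (\<forall>i\<in>L. 0 < a i \<and> 0 < b i) \<and> excess a \<le> excess b + e}" for e
  have count: "countable (\<C> e)" for e
  proof -
    have "countable (PiE L (\<lambda>_. \<rat>) \<times> PiE L (\<lambda>_. \<rat>) :: ((nat \<Rightarrow> real) \<times> (nat \<Rightarrow> real)) set)"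
      by (intro countable_SIGMA countable_PiE countable_rat) auto
    then show ?thesis unfolding \<C>_def by (intro countable_image) (erule countable_subset[rotated], auto)
  qed
  have cover: "H \<subseteq> \<Union> (\<C> e)" if e: "e > 0" for e
  proof
    fix p assume "p \<in> H"
    then have p: "p \<in> space \<Lambda>" "\<And>i. i \<in> L \<Longrightarrow> height p i > 0" using H(2) by (auto simp: positive_heights_def)
    obtain a b where ab: "a \<in> PiE L (\<lambda>_. \<rat>)" "b \<in> PiE L (\<lambda>_. \<rat>)"
      "\<forall>i\<in>L. 0 < a i \<and> a i \<le> height p i \<and> height p i < b i" "excess a \<le> excess b + e"
      using good_window[of e "height p", OF e p(2)] by blast
    have "p \<in> win a b" using p(1) ab(3) by (auto simp: win_def)
    moreover have "\<forall>i\<in>L. 0 < a i \<and> 0 < b i" using ab(3) p(2) by (meson less_trans)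
    ultimately show "p \<in> \<Union> (\<C> e)" unfolding \<C>_def using ab by blast
  qed
  have window: "emeasure leader_law A \<le> ennreal (exp e) * emeasure leader_density A \<and>
      emeasure leader_density A \<le> ennreal (exp e) * emeasure leader_law A"
    if C: "C \<in> \<C> e" and A: "A \<in> sets \<Lambda>" "A \<subseteq> C" for A C e
  proof -
    have "\<exists>a b. (\<forall>i\<in>L. 0 < a i) \<and> (\<forall>i\<in>L. 0 < b i) \<and> excess a \<le> excess b + e \<and> C = win a b"
      using C unfolding \<C>_def by blast
    then obtain a b where ab0: "\<forall>i\<in>L. 0 < a i" "\<forall>i\<in>L. 0 < b i" and ab12: "excess a \<le> excess b + e" "C = win a b"
      by blast
    have ab: "\<And>i. i \<in> L \<Longrightarrow> 0 < a i" "\<And>i. i \<in> L \<Longrightarrow> 0 < b i" "excess a \<le> excess b + e" "C = win a b"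
      using ab0 ab12 by auto
    have Aa: "a i \<le> height p i" and Ab: "height p i < b i" if "p \<in> A" "i \<in> L" for p i
      using that A ab by (auto simp: win_def)
    have Asp: "p \<in> space \<Lambda>" if "p \<in> A" for p using that A sets.sets_into_space by blast
    have 1: "1 \<in> L" using l_pos by auto
    have "A \<subseteq> exceed a" using Aa 1 Asp by (auto simp: exceed_def)
    then have fin: "emeasure \<Lambda> A < \<infinity>"
      by (rule emeasure_finite_subset) (use emeasure_exceed_finite[of a] ab(1) in auto)
    then have m: "emeasure \<Lambda> A = ennreal (measure \<Lambda> A)" by (simp add: emeasure_eq_ennreal_measure less_top)
    have Va: "excess (heights p) \<le> excess a" if "p \<in> A" for p
      using Aa[OF that] ab(1) by (intro excess_antimono) auto
    have Vb: "excess b \<le> excess (heights p)" if "p \<in> A" for p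
      using Aa[OF that] Ab[OF that] ab(1) by (intro excess_antimono) (auto intro: less_imp_le less_le_trans)
    have const: "(\<integral>\<^sup>+p. ennreal (exp x) * indicator A p \<partial>\<Lambda>) = ennreal (measure \<Lambda> A * exp x)" for x
      unfolding nn_integral_cmult_indicator[OF A(1)] m by (simp add: ennreal_mult'[symmetric] mult.commute)
    have lo: "ennreal (measure \<Lambda> A * exp (- excess a)) \<le> emeasure leader_density A"
    proof -
      have "ennreal (measure \<Lambda> A * exp (- excess a)) = (\<integral>\<^sup>+p. ennreal (exp (- excess a)) * indicator A p \<partial>\<Lambda>)"
        by (simp only: const)
      also have "\<dots> \<le> emeasure leader_density A"
        unfolding emeasure_leader_density[OF A(1)] using Va
        by (intro nn_integral_mono) (auto split: split_indicator intro!: ennreal_leI)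
      finally show ?thesis .
    qed
    have hi: "emeasure leader_density A \<le> ennreal (measure \<Lambda> A * exp (- excess b))"
    proof -
      have "emeasure leader_density A \<le> (\<integral>\<^sup>+p. ennreal (exp (- excess b)) * indicator A p \<partial>\<Lambda>)"
        unfolding emeasure_leader_density[OF A(1)] using Vb
        by (intro nn_integral_mono) (auto split: split_indicator intro!: ennreal_leI)
      also have "\<dots> = ennreal (measure \<Lambda> A * exp (- excess b))"
        by (simp only: const)
      finally show ?thesis .
    qed
    have ba: "measure \<Lambda> A * exp (- excess b) \<le> exp e * (measure \<Lambda> A * exp (- excess a))"
    proof -
      have "exp (- excess b) \<le> exp e * exp (- excess a)" using ab(3) by (simp add: exp_add[symmetric])
      from mult_left_mono[OF this, of "measure \<Lambda> A"] show ?thesis by (simp add: mult_ac)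
    qed
    have up: "emeasure leader_law A \<le> ennreal (measure \<Lambda> A * exp (- excess b))"
      unfolding emeasure_leader_law[OF A(1)] emeasure_eq_measure
      using single_leader_upper[OF A(1) fin ab(2) Ab] by (intro ennreal_leI) auto
    have down: "ennreal (measure \<Lambda> A * exp (- excess a)) \<le> emeasure leader_law A"
      unfolding emeasure_leader_law[OF A(1)] emeasure_eq_measure
      using single_leader_lower[OF A(1) ab(1) Aa] by (intro ennreal_leI) auto
    have ba': "ennreal (measure \<Lambda> A * exp (- excess b)) \<le> ennreal (exp e) * ennreal (measure \<Lambda> A * exp (- excess a))"
      using ba by (simp add: ennreal_mult'[symmetric])
    show ?thesis
      using up hi ba' mult_left_mono[OF lo, of "ennreal (exp e)"] mult_left_mono[OF down, of "ennreal (exp e)"]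
      by (auto intro: order_trans)
  qed
  have 1: "emeasure leader_law H \<le> ennreal (exp e) * emeasure leader_density H" if "e > 0" for e
    by (rule emeasure_le_by_cover[OF _ count[of e] _ _ cover[OF that]])
       (use H window in \<open>auto simp: \<C>_def\<close>)
  have 2: "emeasure leader_density H \<le> ennreal (exp e) * emeasure leader_law H" if "e > 0" for e
    by (rule emeasure_le_by_cover[OF _ count[of e] _ _ cover[OF that]])
       (use H window in \<open>auto simp: \<C>_def\<close>)
  have fin: "emeasure leader_law H < \<infinity>" using H by (simp add: emeasure_leader_law emeasure_eq_measure)
  have "ennreal (exp 1) * emeasure leader_law H < \<infinity>" using fin by (simp add: ennreal_mult_less_top)
  then have "emeasure leader_density H < \<infinity>" using 2[of 1] by (auto simp: le_less_trans)
  then show ?thesis using le_if_le_exp_mult[OF _ 1] le_if_le_exp_mult[OF fin 2] by (intro antisym) auto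
qed

end


section \<open>Independence of a cell from the rest of the process\<close>

lemma sets_borel_atMost:
  "sets (borel :: 'c :: {linorder_topology, second_countable_topology} measure) = sigma_sets UNIV (range atMost)"
proof -
  have "sigma_sets UNIV (range (greaterThan :: 'c \<Rightarrow> _)) = sigma_sets UNIV (range atMost)"
  proof (intro sigma_sets_eqI)
    fix a assume "a \<in> range (greaterThan :: 'c \<Rightarrow> _)"
    then obtain x where "a = {x<..}" by auto
    then have "a = UNIV - {..x}" by auto
    then show "a \<in> sigma_sets UNIV (range atMost)" by (simp only:) (intro sigma_sets.Compl sigma_sets.Basic rangeI)
  next
    fix a assume "a \<in> range (atMost :: 'c \<Rightarrow> _)"
    then obtain x where "a = {..x}" by auto
    then have "a = UNIV - {x<..}" by auto
    then show "a \<in> sigma_sets UNIV (range greaterThan)" by (simp only:) (intro sigma_sets.Compl sigma_sets.Basic rangeI)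
  qed
  then show ?thesis by (simp add: borel_Ioi)
qed

context storm_process begin

text \<open>The maximum at \<open>t e\<close> over the storms outside \<open>A\<close>. With values in \<open>ennreal\<close> its sublevel sets are
  void events without any exception.\<close>

definition sup_off_ennreal :: "storm set \<Rightarrow> nat \<Rightarrow> 'a \<Rightarrow> ennreal" where
  "sup_off_ennreal A e \<omega> = (SUP p\<in>\<Phi> \<omega> - A. ennreal (height p e))"

definition sup_off :: "storm set \<Rightarrow> nat \<Rightarrow> 'a \<Rightarrow> real" where
  "sup_off A e \<omega> = enn2real (sup_off_ennreal A e \<omega>)"

definition above_off :: "storm set \<Rightarrow> nat \<Rightarrow> ennreal \<Rightarrow> storm set" where
  "above_off A e c = {p \<in> space \<Lambda>. p \<notin> A \<and> ennreal (height p e) > c}"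

lemma above_off_sets [measurable (raw)]:
  assumes [measurable]: "A \<in> sets \<Lambda>" shows "above_off A e c \<in> sets \<Lambda>"
  unfolding above_off_def by measurable

lemma sup_off_le_iff:
  assumes "\<omega> \<in> space \<Omega>"
  shows "sup_off_ennreal A e \<omega> \<le> c \<longleftrightarrow> cnt (above_off A e c) \<omega> = 0"
proof -
  have "sup_off_ennreal A e \<omega> \<le> c \<longleftrightarrow> (\<forall>p\<in>\<Phi> \<omega> - A. \<not> ennreal (height p e) > c)"
    by (simp add: sup_off_ennreal_def SUP_le_iff not_less)
  also have "\<dots> \<longleftrightarrow> \<Phi> \<omega> \<inter> above_off A e c = {}"
    using \<Phi>_space[OF assms] unfolding above_off_def by blast
  finally show ?thesis by (simp add: num_points_eq_0_iff)
qed

lemma sup_off_ennreal_measurable [measurable]: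
  assumes [measurable]: "A \<in> sets \<Lambda>"
  shows "sup_off_ennreal A e \<in> borel_measurable \<Omega>"
proof (rule borel_measurableI_le)
  fix c
  have "{\<omega> \<in> space \<Omega>. sup_off_ennreal A e \<omega> \<le> c} = {\<omega> \<in> space \<Omega>. cnt (above_off A e c) \<omega> = 0}"
    using sup_off_le_iff by blast
  also have "\<dots> \<in> sets \<Omega>" by measurable
  finally show "{\<omega> \<in> space \<Omega>. sup_off_ennreal A e \<omega> \<le> c} \<in> sets \<Omega>" .
qed

lemma sup_off_measurable [measurable]: "A \<in> sets \<Lambda> \<Longrightarrow> sup_off A e \<in> borel_measurable \<Omega>"
  unfolding sup_off_def[abs_def] by measurable

lemma regular_config_sup_off:
  assumes r: "regular_config \<omega>" and i: "e \<in> L" and pos: "sup_off A e \<omega> > 0"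
  shows "\<exists>p\<in>\<Phi> \<omega> - A. height p e = sup_off A e \<omega>"
proof -
  obtain n where n: "1 / Suc n < sup_off A e \<omega>"
    using pos reals_Archimedean[of "sup_off A e \<omega>"] by (auto simp: inverse_eq_divide)
  let ?F = "(\<Phi> \<omega> - A) \<inter> {p \<in> space \<Lambda>. height p e \<ge> 1 / Suc n}"
  have sp: "\<Phi> \<omega> \<subseteq> space \<Lambda>" using r by (simp add: regular_config_def)
  have "finite (\<Phi> \<omega> \<inter> {p \<in> space \<Lambda>. height p e \<ge> 1 / Suc n})" using r i unfolding regular_config_def by blast
  then have fin: "finite ?F" by (rule rev_finite_subset) blast
  have ne: "?F \<noteq> {}"
  proof
    assume emp: "?F = {}"
    have "sup_off_ennreal A e \<omega> \<le> ennreal (1 / Suc n)"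
      unfolding sup_off_ennreal_def
    proof (rule SUP_least)
      fix p assume "p \<in> \<Phi> \<omega> - A"
      then have "\<not> height p e \<ge> 1 / Suc n" using emp sp by blast
      then show "ennreal (height p e) \<le> ennreal (1 / Suc n)" by (intro ennreal_leI) simp
    qed
    from enn2real_mono[OF this] n show False by (simp add: sup_off_def)
  qed
  have "Max ((\<lambda>p. height p e) ` ?F) \<in> (\<lambda>p. height p e) ` ?F" using fin ne by (intro Max_in) auto
  then obtain p where p: "p \<in> ?F" "height p e = Max ((\<lambda>p. height p e) ` ?F)" by force
  have "height q e \<le> height p e" if "q \<in> \<Phi> \<omega> - A" for q
  proof (cases "height q e \<ge> 1 / Suc n")
    case True
    then have "q \<in> ?F" using that sp by auto
    then show ?thesis unfolding p(2) using fin by (intro Max_ge) auto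
  next
    case False
    then show ?thesis using p(1) by auto
  qed
  then have "sup_off_ennreal A e \<omega> = ennreal (height p e)"
    unfolding sup_off_ennreal_def using p(1)
    by (intro antisym SUP_least SUP_upper2[of p]) (auto intro: ennreal_leI)
  moreover have "p \<in> space \<Lambda>" "p \<in> \<Phi> \<omega> - A" using p(1) by auto
  ultimately show ?thesis using height_nonneg[of p e] by (intro bexI[of _ p]) (auto simp: sup_off_def)
qed

lemma sup_off_eq:
  assumes "q \<in> \<Phi> \<omega> - A" "\<And>p. p \<in> \<Phi> \<omega> \<Longrightarrow> height p e \<le> height q e" "height q e \<ge> 0"
  shows "sup_off A e \<omega> = height q e"
proof -
  have "sup_off_ennreal A e \<omega> = ennreal (height q e)"
    unfolding sup_off_ennreal_def using assms
    by (intro antisym SUP_least SUP_upper2[of q]) (auto intro: ennreal_leI)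
  then show ?thesis using assms(3) by (simp add: sup_off_def)
qed

text \<open>The supremum off \<open>A\<close> has no atoms and no singular part on the positive axis, because it is
  attained by some storm and almost surely no storm has its height in a given Lebesgue null set of positive
  numbers.\<close>

lemma AE_sup_off:
  assumes Q: "AE x in lborel. Q x" and e: "e \<in> L"
  shows "AE \<omega> in \<Omega>. sup_off A e \<omega> > 0 \<longrightarrow> Q (sup_off A e \<omega>)"
proof -
  obtain N where N: "{x \<in> space lborel. \<not> Q x} \<subseteq> N" "emeasure lborel N = 0" "N \<in> sets lborel"
    using AE_E[OF Q] by blast
  have [measurable]: "N \<in> sets borel" using N by simp
  have "AE x in lborel. x \<notin> N" using N by (intro AE_not_in) (auto simp: null_sets_def)
  then have "AE p in \<Lambda>. height p e > 0 \<longrightarrow> height p e \<notin> N" by (intro AE_height) measurable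
  then have "emeasure \<Lambda> {p \<in> space \<Lambda>. \<not> (height p e > 0 \<longrightarrow> height p e \<notin> N)} = 0"
    by (subst (asm) AE_iff_measurable[OF _ refl]) auto
  then have "AE \<omega> in \<Omega>. \<Phi> \<omega> \<inter> {p \<in> space \<Lambda>. \<not> (height p e > 0 \<longrightarrow> height p e \<notin> N)} = {}"
    by (intro AE_cnt_null) auto
  then show ?thesis using AE_regular_config
  proof eventually_elim
    case (elim \<omega>)
    show ?case
    proof
      assume pos: "sup_off A e \<omega> > 0"
      obtain p where p: "p \<in> \<Phi> \<omega> - A" "height p e = sup_off A e \<omega>"
        using regular_config_sup_off[OF elim(2) e pos] by blast
      moreover have "p \<in> space \<Lambda>" using elim(2) p(1) by (auto simp: regular_config_def)
      ultimately have "sup_off A e \<omega> \<notin> N" using elim(1) pos by auto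
      then show "Q (sup_off A e \<omega>)" using N(1) by auto
    qed
  qed
qed

text \<open>Meaningful if \<open>A\<close> contains exactly one point of the configuration.\<close>

definition lone :: "storm set \<Rightarrow> 'a \<Rightarrow> storm" where "lone A \<omega> = the_elem (\<Phi> \<omega> \<inter> A)"

lemma lone_iff: "cnt A \<omega> = 1 \<and> lone A \<omega> \<in> H \<longleftrightarrow> cnt (A \<inter> H) \<omega> = 1 \<and> cnt (A - H) \<omega> = 0"
proof
  assume *: "cnt A \<omega> = 1 \<and> lone A \<omega> \<in> H"
  then have "\<Phi> \<omega> \<inter> A = {lone A \<omega>}"
    unfolding lone_def num_points_eq_1_iff by (intro card_1_the_elem) simp
  then have "\<Phi> \<omega> \<inter> (A \<inter> H) = {lone A \<omega>}" "\<Phi> \<omega> \<inter> (A - H) = {}"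
    using * by (simp_all add: Int_assoc[symmetric] Diff_Int_distrib[symmetric] Int_Diff[symmetric] insert_absorb)
  then show "cnt (A \<inter> H) \<omega> = 1 \<and> cnt (A - H) \<omega> = 0" by (simp add: num_points_eq_1_iff num_points_eq_0_iff)
next
  assume *: "cnt (A \<inter> H) \<omega> = 1 \<and> cnt (A - H) \<omega> = 0"
  then obtain p where p: "\<Phi> \<omega> \<inter> (A \<inter> H) = {p}" and "\<Phi> \<omega> \<inter> (A - H) = {}"
    by (metis num_points_eq_1_iff num_points_eq_0_iff card_1_the_elem)
  then have "\<Phi> \<omega> \<inter> A = {p}" by blast
  then show "cnt A \<omega> = 1 \<and> lone A \<omega> \<in> H" using p by (auto simp: num_points_eq_1_iff lone_def)
qed

lemma prob_lone:
  assumes [measurable]: "A \<in> sets \<Lambda>" "H \<in> sets \<Lambda>" and fin: "emeasure \<Lambda> A < \<infinity>"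
  shows "prob {\<omega> \<in> space \<Omega>. cnt (A \<inter> H) \<omega> \<in> {1} \<and> cnt (A - H) \<omega> \<in> {0}}
    = measure \<Lambda> (A \<inter> H) * exp (- measure \<Lambda> A)"
proof -
  have f: "emeasure \<Lambda> (A \<inter> H) < \<infinity>" "emeasure \<Lambda> (A - H) < \<infinity>"
    using emeasure_finite_subset[OF Int_lower1 _ fin] emeasure_finite_subset[OF Diff_subset _ fin] by simp_all
  have "measure \<Lambda> A = measure \<Lambda> (A \<inter> H) + measure \<Lambda> (A - H)"
    using fin f measure_Union[of \<Lambda> "A \<inter> H" "A - H"] by (simp add: Int_Diff_Un less_top Int_Diff_disjoint)
  moreover have "prob {\<omega> \<in> space \<Omega>. cnt (A \<inter> H) \<omega> \<in> {1} \<and> cnt (A - H) \<omega> \<in> {0}} =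
     prob {\<omega> \<in> space \<Omega>. cnt (A \<inter> H) \<omega> \<in> {1}} * prob {\<omega> \<in> space \<Omega>. cnt (A - H) \<omega> \<in> {0}}"
    by (rule indep2) auto
  moreover have "prob {\<omega> \<in> space \<Omega>. cnt (A \<inter> H) \<omega> \<in> {1}} = measure \<Lambda> (A \<inter> H) * exp (- measure \<Lambda> (A \<inter> H))"
    "prob {\<omega> \<in> space \<Omega>. cnt (A - H) \<omega> \<in> {0}} = exp (- measure \<Lambda> (A - H))"
    using prob_cnt_1[OF _ f(1)] prob_cnt_0[OF _ f(2)] by simp_all
  ultimately show ?thesis by (simp only: minus_add_distrib exp_add mult.assoc)
qed

text \<open>The sublevel events of the supremum off \<open>A\<close> are void events outside \<open>A\<close>, hence independent
  of the points in \<open>A\<close>; these events generate.\<close>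

lemma sup_off_indep_lone:
  assumes A [measurable]: "A \<in> sets \<Lambda>" and H [measurable]: "H \<in> sets \<Lambda>" and E: "E \<in> sets borel"
  defines "B \<equiv> {\<omega> \<in> space \<Omega>. cnt (A \<inter> H) \<omega> \<in> {1} \<and> cnt (A - H) \<omega> \<in> {0}}"
  shows "emeasure \<Omega> ({\<omega> \<in> space \<Omega>. sup_off_ennreal A e \<omega> \<in> E} \<inter> B)
    = emeasure \<Omega> {\<omega> \<in> space \<Omega>. sup_off_ennreal A e \<omega> \<in> E} * emeasure \<Omega> B"
proof -
  have [measurable]: "B \<in> sets \<Omega>" unfolding B_def by measurable
  let ?S = "sup_off_ennreal A e"
  let ?m1 = "distr (density \<Omega> (indicator B)) borel ?S"
  let ?m2 = "scale_measure (emeasure \<Omega> B) (distr \<Omega> borel ?S)"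
  have m1: "emeasure ?m1 X = emeasure \<Omega> ({\<omega> \<in> space \<Omega>. ?S \<omega> \<in> X} \<inter> B)" if [measurable]: "X \<in> sets borel" for X
  proof -
    have "?S -` X \<inter> space \<Omega> = {\<omega> \<in> space \<Omega>. ?S \<omega> \<in> X}" by auto
    moreover have "{\<omega> \<in> space \<Omega>. ?S \<omega> \<in> X} \<in> sets \<Omega>" by measurable
    ultimately show ?thesis
      by (subst emeasure_distr) (simp_all add: emeasure_density_const emeasure_restricted Int_commute)
  qed
  have m2: "emeasure ?m2 X = emeasure \<Omega> {\<omega> \<in> space \<Omega>. ?S \<omega> \<in> X} * emeasure \<Omega> B" if [measurable]: "X \<in> sets borel" for X
    by (simp add: emeasure_distr vimage_def Int_def conj_commute mult.commute)
  have "?m1 = ?m2"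
  proof (rule measure_eqI_generator_eq[where E = "range (\<lambda>c::ennreal. {..c})" and \<Omega> = UNIV and A = "\<lambda>_. {..top}"])
    show "Int_stable (range (\<lambda>c::ennreal. {..c}))" by (auto simp: Int_stable_def)
    fix X assume "X \<in> range (\<lambda>c::ennreal. {..c})"
    then obtain c where X: "X = {..c}" by auto
    have "prob {\<omega> \<in> space \<Omega>. cnt (above_off A e c) \<omega> \<in> {0} \<and> cnt (A \<inter> H) \<omega> \<in> {1} \<and> cnt (A - H) \<omega> \<in> {0}} =
       prob {\<omega> \<in> space \<Omega>. cnt (above_off A e c) \<omega> \<in> {0}} * prob {\<omega> \<in> space \<Omega>. cnt (A \<inter> H) \<omega> \<in> {1}} *
       prob {\<omega> \<in> space \<Omega>. cnt (A - H) \<omega> \<in> {0}}"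
      by (rule indep3) (auto simp: above_off_def)
    also have "\<dots> = prob {\<omega> \<in> space \<Omega>. cnt (above_off A e c) \<omega> \<in> {0}} * prob B"
      unfolding B_def by (subst indep2) auto
    also have "{\<omega> \<in> space \<Omega>. cnt (above_off A e c) \<omega> \<in> {0}} = {\<omega> \<in> space \<Omega>. ?S \<omega> \<in> X}"
      using sup_off_le_iff by (auto simp: X)
    also have "{\<omega> \<in> space \<Omega>. cnt (above_off A e c) \<omega> \<in> {0} \<and> cnt (A \<inter> H) \<omega> \<in> {1} \<and> cnt (A - H) \<omega> \<in> {0}}
        = {\<omega> \<in> space \<Omega>. ?S \<omega> \<in> X} \<inter> B"
      using sup_off_le_iff by (auto simp: X B_def)
    finally show "emeasure ?m1 X = emeasure ?m2 X"
      by (subst m1 m2, simp add: X)+ (simp add: emeasure_eq_measure ennreal_mult' X)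
  next
    show "sets ?m1 = sigma_sets UNIV (range (\<lambda>c::ennreal. {..c}))"
      "sets ?m2 = sigma_sets UNIV (range (\<lambda>c::ennreal. {..c}))"
      by (simp_all add: sets_borel_atMost)
    show "emeasure ?m1 {..top} \<noteq> \<infinity>" by (subst m1) auto
  qed auto
  then show ?thesis using m1[OF E] m2[OF E] by simp
qed

text \<open>By independence the joint law of the supremum off \<open>A\<close> and the lone point of \<open>A\<close> is the product of the
  law of the former with a multiple of \<open>\<Lambda>\<close> on \<open>A\<close>. Since the supremum has no singular part, Fubini shows that a set
  whose sections are Lebesgue null for almost all storms is avoided.\<close>

lemma lone_pair_null:
  assumes A [measurable]: "A \<in> sets \<Lambda>" and fin: "emeasure \<Lambda> A < \<infinity>" and e: "e \<in> L"
    and T [measurable]: "T \<in> sets (borel \<Otimes>\<^sub>M \<Lambda>)"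
    and null: "AE p in \<Lambda>. AE x in lborel. x > 0 \<longrightarrow> (x, p) \<notin> T"
  shows "AE \<omega> in \<Omega>. cnt A \<omega> = 1 \<longrightarrow> sup_off A e \<omega> > 0 \<longrightarrow> (sup_off A e \<omega>, lone A \<omega>) \<notin> T"
proof -
  \<comment> \<open>The exceptional set is cut down to positive suprema, where \<open>AE_sup_off\<close> applies.\<close>
  define T' where "T' = T \<inter> ({0<..} \<times> space \<Lambda>)"
  have [measurable]: "T' \<in> sets (borel \<Otimes>\<^sub>M \<Lambda>)" unfolding T'_def by measurable
  let ?R = "restrict_space \<Omega> {\<omega> \<in> space \<Omega>. cnt A \<omega> = 1}"
  let ?P = "distr \<Omega> borel (sup_off A e)"
  let ?\<nu> = "density \<Lambda> (\<lambda>p. ennreal (exp (- measure \<Lambda> A)) * indicator A p)"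
  have \<nu>: "emeasure ?\<nu> H = ennreal (measure \<Lambda> (A \<inter> H) * exp (- measure \<Lambda> A))" if [measurable]: "H \<in> sets \<Lambda>" for H
  proof -
    have "emeasure ?\<nu> H = (\<integral>\<^sup>+p. ennreal (exp (- measure \<Lambda> A)) * indicator (A \<inter> H) p \<partial>\<Lambda>)"
      by (subst emeasure_density) (auto intro!: nn_integral_cong split: split_indicator)
    also have "\<dots> = ennreal (exp (- measure \<Lambda> A)) * emeasure \<Lambda> (A \<inter> H)"
      by (rule nn_integral_cmult_indicator) measurable
    also have "emeasure \<Lambda> (A \<inter> H) = ennreal (measure \<Lambda> (A \<inter> H))"
      using emeasure_finite_subset[OF Int_lower1 A fin, of H] by (intro emeasure_eq_ennreal_measure) auto
    finally show ?thesis by (simp add: ennreal_mult'[symmetric] mult.commute)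
  qed
  have lone_meas: "lone A \<in> measurable ?R \<Lambda>"
  proof (rule measurableI)
    fix \<omega> assume "\<omega> \<in> space ?R"
    then show "lone A \<omega> \<in> space \<Lambda>"
      using card_1_the_elem[of "\<Phi> \<omega> \<inter> A"] \<Phi>_space[of \<omega>]
      by (auto simp: space_restrict_space lone_def num_points_eq_1_iff)
  next
    fix H assume [measurable]: "H \<in> sets \<Lambda>"
    have "lone A -` H \<inter> space ?R = {\<omega> \<in> space \<Omega>. cnt A \<omega> = 1 \<and> lone A \<omega> \<in> H}"
      by (auto simp: space_restrict_space)
    also have "\<dots> = {\<omega> \<in> space \<Omega>. cnt (A \<inter> H) \<omega> = 1 \<and> cnt (A - H) \<omega> = 0}"
      by (simp only: lone_iff)
    also have "\<dots> \<in> sets \<Omega>" by measurable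
    finally show "lone A -` H \<inter> space ?R \<in> sets ?R"
      by (subst sets_restrict_space_iff) (auto simp: space_restrict_space)
  qed
  have pair_meas [measurable]: "(\<lambda>\<omega>. (sup_off A e \<omega>, lone A \<omega>)) \<in> measurable ?R (borel \<Otimes>\<^sub>M \<Lambda>)"
    by (rule measurable_Pair[OF measurable_restrict_space1 lone_meas]) measurable
  let ?m = "distr ?R (borel \<Otimes>\<^sub>M \<Lambda>) (\<lambda>\<omega>. (sup_off A e \<omega>, lone A \<omega>))"
  interpret P: prob_space ?P by (rule prob_space_distr) measurable
  interpret N: finite_measure ?\<nu>
    by (rule finite_measureI) (use \<nu>[OF sets.top] in simp)
  interpret PN: pair_sigma_finite ?P ?\<nu> ..
  have "?P \<Otimes>\<^sub>M ?\<nu> = ?m"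
  proof (rule pair_measure_eqI)
    show "sigma_finite_measure ?P" "sigma_finite_measure ?\<nu>" ..
    show "sets (?P \<Otimes>\<^sub>M ?\<nu>) = sets ?m" by (simp cong: sets_pair_measure_cong)
    fix E H assume "E \<in> sets ?P" "H \<in> sets ?\<nu>"
    then have [measurable]: "E \<in> sets borel" "H \<in> sets \<Lambda>" by auto
    let ?B = "{\<omega> \<in> space \<Omega>. cnt (A \<inter> H) \<omega> \<in> {1} \<and> cnt (A - H) \<omega> \<in> {0}}"
    have "emeasure ?m (E \<times> H) = emeasure ?R ((\<lambda>\<omega>. (sup_off A e \<omega>, lone A \<omega>)) -` (E \<times> H) \<inter> space ?R)"
      by (rule emeasure_distr) measurable
    also have "(\<lambda>\<omega>. (sup_off A e \<omega>, lone A \<omega>)) -` (E \<times> H) \<inter> space ?R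
        = {\<omega> \<in> space \<Omega>. sup_off_ennreal A e \<omega> \<in> enn2real -` E} \<inter> {\<omega> \<in> space \<Omega>. cnt A \<omega> = 1 \<and> lone A \<omega> \<in> H}"
      by (auto simp: space_restrict_space sup_off_def)
    also have "emeasure ?R \<dots> = emeasure \<Omega> \<dots>"
      by (intro emeasure_restrict_space) auto
    also have "{\<omega> \<in> space \<Omega>. cnt A \<omega> = 1 \<and> lone A \<omega> \<in> H} = ?B"
      by (simp only: lone_iff singleton_iff)
    also have "emeasure \<Omega> ({\<omega> \<in> space \<Omega>. sup_off_ennreal A e \<omega> \<in> enn2real -` E} \<inter> ?B)
        = emeasure \<Omega> {\<omega> \<in> space \<Omega>. sup_off_ennreal A e \<omega> \<in> enn2real -` E} * emeasure \<Omega> ?B"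
    proof (rule sup_off_indep_lone)
      have "(enn2real -` E \<inter> space (borel :: ennreal measure)) \<in> sets borel"
        by (rule measurable_sets[OF _ \<open>E \<in> sets borel\<close>]) measurable
      then show "enn2real -` E \<in> sets (borel :: ennreal measure)" by simp
    qed (fact A, fact)
    also have "{\<omega> \<in> space \<Omega>. sup_off_ennreal A e \<omega> \<in> enn2real -` E} = sup_off A e -` E \<inter> space \<Omega>"
      by (auto simp: sup_off_def)
    also have "emeasure \<Omega> \<dots> = emeasure ?P E" by (rule emeasure_distr[symmetric]) measurable
    also have "emeasure \<Omega> ?B = emeasure ?\<nu> H"
      using prob_lone[OF A _ fin, of H] by (simp add: \<nu> emeasure_eq_measure)
    finally show "emeasure ?P E * emeasure ?\<nu> H = emeasure ?m (E \<times> H)" ..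
  qed
  moreover have "AE z in ?P \<Otimes>\<^sub>M ?\<nu>. z \<notin> T'"
  proof -
    have T'': "{x \<in> space (?P \<Otimes>\<^sub>M ?\<nu>). (fst x, snd x) \<notin> T'} \<in> sets (?P \<Otimes>\<^sub>M ?\<nu>)"
    proof -
      have "{x \<in> space (borel \<Otimes>\<^sub>M \<Lambda>). x \<notin> T'} \<in> sets (borel \<Otimes>\<^sub>M \<Lambda>)" by measurable
      then show ?thesis by (simp add: space_pair_measure cong: sets_pair_measure_cong)
    qed
    have "AE p in \<Lambda>. AE x in ?P. (x, p) \<notin> T'"
      using null
    proof eventually_elim
      case (elim p)
      have "AE \<omega> in \<Omega>. sup_off A e \<omega> > 0 \<longrightarrow> (sup_off A e \<omega> > 0 \<longrightarrow> (sup_off A e \<omega>, p) \<notin> T)"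
        by (rule AE_sup_off[OF elim e])
      then have "AE \<omega> in \<Omega>. (sup_off A e \<omega>, p) \<notin> T'" by eventually_elim (auto simp: T'_def)
      moreover have "{x \<in> space borel. (x, p) \<notin> T'} \<in> sets borel"
        if "p \<in> space \<Lambda>" using that by measurable
      moreover have "{x \<in> space borel. (x, p) \<notin> T'} = UNIV" if "p \<notin> space \<Lambda>" using that by (auto simp: T'_def)
      ultimately show ?case by (subst AE_distr_iff) (cases "p \<in> space \<Lambda>"; auto)+
    qed
    then have "AE p in ?\<nu>. AE x in ?P. (x, p) \<notin> T'" by (subst AE_density) (auto elim: eventually_mono)
    then have "AE x in ?P. AE p in ?\<nu>. (x, p) \<notin> T'" using PN.AE_commute[OF T''] by simp
    then show ?thesis using T'' by (intro PN.AE_pair_measure) simp_all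
  qed
  ultimately have "AE z in ?m. z \<notin> T'" by (simp only:)
  then have "AE \<omega> in ?R. (sup_off A e \<omega>, lone A \<omega>) \<notin> T'"
    by (rule AE_distrD[OF pair_meas])
  then have "AE \<omega> in \<Omega>. \<omega> \<in> {\<omega> \<in> space \<Omega>. cnt A \<omega> = 1} \<longrightarrow> (sup_off A e \<omega>, lone A \<omega>) \<notin> T'"
    by (subst (asm) AE_restrict_space_iff) auto
  then show ?thesis using AE_space
  proof eventually_elim
    case (elim \<omega>)
    show ?case
    proof (intro impI)
      assume *: "cnt A \<omega> = 1" "sup_off A e \<omega> > 0"
      then have "lone A \<omega> \<in> space \<Lambda>"
        using card_1_the_elem[of "\<Phi> \<omega> \<inter> A"] \<Phi>_space[OF elim(2)] by (auto simp: lone_def num_points_eq_1_iff)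
      then show "(sup_off A e \<omega>, lone A \<omega>) \<notin> T" using elim * by (auto simp: T'_def)
    qed
  qed
qed

definition cell :: "real \<Rightarrow> real \<Rightarrow> real \<Rightarrow> real \<Rightarrow> (real \<Rightarrow> real) \<Rightarrow> storm set" where
  "cell a b c d g = {p \<in> space \<Lambda>. a < fst p \<and> fst p < b \<and> c < fst (snd p) \<and> fst (snd p) < d \<and> snd (snd p) = g}"

text \<open>Independence needs a fixed region, whereas the storm of interest is random. Countably many regions of
  finite intensity suffice to isolate every storm of every configuration, so that each storm is the lone point of
  one of them.\<close>

definition cells :: "storm set set" where
  "cells = (\<lambda>(a, b, c, d, g). cell a b c d g) ` (\<rat> \<times> \<rat> \<times> (\<rat> \<inter> {0<..}) \<times> \<rat> \<times> G)"

lemma countable_cells: "countable cells"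
  unfolding cells_def using G_fin
  by (intro countable_image countable_SIGMA countable_rat countable_Int1 countable_finite)

lemma cells_sets: "A \<in> cells \<Longrightarrow> A \<in> sets \<Lambda>"
proof -
  assume "A \<in> cells"
  then obtain a b c d g where A: "A = cell a b c d g" "g \<in> G" by (auto simp: cells_def)
  show ?thesis unfolding A cell_def using A(2) by measurable
qed

lemma cells_finite: "A \<in> cells \<Longrightarrow> emeasure \<Lambda> A < \<infinity>"
proof -
  assume A: "A \<in> cells"
  then obtain a b c d g where *: "A = cell a b c d g" "c > 0" by (auto simp: cells_def)
  note [measurable] = cells_sets[OF A]
  have "emeasure \<Lambda> A = (\<integral>\<^sup>+p. indicator A p \<partial>\<Lambda>)" by simp
  also have "\<dots> = (\<integral>\<^sup>+f. (\<integral>\<^sup>+s. (\<integral>\<^sup>+u. indicator {0<..} u * (indicator A (s, u, f) * ennreal (1 / u\<^sup>2)) \<partial>lborel) \<partial>lborel) \<partial>PF)"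
    by (rule nn_integral_intensity) measurable
  also have "\<dots> \<le> (\<integral>\<^sup>+f. (\<integral>\<^sup>+s. (\<integral>\<^sup>+u. ennreal (1 / c\<^sup>2) * indicator {a..b} s * indicator {c..d} u \<partial>lborel) \<partial>lborel) \<partial>PF)"
  proof (intro nn_integral_mono)
    fix f and s u :: real
    show "indicator {0<..} u * (indicator A (s, u, f) * ennreal (1 / u\<^sup>2)) \<le> ennreal (1 / c\<^sup>2) * indicator {a..b} s * indicator {c..d} u"
    proof (cases "u > 0 \<and> (s, u, f) \<in> A")
      case True
      then have u: "u > c" "s \<in> {a..b}" "u \<in> {c..d}" by (auto simp: * cell_def)
      then have "1 / u\<^sup>2 \<le> 1 / c\<^sup>2" using *(2) by (intro divide_left_mono power_mono mult_pos_pos) auto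
      then show ?thesis using True u by (auto intro: ennreal_leI)
    qed (auto split: split_indicator)
  qed
  also have "\<dots> = (\<integral>\<^sup>+f. ennreal (1 / c\<^sup>2) * ennreal (max 0 (d - c)) * ennreal (max 0 (b - a)) \<partial>PF)"
  proof -
    have "(\<integral>\<^sup>+u. ennreal (1 / c\<^sup>2) * indicator {a..b} s * indicator {c..d} u \<partial>lborel)
        = (ennreal (1 / c\<^sup>2) * ennreal (max 0 (d - c))) * indicator {a..b} s" for s
      by (subst nn_integral_cmult_indicator) (auto simp: mult_ac emeasure_lborel_Icc_eq max_def)
    then show ?thesis
      by (simp add: nn_integral_cmult_indicator emeasure_lborel_Icc_eq max_def del: nn_integral_const)
  qed
  also have "\<dots> < \<infinity>"
    using prob_space.emeasure_space_1[OF PF_prob] by (simp add: ennreal_mult_less_top)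
  finally show ?thesis .
qed

text \<open>Near \<open>p\<close> there are finitely many storms by local finiteness, hence a positive distance to the nearest
  one with another shift or amplitude; the profile separates the others.\<close>

lemma cell_isolates:
  assumes \<omega>: "\<omega> \<in> space \<Omega>" and p: "p \<in> \<Phi> \<omega>"
  shows "\<exists>A\<in>cells. \<Phi> \<omega> \<inter> A = {p}"
proof -
  obtain s u f where [simp]: "p = (s, u, f)" by (cases p)
  have u: "u > 0" "f \<in> G" using \<Phi>_space[OF \<omega>] p by auto
  let ?C = "{s - 1..s + 1} \<times> {u / 2..2 * u}"
  let ?F = "{q \<in> \<Phi> \<omega>. (fst q, fst (snd q)) \<in> ?C}"
  have fin: "finite ?F" by (rule finite_compact[OF \<omega>]) (use u in \<open>auto intro: compact_Times\<close>)
  have "\<exists>d>0. \<forall>x\<in>(\<lambda>q. (fst q, fst (snd q))) ` ?F. x \<noteq> (s, u) \<longrightarrow> d \<le> dist (s, u) x"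
    by (rule finite_set_avoid) (intro finite_imageI fin)
  then obtain d where d: "d > 0" "\<forall>x\<in>(\<lambda>q. (fst q, fst (snd q))) ` ?F. x \<noteq> (s, u) \<longrightarrow> d \<le> dist (s, u) x"
    by blast
  define r where "r = min (d / 2) (min 1 (u / 2))"
  have r: "r > 0" "r \<le> d / 2" "r \<le> 1" "r \<le> u / 2" using d u by (auto simp: r_def)
  obtain a where a: "a \<in> \<rat>" "s - r < a" "a < s" using Rats_dense_in_real[of "s - r" s] r by auto
  obtain b where b: "b \<in> \<rat>" "s < b" "b < s + r" using Rats_dense_in_real[of s "s + r"] r by auto
  obtain c where c: "c \<in> \<rat>" "u - r < c" "c < u" using Rats_dense_in_real[of "u - r" u] r by auto
  obtain e where e: "e \<in> \<rat>" "u < e" "e < u + r" using Rats_dense_in_real[of u "u + r"] r by auto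
  have "c > 0" using c r u by linarith
  then have "cell a b c e f \<in> cells" unfolding cells_def using a b c e u by (intro image_eqI[of _ _ "(a, b, c, e, f)"]) auto
  moreover have "\<Phi> \<omega> \<inter> cell a b c e f = {p}"
  proof
    show "{p} \<subseteq> \<Phi> \<omega> \<inter> cell a b c e f" using p a b c e u by (auto simp: cell_def)
    show "\<Phi> \<omega> \<inter> cell a b c e f \<subseteq> {p}"
    proof
      fix q assume q: "q \<in> \<Phi> \<omega> \<inter> cell a b c e f"
      obtain s' u' f' where [simp]: "q = (s', u', f')" by (cases q)
      have q': "\<bar>s - s'\<bar> < r" "\<bar>u - u'\<bar> < r" "f' = f" using q a b c e by (auto simp: cell_def)
      then have "s' \<in> {s - 1..s + 1}" "u' \<in> {u / 2..2 * u}" using r by auto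
      then have "q \<in> ?F" using q by auto
      then have "(s', u') \<in> (\<lambda>q. (fst q, fst (snd q))) ` ?F" by force
      moreover have "dist (s, u) (s', u') < d"
      proof -
        have "dist (s, u) (s', u') \<le> \<bar>s - s'\<bar> + \<bar>u - u'\<bar>"
          by (simp add: dist_Pair_Pair dist_real_def sqrt_sum_squares_le_sum_abs)
        then show ?thesis using q' r by linarith
      qed
      ultimately have "(s', u') = (s, u)" using d(2) not_le by blast
      then show "q \<in> {p}" using q' by simp
    qed
  qed
  ultimately show ?thesis by blast
qed

end


section \<open>Charts of storms with a given profile\<close>

context storm_model begin

definition strip :: "(real \<Rightarrow> real) \<Rightarrow> real \<Rightarrow> real \<Rightarrow> storm set" where
  "strip f j1 j2 = {p \<in> space \<Lambda>. fst p \<in> {j1..j2} \<and> snd (snd p) = f}"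

definition is_branch :: "nat \<Rightarrow> nat \<Rightarrow> (real \<Rightarrow> real) \<Rightarrow> real \<Rightarrow> real \<Rightarrow> bool" where
  "is_branch a b f j1 j2 \<longleftrightarrow> a \<in> L \<and> b \<in> L \<and> f \<in> G \<and> branch_interval f (t a) (t b) j1 j2"

text \<open>The weight \<open>u\<^sup>-\<^sup>2 P\<^sub>F{f}\<close> of the storm in the intensity, divided by the absolute Jacobian
  \<open>u \<bar>wronskian\<bar>\<close> of the heights with indices \<open>a\<close> and \<open>b\<close>.\<close>

definition weight :: "nat \<Rightarrow> nat \<Rightarrow> storm \<Rightarrow> real" where
  "weight a b p = (case p of (s, u, f) \<Rightarrow> measure PF {f} / (u\<^sup>2 * (u * \<bar>wronskian f (t a) (t b) s\<bar>)))"

definition ratios :: "nat \<Rightarrow> nat \<Rightarrow> (real \<Rightarrow> real) \<Rightarrow> real \<Rightarrow> real \<Rightarrow> real set" where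
  "ratios a b f j1 j2 = height_ratio f (t a) (t b) ` {j1..j2}"

text \<open>The storm of the strip with height \<open>v\<close> at \<open>t a\<close> and \<open>v r\<close> at \<open>t b\<close>. So \<open>storm_of\<close> inverts the chart
  \<open>p \<mapsto> (height p a, height p b / height p a)\<close> of the strip.\<close>

definition storm_of :: "nat \<Rightarrow> nat \<Rightarrow> (real \<Rightarrow> real) \<Rightarrow> real \<Rightarrow> real \<Rightarrow> real \<Rightarrow> real \<Rightarrow> storm" where
  "storm_of a b f j1 j2 v r =
     (let s = branch_inv f (t a) (t b) j1 j2 r in (s, v / f (t a - s), f))"

text \<open>The only storm of the strip that can have the heights \<open>z\<close>; two coordinates of \<open>z\<close> determine it.\<close>

definition locate :: "nat \<Rightarrow> nat \<Rightarrow> (real \<Rightarrow> real) \<Rightarrow> real \<Rightarrow> real \<Rightarrow> (nat \<Rightarrow> real) \<Rightarrow> storm" where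
  "locate a b f j1 j2 z = storm_of a b f j1 j2 (z a) (z b / z a)"

definition strip_image :: "(real \<Rightarrow> real) \<Rightarrow> real \<Rightarrow> real \<Rightarrow> (nat \<Rightarrow> real) set" where
  "strip_image f j1 j2 = heights ` (strip f j1 j2 \<inter> positive_heights)"

lemma coordinate_measurable: "i \<in> L \<Longrightarrow> (\<lambda>z. z i) \<in> borel_measurable V"
  unfolding vec_space_def by measurable

lemma coordinates_measurable:
  assumes "a \<in> L" "b \<in> L" "i \<in> L" "h \<in> measurable (borel \<Otimes>\<^sub>M borel \<Otimes>\<^sub>M borel) N"
  shows "(\<lambda>z. h (z a, z b, z i)) \<in> measurable V N"
  by (rule measurable_compose[OF _ assms(4)]) (intro measurable_Pair coordinate_measurable assms(1-3))

lemma heights_in_V [simp]: "heights p \<in> space V"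
  by (simp add: vec_space_def heights_def space_PiM)

lemma strip_sets [measurable]: "f \<in> G \<Longrightarrow> strip f j1 j2 \<in> sets \<Lambda>"
  unfolding strip_def by measurable

lemma branch_profile: "is_branch a b f j1 j2 \<Longrightarrow> branch f (t a) (t b) j1 j2"
  by (simp add: is_branch_def branch_def G_meas)

context
  fixes a b f j1 j2 assumes B: "is_branch a b f j1 j2"
begin

interpretation branch f "t a" "t b" j1 j2 using B by (rule branch_profile)

lemma idx: "a \<in> L" "b \<in> L" "f \<in> G" using B by (auto simp: is_branch_def)

lemma storm_of_in_strip:
  assumes "v > 0" "r \<in> ratios a b f j1 j2"
  shows "storm_of a b f j1 j2 v r \<in> strip f j1 j2"
    "height (storm_of a b f j1 j2 v r) a = v" "height (storm_of a b f j1 j2 v r) b = v * r"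
proof -
  have s: "\<sigma> r \<in> J" by (rule \<sigma>_in)
  note pos = f_pos[OF s]
  show "storm_of a b f j1 j2 v r \<in> strip f j1 j2"
    using s pos assms(1) idx by (auto simp: strip_def storm_of_def Let_def)
  show "height (storm_of a b f j1 j2 v r) a = v" using pos by (simp add: storm_of_def Let_def)
  have "q (\<sigma> r) = r" using assms(2) by (simp add: q_\<sigma> ratios_def)
  then show "height (storm_of a b f j1 j2 v r) b = v * r"
    using pos by (simp add: storm_of_def Let_def height_ratio_def field_simps)
qed

lemma strip_storm_of:
  assumes "p \<in> strip f j1 j2"
  shows "height p a > 0" "height p b / height p a \<in> ratios a b f j1 j2"
    "storm_of a b f j1 j2 (height p a) (height p b / height p a) = p"
proof -
  obtain s u where p: "p = (s, u, f)" "s \<in> J" "u > 0" using assms by (cases p) (auto simp: strip_def)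
  note pos = f_pos[OF p(2)]
  have r: "height p b / height p a = q s" using p pos by (simp add: height_ratio_def)
  show "height p a > 0" using p pos by simp
  show "height p b / height p a \<in> ratios a b f j1 j2" unfolding r ratios_def using p(2) by blast
  show "storm_of a b f j1 j2 (height p a) (height p b / height p a) = p"
    unfolding r using p pos by (simp add: storm_of_def Let_def)
qed

lemma weight_pos: "p \<in> strip f j1 j2 \<Longrightarrow> weight a b p > 0"
proof -
  assume "p \<in> strip f j1 j2"
  then obtain s u where p: "p = (s, u, f)" "s \<in> J" "u > 0" by (cases p) (auto simp: strip_def)
  have "d s \<noteq> 0" using d_sign p(2) by force
  then show ?thesis using p idx PF_pos by (simp add: weight_def)
qed

text \<open>An image of a measurable set under \<open>heights\<close> need not be measurable in general. For a strip it is,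
  because it is cut out by the equations that say that the located storm has the heights \<open>z\<close>.\<close>

lemma strip_image_eq:
  "strip_image f j1 j2 = {z \<in> space V. (\<forall>i\<in>L. z i > 0) \<and> z b / z a \<in> ratios a b f j1 j2 \<and>
      (\<forall>i\<in>L. height (locate a b f j1 j2 z) i = z i)}"
proof (intro set_eqI iffI)
  fix z assume "z \<in> strip_image f j1 j2"
  then obtain p where p: "p \<in> strip f j1 j2" "p \<in> positive_heights" "z = heights p" by (auto simp: strip_image_def)
  have "locate a b f j1 j2 z = p" using strip_storm_of(3)[OF p(1)] idx by (simp add: locate_def p(3))
  then show "z \<in> {z \<in> space V. (\<forall>i\<in>L. z i > 0) \<and> z b / z a \<in> ratios a b f j1 j2 \<and>
      (\<forall>i\<in>L. height (locate a b f j1 j2 z) i = z i)}"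
    using p strip_storm_of(2)[OF p(1)] idx by (auto simp: positive_heights_def)
next
  fix z assume z: "z \<in> {z \<in> space V. (\<forall>i\<in>L. z i > 0) \<and> z b / z a \<in> ratios a b f j1 j2 \<and>
      (\<forall>i\<in>L. height (locate a b f j1 j2 z) i = z i)}"
  let ?p = "locate a b f j1 j2 z"
  have s: "?p \<in> strip f j1 j2" unfolding locate_def using z idx by (intro storm_of_in_strip) auto
  moreover have "heights ?p = z"
    using z by (auto simp: heights_def vec_space_def space_PiM PiE_def extensional_def fun_eq_iff)
  moreover have "?p \<in> positive_heights" using s z by (auto simp: positive_heights_def strip_def)
  ultimately show "z \<in> strip_image f j1 j2" unfolding strip_image_def by (metis IntI imageI)
qed

lemma ratios_sets [measurable]: "ratios a b f j1 j2 \<in> sets borel"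
  unfolding ratios_def by measurable

lemma strip_image_sets: "strip_image f j1 j2 \<in> sets V"
proof -
  have [measurable]: "Measurable.pred V (\<lambda>z. height (locate a b f j1 j2 z) i = z i)" "Measurable.pred V (\<lambda>z. z i > 0)"
    "Measurable.pred V (\<lambda>z. z b / z a \<in> ratios a b f j1 j2)" if i: "i \<in> L" for i
    using coordinates_measurable[OF idx(1,2) i, of "\<lambda>(x, y, w). x / f (t a - \<sigma> (y / x)) * f (t i - \<sigma> (y / x)) = w" "count_space UNIV"]
      coordinates_measurable[OF idx(1,2) i, of "\<lambda>(x, y, w). w > 0" "count_space UNIV"]
      coordinates_measurable[OF idx(1,2) i, of "\<lambda>(x, y, w). y / x \<in> ratios a b f j1 j2" "count_space UNIV"]
    unfolding locate_def storm_of_def Let_def height_simp by simp_all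
  note this(3)[OF idx(1), measurable]
  show ?thesis unfolding strip_image_eq by measurable
qed

lemma locate_heights: "p \<in> strip f j1 j2 \<Longrightarrow> locate a b f j1 j2 (heights p) = p"
  using strip_storm_of(3)[of p] idx by (simp add: locate_def)

lemma strip_image_locate:
  assumes "z \<in> strip_image f j1 j2"
  shows "locate a b f j1 j2 z \<in> strip f j1 j2" "heights (locate a b f j1 j2 z) = z"
  using assms locate_heights by (auto simp: strip_image_def)

lemma weight_measurable: "(\<lambda>z. weight a b (locate a b f j1 j2 z)) \<in> borel_measurable V"
proof -
  let ?D = "\<lambda>s. indicator J s * \<bar>d s\<bar>"
  have "(\<lambda>z. measure PF {f} / ((z a / f (t a - \<sigma> (z b / z a)))\<^sup>2 *
      (z a / f (t a - \<sigma> (z b / z a)) * ?D (\<sigma> (z b / z a))))) \<in> borel_measurable V"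
    using coordinates_measurable[OF idx(1,2,1), of "\<lambda>(x, y, w). measure PF {f} / ((x / f (t a - \<sigma> (y / x)))\<^sup>2 *
      (x / f (t a - \<sigma> (y / x)) * ?D (\<sigma> (y / x))))" borel] by simp
  also have "(\<lambda>z. measure PF {f} / ((z a / f (t a - \<sigma> (z b / z a)))\<^sup>2 *
      (z a / f (t a - \<sigma> (z b / z a)) * ?D (\<sigma> (z b / z a))))) = (\<lambda>z. weight a b (locate a b f j1 j2 z))"
    by (simp add: weight_def locate_def storm_of_def Let_def del: atLeastAtMost_iff)
  finally show ?thesis .
qed

text \<open>In the chart of the strip the intensity has density \<open>weight\<close> with respect to \<open>v dv dr\<close>: the weight
  has been defined so that \<open>weight * u \<bar>wronskian\<bar> = P\<^sub>F{f} / u\<^sup>2\<close>, and the change of variables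
  absorbs the factor \<open>u \<bar>wronskian\<bar>\<close>.\<close>

lemma strip_integral:
  assumes g [measurable]: "g \<in> borel_measurable V"
  shows "(\<integral>\<^sup>+p. indicator (strip f j1 j2) p * g (heights p) \<partial>\<Lambda>) =
    (\<integral>\<^sup>+v. indicator {0<..} v * (\<integral>\<^sup>+r. indicator (ratios a b f j1 j2) r *
       (g (heights (storm_of a b f j1 j2 v r)) * (ennreal (weight a b (storm_of a b f j1 j2 v r)) * ennreal v)) \<partial>lborel) \<partial>lborel)"
    (is "?L = ?R")
proof -
  note [measurable] = strip_sets[OF idx(3)]
  let ?D = "\<lambda>s. indicator J s * \<bar>d s\<bar>"
  let ?m = "measure PF {f}"
  let ?in = "\<lambda>f' s u. indicator {0<..} u * (indicator (strip f j1 j2) (s, u, f') * g (heights (s, u, f')) * ennreal (1 / u\<^sup>2))"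
  let ?g = "\<lambda>s u. indicator {0<..} u * (g (heights (s, u, f)) * ennreal (1 / u\<^sup>2))"
  let ?h = "\<lambda>h s u. indicator {0<..} u * (h (s, u) * ennreal (u * \<bar>d s\<bar>))"
  have hm [measurable]: "(\<lambda>x. heights (fst x, snd x, f)) \<in> measurable (borel \<Otimes>\<^sub>M borel) V"
    unfolding heights_def vec_space_def height_simp by measurable
  define h where "h = (\<lambda>x. g (heights (fst x, snd x, f)) * ennreal (?m / ((snd x)\<^sup>2 * (snd x * ?D (fst x)))))"
  have [measurable]: "h \<in> borel_measurable (borel \<Otimes>\<^sub>M borel)" unfolding h_def by measurable
  \<comment> \<open>The strip contains a single profile, so the integral over the marks contributes one mass.\<close>
  define c where "c = (\<integral>\<^sup>+s. (\<integral>\<^sup>+u. ?in f s u \<partial>lborel) \<partial>lborel)"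
  have "?L = (\<integral>\<^sup>+f'. (\<integral>\<^sup>+s. (\<integral>\<^sup>+u. ?in f' s u \<partial>lborel) \<partial>lborel) \<partial>PF)"
    by (subst nn_integral_intensity) auto
  also have "\<dots> = (\<integral>\<^sup>+f'. c * indicator {f} f' \<partial>PF)"
  proof (rule nn_integral_cong)
    fix f'
    show "(\<integral>\<^sup>+s. (\<integral>\<^sup>+u. ?in f' s u \<partial>lborel) \<partial>lborel)
      = c * indicator {f} f'"
    proof (cases "f' = f")
      case False
      then have "indicator (strip f j1 j2) (s, u, f') = (0 :: ennreal)" for s u by (auto simp: strip_def)
      then show ?thesis using False by simp
    qed (simp add: c_def)
  qed
  also have "\<dots> = ennreal ?m * c"
  proof -
    have "emeasure PF {f} = ennreal ?m"
      using PF_prob finite_measure.emeasure_eq_measure prob_space.finite_measure by blast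
    then show ?thesis using idx sets_PF by (subst nn_integral_cmult_indicator) (auto simp: mult.commute)
  qed
  also have "\<dots> = (\<integral>\<^sup>+s. indicator J s * (\<integral>\<^sup>+u. ?h h s u \<partial>lborel) \<partial>lborel)"
  proof -
    have "ennreal ?m * c = ennreal ?m * (\<integral>\<^sup>+s. indicator J s * (\<integral>\<^sup>+u. ?g s u \<partial>lborel) \<partial>lborel)"
      unfolding c_def
    proof (rule arg_cong2[where f = "(*)", OF refl], rule nn_integral_cong)
      fix s :: real
      have "?in f s u
          = indicator J s * (?g s u)" for u
        by (auto simp: strip_def idx split: split_indicator)
      note eq = this
      show "(\<integral>\<^sup>+u. ?in f s u \<partial>lborel)
          = indicator J s * (\<integral>\<^sup>+u. ?g s u \<partial>lborel)"
        unfolding eq by (cases "s \<in> J") (simp_all del: atLeastAtMost_iff)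
    qed
    also have "\<dots> = (\<integral>\<^sup>+s. ennreal ?m * (indicator J s * (\<integral>\<^sup>+u. ?g s u \<partial>lborel)) \<partial>lborel)"
    proof (rule nn_integral_cmult[symmetric])
      have "(\<lambda>s. \<integral>\<^sup>+u. ?g s u \<partial>lborel) \<in> borel_measurable lborel"
        using lborel.borel_measurable_nn_integral_fst[of "\<lambda>x. indicator {0<..} (snd x) * (g (heights (fst x, snd x, f)) * ennreal (1 / (snd x)\<^sup>2))" lborel]
        by simp
      then show "(\<lambda>s. indicator J s * (\<integral>\<^sup>+u. ?g s u \<partial>lborel)) \<in> borel_measurable lborel"
        by measurable
    qed
    also have "\<dots> = (\<integral>\<^sup>+s. indicator J s * (\<integral>\<^sup>+u. ?h h s u \<partial>lborel) \<partial>lborel)"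
    proof (rule nn_integral_cong)
      fix s :: real
      show "ennreal ?m * (indicator J s * (\<integral>\<^sup>+u. ?g s u \<partial>lborel))
        = indicator J s * (\<integral>\<^sup>+u. ?h h s u \<partial>lborel)"
      proof (cases "s \<in> J")
        case True
        then have ds: "\<bar>d s\<bar> > 0" using d_sign by force
        have "ennreal ?m * (\<integral>\<^sup>+u. ?g s u \<partial>lborel)
            = (\<integral>\<^sup>+u. ennreal ?m * (?g s u) \<partial>lborel)"
          using measurable_compose[OF measurable_Pair1'[of s borel borel] hm] by (intro nn_integral_cmult[symmetric]) simp
        also have "\<dots> = (\<integral>\<^sup>+u. ?h h s u \<partial>lborel)"
        proof (rule nn_integral_cong)
          fix u :: real
          show "ennreal ?m * (?g s u)
            = ?h h s u"
          proof (cases "u > 0")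
            case u: True
            have "ennreal (?m / (u\<^sup>2 * (u * \<bar>d s\<bar>))) * ennreal (u * \<bar>d s\<bar>) = ennreal ?m * ennreal (1 / u\<^sup>2)"
              using u ds by (simp add: ennreal_mult[symmetric])
            then have "g (heights (s, u, f)) * ennreal (?m / (u\<^sup>2 * (u * \<bar>d s\<bar>))) * ennreal (u * \<bar>d s\<bar>)
                = ennreal ?m * (g (heights (s, u, f)) * ennreal (1 / u\<^sup>2))"
              by (simp only: mult.assoc mult.left_commute[of "g (heights (s, u, f))" "ennreal ?m"])
            then show ?thesis using u True by (simp add: h_def)
          qed simp
        qed
        finally show ?thesis using True by simp
      qed simp
    qed
    finally show ?thesis .
  qed
  also have "\<dots> = (\<integral>\<^sup>+v. indicator {0<..} v *
            (\<integral>\<^sup>+r. indicator (q ` J) r * (h (\<sigma> r, v / f (t a - \<sigma> r)) * ennreal v) \<partial>lborel) \<partial>lborel)"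
    by (rule area_formula) measurable
  also have "\<dots> = ?R"
    by (simp add: h_def ratios_def storm_of_def Let_def weight_def mult.assoc del: atLeastAtMost_iff)
  finally show ?thesis .
qed

end

text \<open>The image of the leader density on \<open>U\<close>. On vectors with positive coordinates it is the law of the
  vector of maxima on the event that there is a single leader and it lies in \<open>U\<close>.\<close>

definition law_on :: "storm set \<Rightarrow> (nat \<Rightarrow> real) measure" where
  "law_on U = distr (density \<Lambda> (\<lambda>p. indicator U p * ennreal (exp (- excess (heights p))))) V heights"

lemma sets_law_on [simp]: "sets (law_on U) = sets V" by (simp add: law_on_def)

lemma measurable_law_on [simp]: "measurable (law_on U) N = measurable V N"
  by (simp cong: measurable_cong_sets)

lemma nn_integral_law_on:
  assumes [measurable]: "U \<in> sets \<Lambda>" "g \<in> borel_measurable V"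
  shows "(\<integral>\<^sup>+z. g z \<partial>law_on U) = (\<integral>\<^sup>+p. indicator U p * (ennreal (exp (- excess (heights p))) * g (heights p)) \<partial>\<Lambda>)"
  unfolding law_on_def
proof -
  have "(\<integral>\<^sup>+z. g z \<partial>distr (density \<Lambda> (\<lambda>p. indicator U p * ennreal (exp (- excess (heights p))))) V heights)
      = (\<integral>\<^sup>+p. g (heights p) \<partial>density \<Lambda> (\<lambda>p. indicator U p * ennreal (exp (- excess (heights p)))))"
    by (rule nn_integral_distr) measurable
  also have "\<dots> = (\<integral>\<^sup>+p. indicator U p * ennreal (exp (- excess (heights p))) * g (heights p) \<partial>\<Lambda>)"
    by (rule nn_integral_density) measurable
  finally show "(\<integral>\<^sup>+z. g z \<partial>distr (density \<Lambda> (\<lambda>p. indicator U p * ennreal (exp (- excess (heights p))))) V heights)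
      = (\<integral>\<^sup>+p. indicator U p * (ennreal (exp (- excess (heights p))) * g (heights p)) \<partial>\<Lambda>)"
    by (simp only: mult.assoc)
qed

text \<open>The coordinates \<open>v = z\<^sub>a\<close> and \<open>r = z\<^sub>b / z\<^sub>a\<close> are read off the vector alone. A vector attained in
  two strips therefore has the same coordinates in both charts.\<close>

lemma rays_meet:
  assumes B: "is_branch a b f j1 j2" and B': "is_branch a b f' i1 i2"
    and v: "v > 0" and r: "r \<in> ratios a b f j1 j2"
    and z: "heights (storm_of a b f j1 j2 v r) \<in> strip_image f' i1 i2"
  shows "r \<in> ratios a b f' i1 i2" "heights (storm_of a b f' i1 i2 v r) = heights (storm_of a b f j1 j2 v r)"
proof -
  obtain p where p: "p \<in> strip f' i1 i2" "heights p = heights (storm_of a b f j1 j2 v r)"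
    using z by (auto simp: strip_image_def)
  have h: "height p a = v" "height p b = v * r"
    using storm_of_in_strip[OF B v r] idx[OF B] p(2) heights_apply by metis+
  show "r \<in> ratios a b f' i1 i2" "heights (storm_of a b f' i1 i2 v r) = heights (storm_of a b f j1 j2 v r)"
    using strip_storm_of(2,3)[OF B' p(1)] v p(2) by (simp_all add: h)
qed

text \<open>The crucial comparison. In the chart of either strip, the law on the strip has density
  \<open>exp (- excess z)\<close> times the weight of the located storm with respect to the common measure \<open>v dv dr\<close>. On
  vectors attained in both strips the two densities thus are in the ratio of the weights; cross multiplication
  avoids division.\<close>

lemma weight_exchange:
  assumes B: "is_branch a b f j1 j2" and B': "is_branch a b f' i1 i2" and g [measurable]: "g \<in> borel_measurable V"
  shows "(\<integral>\<^sup>+z. indicator (strip_image f j1 j2 \<inter> strip_image f' i1 i2) z * (g z * ennreal (weight a b (locate a b f' i1 i2 z))) \<partial>law_on (strip f j1 j2))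
       = (\<integral>\<^sup>+z. indicator (strip_image f j1 j2 \<inter> strip_image f' i1 i2) z * (g z * ennreal (weight a b (locate a b f j1 j2 z))) \<partial>law_on (strip f' i1 i2))"
proof -
  let ?A = "strip_image f j1 j2 \<inter> strip_image f' i1 i2"
  let ?w = "\<lambda>z. ennreal (weight a b (locate a b f j1 j2 z))"
  let ?w' = "\<lambda>z. ennreal (weight a b (locate a b f' i1 i2 z))"
  let ?e = "\<lambda>z. ennreal (exp (- excess z))"
  note [measurable] = strip_image_sets[OF B] strip_image_sets[OF B'] weight_measurable[OF B] weight_measurable[OF B']
    strip_sets[OF idx(3)[OF B]] strip_sets[OF idx(3)[OF B']]
  \<comment> \<open>The full integrand, symmetric in the two strips; each side is its integral over the rays of
    one strip.\<close>
  define K where "K z = indicator ?A z * (g z * ?e z * ?w z * ?w' z)" for z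
  let ?ray = "\<lambda>f j1 j2 v r. indicator (ratios a b f j1 j2) r * (K (heights (storm_of a b f j1 j2 v r)) * ennreal v)"
  have one_side: "(\<integral>\<^sup>+z. indicator ?A z * (g z * W z) \<partial>law_on (strip f1 h1 h2))
      = (\<integral>\<^sup>+v. indicator {0<..} v * (\<integral>\<^sup>+r. ?ray f1 h1 h2 v r \<partial>lborel) \<partial>lborel)"
    if B1: "is_branch a b f1 h1 h2" and W [measurable]: "W \<in> borel_measurable V"
      and K: "\<And>z. K z = indicator ?A z * (g z * ?e z * ennreal (weight a b (locate a b f1 h1 h2 z)) * W z)"
    for f1 h1 h2 and W :: "_ \<Rightarrow> ennreal"
  proof -
    note [measurable] = weight_measurable[OF B1] strip_sets[OF idx(3)[OF B1]]
    let ?c = "storm_of a b f1 h1 h2" and ?h = "\<lambda>z. ?e z * (indicator ?A z * (g z * W z))"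
    let ?in = "\<lambda>v r. indicator (ratios a b f1 h1 h2) r * (?h (heights (?c v r)) * (ennreal (weight a b (?c v r)) * ennreal v))"
    have pointwise: "?in v r = ?ray f1 h1 h2 v r" if v: "v > 0" for v r
    proof (cases "r \<in> ratios a b f1 h1 h2")
      case True
      have "locate a b f1 h1 h2 (heights (?c v r)) = ?c v r"
        using storm_of_in_strip(1)[OF B1 v True] by (rule locate_heights[OF B1])
      then show ?thesis using True by (simp add: K mult_ac)
    qed simp
    have "(\<integral>\<^sup>+z. indicator ?A z * (g z * W z) \<partial>law_on (strip f1 h1 h2))
       = (\<integral>\<^sup>+p. indicator (strip f1 h1 h2) p * ?h (heights p) \<partial>\<Lambda>)"
      by (subst nn_integral_law_on) auto
    also have "\<dots> = (\<integral>\<^sup>+v. indicator {0<..} v * (\<integral>\<^sup>+r. ?in v r \<partial>lborel) \<partial>lborel)"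
      by (rule strip_integral[OF B1]) measurable
    also have "\<dots> = (\<integral>\<^sup>+v. indicator {0<..} v * (\<integral>\<^sup>+r. ?ray f1 h1 h2 v r \<partial>lborel) \<partial>lborel)"
    proof (rule nn_integral_cong)
      fix v :: real
      show "indicator {0<..} v * (\<integral>\<^sup>+r. ?in v r \<partial>lborel) = indicator {0<..} v * (\<integral>\<^sup>+r. ?ray f1 h1 h2 v r \<partial>lborel)"
      proof (cases "v > 0")
        case True
        show ?thesis by (simp only: pointwise[OF True])
      qed simp
    qed
    finally show ?thesis .
  qed
  \<comment> \<open>The integrand vanishes unless the vector is attained in both strips, and then the rays agree.\<close>
  have same_ray: "?ray f j1 j2 v r = ?ray f' i1 i2 v r" if v: "v > 0" for v r
  proof (cases "r \<in> ratios a b f j1 j2 \<and> heights (storm_of a b f j1 j2 v r) \<in> ?A")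
    case True
    then show ?thesis using rays_meet[OF B B' v, of r] by simp
  next
    case 1: False
    show ?thesis
    proof (cases "r \<in> ratios a b f' i1 i2 \<and> heights (storm_of a b f' i1 i2 v r) \<in> ?A")
      case True
      then show ?thesis using rays_meet[OF B' B v, of r] by simp
    next
      case 2: False
      have "?ray f j1 j2 v r = 0" "?ray f' i1 i2 v r = 0" using 1 2 by (auto simp: K_def indicator_def)
      then show ?thesis by (simp only:)
    qed
  qed
  have "(\<integral>\<^sup>+v. indicator {0<..} v * (\<integral>\<^sup>+r. ?ray f j1 j2 v r \<partial>lborel) \<partial>lborel)
      = (\<integral>\<^sup>+v. indicator {0<..} v * (\<integral>\<^sup>+r. ?ray f' i1 i2 v r \<partial>lborel) \<partial>lborel)"
  proof (rule nn_integral_cong)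
    fix v :: real
    show "indicator {0<..} v * (\<integral>\<^sup>+r. ?ray f j1 j2 v r \<partial>lborel) = indicator {0<..} v * (\<integral>\<^sup>+r. ?ray f' i1 i2 v r \<partial>lborel)"
    proof (cases "v > 0")
      case True
      show ?thesis by (simp only: same_ray[OF True])
    qed simp
  qed
  then show ?thesis
    using one_side[OF B, of ?w'] one_side[OF B', of ?w] by (simp add: K_def mult_ac)
qed

lemma storm_of_measurable:
  assumes B: "is_branch a b f j1 j2"
  shows "(\<lambda>x. heights (storm_of a b f j1 j2 (fst x) (snd x))) \<in> measurable (borel \<Otimes>\<^sub>M borel) V"
proof -
  interpret branch f "t a" "t b" j1 j2 using B by (rule branch_profile)
  show ?thesis
    unfolding heights_def vec_space_def storm_of_def Let_def height_simp by measurable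
qed

text \<open>The density in the chart is strictly positive, so null sets of the law are null sets of \<open>v dv dr\<close>.\<close>

lemma null_rays:
  assumes B: "is_branch a b f j1 j2" and D [measurable]: "D \<in> sets V"
    and null: "emeasure (law_on (strip f j1 j2)) D = 0"
  shows "AE v in lborel. AE r in lborel. v > 0 \<longrightarrow> r \<in> ratios a b f j1 j2 \<longrightarrow> heights (storm_of a b f j1 j2 v r) \<notin> D"
proof -
  interpret branch f "t a" "t b" j1 j2 using B by (rule branch_profile)
  note [measurable] = strip_sets[OF idx(3)[OF B]] ratios_sets[OF B]
  let ?e = "\<lambda>z. ennreal (exp (- excess z))"
  let ?c = "storm_of a b f j1 j2"
  let ?in = "\<lambda>v r. indicator (ratios a b f j1 j2) r * ((?e (heights (?c v r)) * indicator D (heights (?c v r))) * (ennreal (weight a b (?c v r)) * ennreal v))"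
  note cm [measurable] = storm_of_measurable[OF B]
  have cm1 [measurable]: "(\<lambda>r. heights (?c v r)) \<in> measurable borel V" for v
    using measurable_compose[OF measurable_Pair1'[of v borel borel] cm] by simp
  let ?D = "\<lambda>s. indicator J s * \<bar>d s\<bar>"
  have "(\<lambda>x. ennreal (measure PF {f} / ((fst x / f (t a - \<sigma> (snd x)))\<^sup>2 *
      (fst x / f (t a - \<sigma> (snd x)) * ?D (\<sigma> (snd x)))))) \<in> borel_measurable (borel \<Otimes>\<^sub>M borel)"
    by measurable
  also have "(\<lambda>x. ennreal (measure PF {f} / ((fst x / f (t a - \<sigma> (snd x)))\<^sup>2 *
      (fst x / f (t a - \<sigma> (snd x)) * ?D (\<sigma> (snd x)))))) = (\<lambda>x. ennreal (weight a b (?c (fst x) (snd x))))"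
    by (simp add: weight_def storm_of_def Let_def del: atLeastAtMost_iff)
  finally have wm [measurable]: "(\<lambda>x. ennreal (weight a b (?c (fst x) (snd x)))) \<in> borel_measurable (borel \<Otimes>\<^sub>M borel)" .
  have wm1 [measurable]: "(\<lambda>r. ennreal (weight a b (?c v r))) \<in> borel_measurable borel" for v
    using measurable_compose[OF measurable_Pair1'[of v borel borel] wm] by simp
  have "0 = (\<integral>\<^sup>+z. indicator D z \<partial>law_on (strip f j1 j2))" using null by simp
  also have "\<dots> = (\<integral>\<^sup>+p. indicator (strip f j1 j2) p * (\<lambda>z. ?e z * indicator D z) (heights p) \<partial>\<Lambda>)"
    by (subst nn_integral_law_on) auto
  also have "\<dots> = (\<integral>\<^sup>+v. indicator {0<..} v * (\<integral>\<^sup>+r. ?in v r \<partial>lborel) \<partial>lborel)"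
    by (rule strip_integral[OF B]) measurable
  finally have "(\<integral>\<^sup>+v. indicator {0<..} v * (\<integral>\<^sup>+r. ?in v r \<partial>lborel) \<partial>lborel) = 0" ..
  moreover have "(\<lambda>v. indicator {0<..} v * (\<integral>\<^sup>+r. ?in v r \<partial>lborel)) \<in> borel_measurable lborel"
  proof -
    have "(\<lambda>x. ?in (fst x) (snd x)) \<in> borel_measurable (lborel \<Otimes>\<^sub>M lborel)" by measurable
    from lborel.borel_measurable_nn_integral_fst[OF this] show ?thesis by simp
  qed
  ultimately have "AE v in lborel. indicator {0<..} v * (\<integral>\<^sup>+r. ?in v r \<partial>lborel) = 0"
    by (subst (asm) nn_integral_0_iff_AE) auto
  then show ?thesis
  proof eventually_elim
    case (elim v)
    show ?case
    proof (cases "v > 0")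
      case True
      then have "(\<integral>\<^sup>+r. ?in v r \<partial>lborel) = 0" using elim by simp
      then have "AE r in lborel. ?in v r = 0" by (subst (asm) nn_integral_0_iff_AE) auto
      then show ?thesis
      proof eventually_elim
        case (elim r)
        show ?case
        proof (intro impI notI)
          assume *: "r \<in> ratios a b f j1 j2" "heights (?c v r) \<in> D"
          have "weight a b (?c v r) > 0" using storm_of_in_strip(1)[OF B True *(1)] by (rule weight_pos[OF B])
          then show False using elim * True by simp
        qed
      qed
    qed simp
  qed
qed

end


section \<open>Null sets of the laws on strips\<close>

text \<open>Compact sets are wanted because their continuous images are again Borel.\<close>

lemma inner_regular_sigma_compact:
  fixes M :: "'c :: {second_countable_topology, complete_space} measure"
  assumes M: "sets M = sets borel" and fin: "emeasure M (space M) \<noteq> \<infinity>" and B: "B \<in> sets borel"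
  shows "\<exists>K :: nat \<Rightarrow> 'c set. (\<forall>n. compact (K n) \<and> K n \<subseteq> B) \<and> emeasure M (B - (\<Union>n. K n)) = 0"
proof -
  have sp: "space M = UNIV" using M by (metis sets_eq_imp_space_eq space_borel)
  have finB: "emeasure M A \<noteq> \<infinity>" for A
    using fin emeasure_space[of M A] by (auto simp: top_unique)
  have "\<exists>K. compact K \<and> K \<subseteq> B \<and> emeasure M B < emeasure M K + ennreal (1 / Suc n)" for n
  proof -
    have "\<exists>K\<in>{K. K \<subseteq> B \<and> compact K}. emeasure M B < emeasure M K + ennreal (1 / Suc n)"
    proof (rule SUP_approx_ennreal[OF _ _ inner_regular[OF M fin B]])
      show "{K. K \<subseteq> B \<and> compact K} \<noteq> {}" using compact_empty by blast
    qed (use finB in auto)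
    then show ?thesis by blast
  qed
  then obtain K where K: "\<And>n. compact (K n)" "\<And>n. K n \<subseteq> B" "\<And>n::nat. emeasure M B < emeasure M (K n) + ennreal (1 / Suc n)"
    by metis
  have [measurable]: "K n \<in> sets M" "B \<in> sets M" for n
    using K(1) B M by (auto intro: borel_compact)
  have small: "emeasure M (B - (\<Union>n. K n)) \<le> ennreal e" if e: "e > 0" for e
  proof -
    obtain n where n: "1 / Suc n < e" using e reals_Archimedean[of e] by (auto simp: inverse_eq_divide)
    have "emeasure M (B - (\<Union>n. K n)) \<le> emeasure M (B - K n)"
      by (intro emeasure_mono) auto
    also have "\<dots> = emeasure M B - emeasure M (K n)"
      using K(2) finB by (intro emeasure_Diff) auto
    also have "\<dots> \<le> ennreal (1 / Suc n)"
      using K(3)[of n] by (intro ennreal_minus_le_iff[THEN iffD2]) (auto simp: finB)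
    also have "\<dots> \<le> ennreal e" using n by (intro ennreal_leI) simp
    finally show ?thesis .
  qed
  have "emeasure M (B - (\<Union>n. K n)) \<le> 0"
    by (rule ennreal_le_epsilon) (simp only: add_0 small)
  then show ?thesis using K(1,2) by (intro exI[where x = K] conjI allI) simp_all
qed

context storm_model begin

text \<open>Rational end points keep the strips countable in number, so that almost sure statements can be
  collected over all of them.\<close>

definition branches :: "nat \<Rightarrow> nat \<Rightarrow> ((real \<Rightarrow> real) \<times> real \<times> real) set" where
  "branches a b = {(f, j1, j2). j1 \<in> \<rat> \<and> j2 \<in> \<rat> \<and> is_branch a b f j1 j2}"

lemma countable_branches: "countable (branches a b)"
proof -
  have "branches a b \<subseteq> G \<times> \<rat> \<times> \<rat>" by (auto simp: branches_def is_branch_def)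
  moreover have "countable (G \<times> \<rat> \<times> (\<rat> :: real set))"
    using G_fin by (intro countable_SIGMA countable_rat countable_finite)
  ultimately show ?thesis by (rule countable_subset)
qed

abbreviation on_branch :: "((real \<Rightarrow> real) \<Rightarrow> real \<Rightarrow> real \<Rightarrow> 'c) \<Rightarrow> (real \<Rightarrow> real) \<times> real \<times> real \<Rightarrow> 'c" where
  "on_branch h x \<equiv> h (fst x) (fst (snd x)) (snd (snd x))"

text \<open>The storms that have a chart by the heights with indices \<open>a\<close> and \<open>b\<close>. All others are called
  irregular.\<close>

definition regular_at :: "nat \<Rightarrow> nat \<Rightarrow> storm set" where
  "regular_at a b = (\<Union>x\<in>branches a b. on_branch strip x)"

lemma regular_at_sets [measurable]: "regular_at a b \<in> sets \<Lambda>"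
  unfolding regular_at_def
  by (rule sets.countable_UN''[OF countable_branches])
     (auto simp: branches_def is_branch_def intro!: strip_sets)

lemma C1_regular_at:
  assumes "a \<in> L" "b \<in> L" "(s, u, f) \<in> space \<Lambda>" "C1_near f (t a - s)" "C1_near f (t b - s)"
    "f (t a - s) > 0" "wronskian f (t a) (t b) s \<noteq> 0"
  shows "\<exists>e>0. \<forall>j1 j2. s - e < j1 \<longrightarrow> j1 < s \<longrightarrow> s < j2 \<longrightarrow> j2 < s + e \<longrightarrow>
    is_branch a b f j1 j2 \<and> (s, u, f) \<in> strip f j1 j2"
  using branch_interval_exists[OF assms(4-7)] assms(1-3)
  by (auto simp: is_branch_def strip_def)

definition positive_vecs :: "(nat \<Rightarrow> real) set" where
  "positive_vecs = {z \<in> space V. \<forall>i\<in>L. z i > 0}"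

lemma positive_vecs_sets [measurable]: "positive_vecs \<in> sets V"
proof -
  have [measurable]: "Measurable.pred V (\<lambda>z. z i > 0)" if i: "i \<in> L" for i
    using coordinates_measurable[OF i i i, of "\<lambda>(x, y, w). w > 0" "count_space UNIV"] by simp
  show ?thesis unfolding positive_vecs_def by measurable
qed

lemma strip_image_positive: "strip_image f j1 j2 \<subseteq> positive_vecs"
  by (auto simp: strip_image_def positive_vecs_def positive_heights_def)

end

context storm_process begin

text \<open>If there is a single leader, its heights are the maxima; so this is the law of the leader, pushed
  forward by \<open>heights\<close>.\<close>

lemma emeasure_law_on:
  assumes [measurable]: "U \<in> sets \<Lambda>" "A \<in> sets V" and A: "A \<subseteq> positive_vecs"
  shows "emeasure (law_on U) A = emeasure \<Omega> {\<omega> \<in> space \<Omega>. single \<omega> \<and> leader \<omega> \<in> U \<and> Z \<omega> \<in> A}"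
proof -
  let ?H = "U \<inter> (heights -` A \<inter> space \<Lambda>)"
  have H [measurable]: "?H \<in> sets \<Lambda>" by measurable
  have "{\<omega> \<in> space \<Omega>. single \<omega> \<and> leader \<omega> \<in> U \<and> Z \<omega> \<in> A} = {\<omega> \<in> space \<Omega>. single \<omega> \<and> leader \<omega> \<in> ?H}"
    using leader_in(2,3) by auto
  then have "emeasure \<Omega> {\<omega> \<in> space \<Omega>. single \<omega> \<and> leader \<omega> \<in> U \<and> Z \<omega> \<in> A} = emeasure leader_law ?H"
    by (simp only: emeasure_leader_law[OF H])
  also have "\<dots> = emeasure leader_density ?H"
  proof (rule leader_law_eq_density[OF H])
    show "?H \<subseteq> positive_heights"
    proof
      fix p assume "p \<in> ?H"
      then have "p \<in> space \<Lambda>" "heights p \<in> positive_vecs" using A by auto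
      then show "p \<in> positive_heights" by (auto simp: positive_vecs_def positive_heights_def)
    qed
  qed
  also have "\<dots> = (\<integral>\<^sup>+p. ennreal (exp (- excess (heights p))) * indicator ?H p \<partial>\<Lambda>)"
    by (rule emeasure_leader_density[OF H])
  also have "\<dots> = (\<integral>\<^sup>+p. indicator U p * (ennreal (exp (- excess (heights p))) * indicator A (heights p)) \<partial>\<Lambda>)"
    by (intro nn_integral_cong) (auto split: split_indicator)
  also have "\<dots> = (\<integral>\<^sup>+z. indicator A z \<partial>law_on U)" by (rule nn_integral_law_on[symmetric]) measurable
  also have "\<dots> = emeasure (law_on U) A" by simp
  finally show ?thesis ..
qed

text \<open>Suppose that the maxima \<open>Z\<close> lie in \<open>D\<close> without a single leader, and let \<open>p\<close> be a storm that attains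
  the maximum at \<open>t a\<close>. It is the lone point of some cell \<open>A\<close>, and the suprema off \<open>A\<close> are independent of \<open>p\<close> and
  without singular part. There are two cases.

  If \<open>p\<close> does not attain the maximum at \<open>t b\<close>, this maximum is the supremum off \<open>A\<close>. Then \<open>(Z a, Z b)\<close> has a
  density, whereas \<open>D\<close> is null in the chart of the strip.

  If \<open>p\<close> attains the maximum at \<open>t b\<close> as well, then \<open>p\<close> determines \<open>Z a\<close> and \<open>Z b\<close>, hence the storm located in the
  strip, hence all of \<open>Z\<close>, although that storm is not necessarily a point of the configuration. But another storm
  attains the maximum at some \<open>t e\<close>, so the supremum off \<open>A\<close> at \<open>t e\<close> would hit a value that is determined
  by \<open>p\<close>.\<close>

lemma AE_single_of_null_image:
  assumes B: "is_branch a b f j1 j2" and D [measurable]: "D \<in> sets V" and sub: "D \<subseteq> strip_image f j1 j2"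
    and null: "emeasure (law_on (strip f j1 j2)) D = 0"
  shows "AE \<omega> in \<Omega>. Z \<omega> \<in> D \<longrightarrow> single \<omega>"
proof -
  note idx = idx[OF B]
  let ?c = "storm_of a b f j1 j2"
  note cm [measurable] = storm_of_measurable[OF B]
  note [measurable] = ratios_sets[OF B]
  define N where "N v r \<longleftrightarrow> v > 0 \<and> r \<in> ratios a b f j1 j2 \<and> heights (?c v r) \<in> D" for v r
  have Nm [measurable]: "Measurable.pred (borel \<Otimes>\<^sub>M borel) (\<lambda>x. N (fst x) (snd x))"
    unfolding N_def by measurable
  have "AE v in lborel. AE r in lborel. \<not> N v r"
    using null_rays[OF B D null] by (auto simp: N_def)
  \<comment> \<open>A null set that contains the values \<open>v\<close> for which the section of \<open>D\<close> in the chart fails to be null.\<close>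
  then obtain N0 where N0: "{v \<in> space lborel. \<not> (AE r in lborel. \<not> N v r)} \<subseteq> N0" "emeasure lborel N0 = 0" "N0 \<in> sets lborel"
    by (rule AE_E)
  have [measurable]: "N0 \<in> sets borel" using N0(3) by simp
  have "AE v in lborel. v \<notin> N0" using N0 by (intro AE_not_in) (auto simp: null_sets_def)
  then have N0_AE: "AE p in \<Lambda>. height p a > 0 \<longrightarrow> height p a \<notin> N0" by (intro AE_height) measurable
  \<comment> \<open>Pairs of a value at \<open>t b\<close> and a storm \<open>p\<close> that together with \<open>height p a\<close> yield a vector in \<open>D\<close>.\<close>
  define T1 where "T1 = {x \<in> space (borel \<Otimes>\<^sub>M \<Lambda>). height (snd x) a > 0 \<and> N (height (snd x) a) (fst x / height (snd x) a)}"
  have T1m [measurable]: "T1 \<in> sets (borel \<Otimes>\<^sub>M \<Lambda>)"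
  proof -
    have "(\<lambda>x. (height (snd x) a, fst x / height (snd x) a)) \<in> measurable (borel \<Otimes>\<^sub>M \<Lambda>) (borel \<Otimes>\<^sub>M borel)" by measurable
    from measurable_compose[OF this Nm]
    have [measurable]: "Measurable.pred (borel \<Otimes>\<^sub>M \<Lambda>) (\<lambda>x. N (height (snd x) a) (fst x / height (snd x) a))"
      by simp
    show ?thesis unfolding T1_def by measurable
  qed
  have T1_null: "AE p in \<Lambda>. AE x in lborel. x > 0 \<longrightarrow> (x, p) \<notin> T1"
    using N0_AE
  proof eventually_elim
    case (elim p)
    show ?case
    proof (cases "height p a > 0")
      case True
      then have "AE r in lborel. \<not> N (height p a) r" using elim N0(1) by auto
      moreover have "Measurable.pred borel (\<lambda>r. \<not> N (height p a) r)"
        using measurable_compose[OF measurable_Pair1'[of "height p a" borel borel] Nm] by simp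
      ultimately have "AE x in lborel. \<not> N (height p a) (0 + 1 / height p a * x)"
        using True by (intro AE_borel_affine) auto
      then show ?thesis by (auto simp: T1_def)
    qed (simp add: T1_def)
  qed
  \<comment> \<open>Pairs of a storm \<open>p\<close> and the height at \<open>t e\<close> of the strip's storm with the same heights at \<open>t a\<close> and \<open>t b\<close>.\<close>
  define T2 where "T2 e = {x \<in> space (borel \<Otimes>\<^sub>M \<Lambda>). fst x = heights (?c (height (snd x) a) (height (snd x) b / height (snd x) a)) e}" for e
  have T2m [measurable]: "T2 e \<in> sets (borel \<Otimes>\<^sub>M \<Lambda>)" if e: "e \<in> L" for e
  proof -
    have "(\<lambda>x. (height (snd x) a, height (snd x) b / height (snd x) a)) \<in> measurable (borel \<Otimes>\<^sub>M \<Lambda>) (borel \<Otimes>\<^sub>M borel)" by measurable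
    from measurable_compose[OF measurable_compose[OF this cm] coordinate_measurable[OF e]]
    have [measurable]: "(\<lambda>x. heights (?c (height (snd x) a) (height (snd x) b / height (snd x) a)) e) \<in> borel_measurable (borel \<Otimes>\<^sub>M \<Lambda>)"
      by simp
    show ?thesis unfolding T2_def by measurable
  qed
  have T2_null: "AE p in \<Lambda>. AE x in lborel. x > 0 \<longrightarrow> (x, p) \<notin> T2 e" for e
  proof (rule AE_I2)
    fix p
    have "AE x in lborel. x \<noteq> heights (?c (height p a) (height p b / height p a)) e" by (rule AE_lborel_singleton)
    then show "AE x in lborel. x > 0 \<longrightarrow> (x, p) \<notin> T2 e" by eventually_elim (simp add: T2_def)
  qed
  have A1: "AE \<omega> in \<Omega>. \<forall>A\<in>cells. cnt A \<omega> = 1 \<longrightarrow> sup_off A b \<omega> > 0 \<longrightarrow> (sup_off A b \<omega>, lone A \<omega>) \<notin> T1"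
    by (intro AE_ball_countable[OF countable_cells, THEN iffD2] ballI
        lone_pair_null[OF cells_sets cells_finite _ T1m T1_null] idx)
  have A2: "AE \<omega> in \<Omega>. \<forall>e\<in>L. \<forall>A\<in>cells. cnt A \<omega> = 1 \<longrightarrow> sup_off A e \<omega> > 0 \<longrightarrow> (sup_off A e \<omega>, lone A \<omega>) \<notin> T2 e"
    by (intro AE_finite_allI AE_ball_countable[OF countable_cells, THEN iffD2] ballI
        lone_pair_null[OF cells_sets cells_finite _ T2m T2_null]) auto
  from A1 A2 AE_regular_config AE_space show ?thesis
  proof eventually_elim
    case (elim \<omega>)
    show ?case
    proof (intro impI, rule ccontr)
      assume ZD: "Z \<omega> \<in> D" and ns: "\<not> single \<omega>"
      note reg = elim(3) and sp = elim(4)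
      have Zs: "Z \<omega> \<in> strip_image f j1 j2" using ZD sub by blast
      then have pos: "\<And>i. i \<in> L \<Longrightarrow> Z \<omega> i > 0" and rat: "Z \<omega> b / Z \<omega> a \<in> ratios a b f j1 j2"
        using strip_image_eq[OF B] by auto
      have loc: "heights (?c (Z \<omega> a) (Z \<omega> b / Z \<omega> a)) = Z \<omega>"
        using strip_image_locate(2)[OF B Zs] by (simp add: locate_def)
      have sub: "\<Phi> \<omega> \<subseteq> space \<Lambda>" using \<Phi>_space[OF sp] .
      obtain p where p: "p \<in> \<Phi> \<omega>" "height p a = Z \<omega> a"
        using regular_config_attained[OF reg idx(1) pos[OF idx(1)]] by blast
      obtain A where A: "A \<in> cells" "\<Phi> \<omega> \<inter> A = {p}" using cell_isolates[OF sp p(1)] by blast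
      have cA: "cnt A \<omega> = 1" and lA: "lone A \<omega> = p" by (simp_all add: A num_points_eq_1_iff lone_def)
      have so: "sup_off A e \<omega> = Z \<omega> e" if "e \<in> L" "q \<in> \<Phi> \<omega>" "q \<noteq> p" "height q e = Z \<omega> e" for e q
      proof -
        have q: "q \<in> \<Phi> \<omega> - A" using that A by blast
        show ?thesis using sup_off_eq[OF q, of e] regular_config_le[OF reg that(1)] pos[OF that(1)]
          by (simp add: that(4))
      qed
      \<comment> \<open>Some maximum is attained off \<open>p\<close>: either \<open>p\<close> misses it, or a second storm shares all maxima with \<open>p\<close>.\<close>
      have "\<exists>e\<in>L. \<exists>q\<in>\<Phi> \<omega>. q \<noteq> p \<and> height q e = Z \<omega> e"
      proof (cases "p \<in> hits \<omega>")
        case True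
        have "hits \<omega> \<noteq> {p}" using ns by (auto simp: single_def)
        then obtain q where "q \<in> hits \<omega>" "q \<noteq> p" using True by blast
        then have "q \<in> \<Phi> \<omega>" "height q a = Z \<omega> a" using idx(1) unfolding hits_def I_set_eq by blast+
        then show ?thesis using idx(1) \<open>q \<noteq> p\<close> by blast
      next
        case False
        then have "\<not> (\<forall>i\<in>L. height p i = Z \<omega> i)" using p sub unfolding hits_def I_set_eq by blast
        then obtain e where e: "e \<in> L" "height p e \<noteq> Z \<omega> e" by blast
        obtain q where q: "q \<in> \<Phi> \<omega>" "height q e = Z \<omega> e"
          using regular_config_attained[OF reg e(1) pos[OF e(1)]] by blast
        then have "q \<noteq> p" using e(2) by auto
        then show ?thesis using e(1) q by (intro bexI[of _ e] bexI[of _ q] conjI)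
      qed
      then obtain e q where eq: "e \<in> L" "q \<in> \<Phi> \<omega>" "q \<noteq> p" "height q e = Z \<omega> e" by blast
      have psp: "p \<in> space \<Lambda>" using p sub by blast
      show False
      proof (cases "height p b = Z \<omega> b")
        case True
        have "(Z \<omega> e, p) \<in> T2 e"
          using True p loc psp by (simp add: T2_def space_pair_measure)
        moreover have "(sup_off A e \<omega>, lone A \<omega>) \<notin> T2 e"
          using bspec[OF bspec[OF elim(2) eq(1)] A(1)] cA so[OF eq] pos[OF eq(1)] by simp
        ultimately show False using so[OF eq] lA by simp
      next
        case False
        obtain q' where q': "q' \<in> \<Phi> \<omega>" "height q' b = Z \<omega> b"
          using regular_config_attained[OF reg idx(2) pos[OF idx(2)]] by blast
        then have s: "sup_off A b \<omega> = Z \<omega> b" using False by (intro so[OF idx(2) q'(1)]) auto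
        have "(Z \<omega> b, p) \<in> T1"
          using p loc psp ZD rat pos[OF idx(1)] by (simp add: T1_def N_def space_pair_measure)
        moreover have "(sup_off A b \<omega>, lone A \<omega>) \<notin> T1" 
          using bspec[OF elim(1) A(1)] cA s pos[OF idx(2)] by simp
        ultimately show False using s lA by simp
      qed
    qed
  qed
qed

text \<open>The set of height vectors of storms in \<open>R\<close> is analytic, not obviously measurable.
  The graph of \<open>heights\<close> is a Borel set, so inner regularity of the joint law of leader and
  height vector exhausts it by compact sets, whose projections are closed.\<close>

lemma leader_image_cover:
  assumes R [measurable]: "R \<in> sets \<Lambda>" and D [measurable]: "D \<in> sets V"
    and lead: "AE \<omega> in \<Omega>. Z \<omega> \<in> D \<longrightarrow> single \<omega> \<and> leader \<omega> \<in> R"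
  shows "AE z in distr \<Omega> V Z. z \<in> D \<longrightarrow> (\<exists>p\<in>R. heights p = z)"
proof -
  have "\<exists>C. C \<in> sets V \<and> (\<forall>z\<in>C. \<exists>p\<in>R. heights p = z) \<and>
      (AE \<omega> in \<Omega>. single \<omega> \<and> leader \<omega> \<in> R \<and> Z \<omega> \<in> D \<and> snd (snd (leader \<omega>)) = f \<longrightarrow> Z \<omega> \<in> C)" if f: "f \<in> G" for f
  proof -
    note [measurable] = G_meas[OF f]
    define Rf where "Rf = {p \<in> R. snd (snd p) = f}"
    have "Rf = R \<inter> {p \<in> space \<Lambda>. snd (snd p) = f}" using sets.sets_into_space[OF R] by (auto simp: Rf_def)
    also have "\<dots> \<in> sets \<Lambda>" using f by measurable
    finally have Rf [measurable]: "Rf \<in> sets \<Lambda>" .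
    define E where "E = {\<omega> \<in> space \<Omega>. (single \<omega> \<and> leader \<omega> \<in> Rf) \<and> Z \<omega> \<in> D}"
    have E [measurable]: "E \<in> sets \<Omega>" unfolding E_def by measurable
    let ?R = "restrict_space \<Omega> E"
    define X where "X \<omega> = (fst (leader \<omega>), fst (snd (leader \<omega>)), Z \<omega>)" for \<omega>
    have lead_m: "leader \<in> measurable ?R \<Lambda>"
    proof (rule measurableI)
      fix \<omega> assume "\<omega> \<in> space ?R"
      then show "leader \<omega> \<in> space \<Lambda>" using leader_in(2) by (auto simp: space_restrict_space E_def)
    next
      fix A assume [measurable]: "A \<in> sets \<Lambda>"
      have "leader -` A \<inter> space ?R = {\<omega> \<in> space \<Omega>. (single \<omega> \<and> leader \<omega> \<in> A \<inter> Rf) \<and> Z \<omega> \<in> D}"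
        by (auto simp: space_restrict_space E_def)
      also have "\<dots> \<in> sets \<Omega>" by measurable
      finally show "leader -` A \<inter> space ?R \<in> sets ?R"
        by (subst sets_restrict_space_iff) (auto simp: space_restrict_space)
    qed
    have Z_m: "Z \<in> borel_measurable ?R"
    proof (rule measurable_coordinatewise_then_product)
      fix i show "(\<lambda>\<omega>. Z \<omega> i) \<in> borel_measurable ?R"
      proof (cases "i \<in> L")
        case True
        have "(\<lambda>\<omega>. Z \<omega> i) \<in> borel_measurable \<Omega>"
          by (rule measurable_compose[OF Z_measurable coordinate_measurable[OF True]])
        then show ?thesis by (rule measurable_restrict_space1)
      next
        case False
        then have "(\<lambda>\<omega>. Z \<omega> i) = (\<lambda>\<omega>. undefined)" by (simp only: Z_def max_vec_def restrict_def if_False)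
        then show ?thesis by simp
      qed
    qed
    have X [measurable]: "X \<in> borel_measurable ?R"
      unfolding X_def using measurable_compose[OF lead_m measurable_shift] measurable_compose[OF lead_m measurable_amplitude] Z_m
      by (intro borel_measurable_Pair) auto
    define \<mu> where "\<mu> = distr ?R borel X"
    \<comment> \<open>The graph of \<open>heights\<close> over the part of \<open>R\<close> with profile \<open>f\<close>; the mark is dropped so that
      the graph lies in a Polish space.\<close>
    define \<Gamma> where "\<Gamma> = {x :: real \<times> real \<times> (nat \<Rightarrow> real). (fst x, fst (snd x), f) \<in> Rf \<and>
        (\<forall>i\<in>L. snd (snd x) i = fst (snd x) * f (t i - fst x))}"
    have \<Gamma>: "\<Gamma> \<in> sets borel"
    proof -
      let ?pos = "{x :: real \<times> real \<times> (nat \<Rightarrow> real). fst (snd x) > 0}"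
      have c0 [measurable]: "(\<lambda>x :: real \<times> real \<times> (nat \<Rightarrow> real). fst x) \<in> borel_measurable borel"
        by (intro borel_measurable_continuous_onI continuous_intros)
      have c1 [measurable]: "(\<lambda>x :: real \<times> real \<times> (nat \<Rightarrow> real). fst (snd x)) \<in> borel_measurable borel"
        by (intro borel_measurable_continuous_onI continuous_intros)
      have pos: "?pos \<in> sets borel" using measurable_sets[OF c1, of "{0<..}"] by (simp add: vimage_def)
      have "(\<lambda>x. (fst x, fst (snd x), f)) \<in> measurable (restrict_space borel ?pos) \<Lambda>"
        unfolding storm_intensity_def
      proof (intro measurable_Pair)
        show "(\<lambda>x. fst (snd x)) \<in> measurable (restrict_space borel ?pos) uspace"
          unfolding measurable_density_eq2
          by (intro measurable_restrict_space2 measurable_restrict_space1)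
             (auto simp: space_restrict_space c1)
        show "(\<lambda>x. f) \<in> measurable (restrict_space borel ?pos) PF" using f by (simp add: space_PF)
        show "fst \<in> measurable (restrict_space borel ?pos) lborel"
          by (simp add: measurable_restrict_space1 c0)
      qed
      from measurable_sets[OF this Rf]
      have "(\<lambda>x. (fst x, fst (snd x), f)) -` Rf \<inter> ?pos \<in> sets borel"
        using pos by (subst (asm) sets_restrict_space_iff) (auto simp: space_restrict_space)
      moreover have "{x :: real \<times> real \<times> (nat \<Rightarrow> real). \<forall>i\<in>L. snd (snd x) i = fst (snd x) * f (t i - fst x)} \<in> sets borel"
      proof -
        have "(\<lambda>x :: real \<times> real \<times> (nat \<Rightarrow> real). snd (snd x) i) \<in> borel_measurable borel" for i
          by (intro borel_measurable_continuous_onI continuous_intros continuous_on_product_coordinates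
              continuous_on_compose2[OF continuous_on_product_coordinates]) auto
        note [measurable] = this
        show ?thesis by measurable
      qed
      ultimately have "((\<lambda>x. (fst x, fst (snd x), f)) -` Rf \<inter> ?pos) \<inter> {x. \<forall>i\<in>L. snd (snd x) i = fst (snd x) * f (t i - fst x)} \<in> sets borel"
        by (rule sets.Int)
      also have "((\<lambda>x. (fst x, fst (snd x), f)) -` Rf \<inter> ?pos) \<inter> {x. \<forall>i\<in>L. snd (snd x) i = fst (snd x) * f (t i - fst x)} = \<Gamma>"
        using sets.sets_into_space[OF Rf] by (auto simp: \<Gamma>_def)
      finally show ?thesis .
    qed
    have fin: "emeasure \<mu> (space \<mu>) \<noteq> \<infinity>"
      unfolding \<mu>_def by (subst emeasure_distr[OF X]) (auto simp: emeasure_restrict_space)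
    obtain K where K: "\<And>n::nat. compact (K n)" "\<And>n. K n \<subseteq> \<Gamma>" "emeasure \<mu> (\<Gamma> - (\<Union>n. K n)) = 0"
      using inner_regular_sigma_compact[OF _ fin \<Gamma>] by (auto simp: \<mu>_def)
    define C where "C = (\<Union>n. (\<lambda>x. snd (snd x)) ` K n) \<inter> space V"
    have "C \<in> sets V"
    proof -
      have "compact ((\<lambda>x. snd (snd x)) ` K n)" for n
        by (intro compact_continuous_image[OF _ K(1)] continuous_intros)
      then have "(\<Union>n. (\<lambda>x. snd (snd x)) ` K n) \<in> sets borel" by (intro sets.countable_UN) (auto intro: borel_compact)
      moreover have "(\<lambda>z. z) \<in> borel_measurable V"
      proof (rule measurable_coordinatewise_then_product)
        fix i show "(\<lambda>z. z i) \<in> borel_measurable V"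
        proof (cases "i \<in> L")
          case False
          have "(\<lambda>z. undefined :: real) \<in> borel_measurable V" by simp
          then show ?thesis
            by (rule measurable_cong[THEN iffD1, rotated]) (use False in \<open>auto simp: vec_space_def space_PiM PiE_def extensional_def\<close>)
        qed (rule coordinate_measurable)
      qed
      ultimately have "(\<lambda>z. z) -` (\<Union>n. (\<lambda>x. snd (snd x)) ` K n) \<inter> space V \<in> sets V" by (rule measurable_sets[rotated])
      then show ?thesis by (simp add: C_def)
    qed
    moreover have "\<exists>p\<in>R. heights p = z" if z: "z \<in> C" for z
    proof -
      obtain x n where x: "x \<in> K n" "z = snd (snd x)" "z \<in> space V" using z by (auto simp: C_def)
      then have "x \<in> \<Gamma>" using K(2) by blast
      then have "(fst x, fst (snd x), f) \<in> R" "\<forall>i\<in>L. z i = height (fst x, fst (snd x), f) i"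
        by (auto simp: \<Gamma>_def Rf_def x(2))
      moreover from this(2) x(3) have "heights (fst x, fst (snd x), f) = z"
        by (auto simp: heights_def vec_space_def space_PiM PiE_def extensional_def fun_eq_iff)
      ultimately show ?thesis by blast
    qed
    moreover have "AE \<omega> in \<Omega>. single \<omega> \<and> leader \<omega> \<in> R \<and> Z \<omega> \<in> D \<and> snd (snd (leader \<omega>)) = f \<longrightarrow> Z \<omega> \<in> C"
    proof -
      have UK: "(\<Union>n. K n) \<in> sets borel" using K(1) by (intro sets.countable_UN) (auto intro: borel_compact)
      have "AE x in \<mu>. x \<notin> \<Gamma> - (\<Union>n. K n)"
        using K(3) \<Gamma> UK by (intro AE_not_in) (auto simp: null_sets_def \<mu>_def)
      then have "AE \<omega> in ?R. X \<omega> \<notin> \<Gamma> - (\<Union>n. K n)" unfolding \<mu>_def by (rule AE_distrD[OF X])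
      then have "AE \<omega> in \<Omega>. \<omega> \<in> E \<longrightarrow> X \<omega> \<notin> \<Gamma> - (\<Union>n. K n)"
        by (subst (asm) AE_restrict_space_iff) auto
      then show ?thesis using AE_space
      proof eventually_elim
        case (elim \<omega>)
        show ?case
        proof
          assume *: "single \<omega> \<and> leader \<omega> \<in> R \<and> Z \<omega> \<in> D \<and> snd (snd (leader \<omega>)) = f"
          then have "\<omega> \<in> E" using elim(2) by (auto simp: E_def Rf_def)
          have leq: "leader \<omega> = (fst (leader \<omega>), fst (snd (leader \<omega>)), f)" using * by (metis prod.collapse)
          have "Z \<omega> i = height (leader \<omega>) i" if "i \<in> L" for i
            using leader_in(3)[of \<omega>] * elim(2) that heights_apply by metis
          then have "X \<omega> \<in> \<Gamma>" using * leq unfolding \<Gamma>_def X_def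
            by (simp add: Rf_def) (metis height_simp)
          then have "X \<omega> \<in> (\<Union>n. K n)" using elim(1) \<open>\<omega> \<in> E\<close> by blast
          then obtain n where "X \<omega> \<in> K n" by blast
          then have "Z \<omega> \<in> (\<lambda>x. snd (snd x)) ` K n" by (force simp: X_def)
          then show "Z \<omega> \<in> C" using measurable_space[OF Z_measurable elim(2)] by (auto simp: C_def)
        qed
      qed
    qed
    ultimately show ?thesis by blast
  qed
  then have "\<forall>f\<in>G. \<exists>C. C \<in> sets V \<and> (\<forall>z\<in>C. \<exists>p\<in>R. heights p = z) \<and>
      (AE \<omega> in \<Omega>. single \<omega> \<and> leader \<omega> \<in> R \<and> Z \<omega> \<in> D \<and> snd (snd (leader \<omega>)) = f \<longrightarrow> Z \<omega> \<in> C)"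
    by (intro ballI)
  from bchoice[OF this] obtain C where C0: "\<forall>f\<in>G. C f \<in> sets V \<and> (\<forall>z\<in>C f. \<exists>p\<in>R. heights p = z) \<and>
      (AE \<omega> in \<Omega>. single \<omega> \<and> leader \<omega> \<in> R \<and> Z \<omega> \<in> D \<and> snd (snd (leader \<omega>)) = f \<longrightarrow> Z \<omega> \<in> C f)"
    by (elim exE)
  then have C: "\<And>f. f \<in> G \<Longrightarrow> C f \<in> sets V" "\<And>f z. f \<in> G \<Longrightarrow> z \<in> C f \<Longrightarrow> \<exists>p\<in>R. heights p = z"
    "\<And>f. f \<in> G \<Longrightarrow> AE \<omega> in \<Omega>. single \<omega> \<and> leader \<omega> \<in> R \<and> Z \<omega> \<in> D \<and> snd (snd (leader \<omega>)) = f \<longrightarrow> Z \<omega> \<in> C f"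
    by simp_all
  have UC [measurable]: "(\<Union>f\<in>G. C f) \<in> sets V" using C(1) G_fin by (intro sets.finite_UN) auto
  have "AE \<omega> in \<Omega>. \<forall>f\<in>G. single \<omega> \<and> leader \<omega> \<in> R \<and> Z \<omega> \<in> D \<and> snd (snd (leader \<omega>)) = f \<longrightarrow> Z \<omega> \<in> C f"
    using G_fin C(3) by (intro AE_finite_allI)
  then have "AE \<omega> in \<Omega>. Z \<omega> \<in> D \<longrightarrow> Z \<omega> \<in> (\<Union>f\<in>G. C f)"
    using lead
  proof eventually_elim
    case (elim \<omega>)
    show ?case
    proof
      assume ZD: "Z \<omega> \<in> D"
      then have "leader \<omega> \<in> space \<Lambda>" using elim(2) sets.sets_into_space[OF R] by blast
      then have "snd (snd (leader \<omega>)) \<in> G" by (cases "leader \<omega>") simp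
      then show "Z \<omega> \<in> (\<Union>f\<in>G. C f)" using elim ZD by blast
    qed
  qed
  then have "AE z in distr \<Omega> V Z. z \<in> D \<longrightarrow> z \<in> (\<Union>f\<in>G. C f)"
    by (subst AE_distr_iff) measurable
  then show ?thesis by eventually_elim (use C(2) in blast)
qed

text \<open>By the previous results there is almost surely a single leader if the maxima lie in \<open>D\<close>. It cannot
  belong to any of the countably many strips, since \<open>weight_exchange\<close> carries the null set \<open>D\<close> over to the law
  on any of them.\<close>

lemma AE_irregular_of_null_image:
  assumes B: "is_branch a b f j1 j2" and D [measurable]: "D \<in> sets V" and sub: "D \<subseteq> strip_image f j1 j2"
    and null: "emeasure (law_on (strip f j1 j2)) D = 0"
  shows "AE z in distr \<Omega> V Z. z \<in> D \<longrightarrow> (\<exists>p\<in>space \<Lambda> - regular_at a b. heights p = z)"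
proof (rule leader_image_cover)
  have other: "AE \<omega> in \<Omega>. single \<omega> \<longrightarrow> Z \<omega> \<in> D \<longrightarrow> leader \<omega> \<notin> strip f' i1 i2"
    if br: "(f', i1, i2) \<in> branches a b" for f' i1 i2
  proof -
    have B': "is_branch a b f' i1 i2" using br by (simp add: branches_def)
    note [measurable] = strip_image_sets[OF B] strip_image_sets[OF B'] weight_measurable[OF B] weight_measurable[OF B']
      strip_sets[OF idx(3)[OF B']]
    let ?A = "strip_image f j1 j2 \<inter> strip_image f' i1 i2"
    have "AE z in law_on (strip f j1 j2). z \<notin> D" using null by (intro AE_not_in) (auto simp: null_sets_def)
    then have "AE z in law_on (strip f j1 j2). indicator ?A z * (indicator D z * ennreal (weight a b (locate a b f' i1 i2 z))) = 0"
      by eventually_elim simp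
    then have "(\<integral>\<^sup>+z. indicator ?A z * (indicator D z * ennreal (weight a b (locate a b f' i1 i2 z))) \<partial>law_on (strip f j1 j2)) = 0"
      by (subst nn_integral_0_iff_AE) auto
    then have "(\<integral>\<^sup>+z. indicator ?A z * (indicator D z * ennreal (weight a b (locate a b f j1 j2 z))) \<partial>law_on (strip f' i1 i2)) = 0"
      by (subst weight_exchange[OF B B', symmetric]) auto
    then have "AE z in law_on (strip f' i1 i2). indicator ?A z * (indicator D z * ennreal (weight a b (locate a b f j1 j2 z))) = 0"
      by (subst (asm) nn_integral_0_iff_AE) auto
    then have "AE z in law_on (strip f' i1 i2). z \<notin> ?A \<inter> D"
    proof eventually_elim
      case (elim z)
      show ?case
      proof
        assume z: "z \<in> ?A \<inter> D"
        then have "weight a b (locate a b f j1 j2 z) > 0"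
          using strip_image_locate(1)[OF B] by (intro weight_pos[OF B]) auto
        then show False using elim z by simp
      qed
    qed
    then have "emeasure (law_on (strip f' i1 i2)) (?A \<inter> D) = 0"
      by (subst (asm) AE_iff_measurable[of "?A \<inter> D"])
         (use sets.sets_into_space[OF D] in \<open>auto simp: sets_eq_imp_space_eq[OF sets_law_on]\<close>)
    then have "emeasure \<Omega> {\<omega> \<in> space \<Omega>. single \<omega> \<and> leader \<omega> \<in> strip f' i1 i2 \<and> Z \<omega> \<in> ?A \<inter> D} = 0"
      using strip_image_positive by (subst (asm) emeasure_law_on) auto
    moreover have "{\<omega> \<in> space \<Omega>. (single \<omega> \<and> leader \<omega> \<in> strip f' i1 i2) \<and> Z \<omega> \<in> ?A \<inter> D} \<in> sets \<Omega>" by measurable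
    ultimately have "{\<omega> \<in> space \<Omega>. single \<omega> \<and> leader \<omega> \<in> strip f' i1 i2 \<and> Z \<omega> \<in> ?A \<inter> D} \<in> null_sets \<Omega>"
      by (simp only: null_sets_def conj_assoc mem_Collect_eq simp_thms)
    then have "AE \<omega> in \<Omega>. \<omega> \<notin> {\<omega> \<in> space \<Omega>. single \<omega> \<and> leader \<omega> \<in> strip f' i1 i2 \<and> Z \<omega> \<in> ?A \<inter> D}"
      by (rule AE_not_in)
    then show ?thesis using AE_space
    proof eventually_elim
      case (elim \<omega>)
      show ?case
      proof (intro impI notI)
        assume *: "single \<omega>" "Z \<omega> \<in> D" "leader \<omega> \<in> strip f' i1 i2"
        have h: "heights (leader \<omega>) = Z \<omega>" "leader \<omega> \<in> space \<Lambda>" using leader_in(2,3)[OF *(1) elim(2)] by auto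
        have zp: "Z \<omega> \<in> positive_vecs" using *(2) sub strip_image_positive by blast
        have "height (leader \<omega>) i > 0" if "i \<in> L" for i
        proof -
          have "Z \<omega> i > 0" using zp that unfolding positive_vecs_def by blast
          then show ?thesis unfolding h(1)[symmetric] heights_apply[OF that] .
        qed
        then have "leader \<omega> \<in> positive_heights" using h(2) by (simp add: positive_heights_def)
        then have "Z \<omega> \<in> strip_image f' i1 i2" using * h(1) unfolding strip_image_def by (metis IntI imageI)
        then show False using elim * sub by blast
      qed
    qed
  qed
  have "AE \<omega> in \<Omega>. \<forall>x\<in>branches a b. single \<omega> \<longrightarrow> Z \<omega> \<in> D \<longrightarrow> leader \<omega> \<notin> on_branch strip x"
    using other by (intro AE_ball_countable[OF countable_branches, THEN iffD2]) auto
  then show "AE \<omega> in \<Omega>. Z \<omega> \<in> D \<longrightarrow> single \<omega> \<and> leader \<omega> \<in> space \<Lambda> - regular_at a b"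
    using AE_single_of_null_image[OF B D sub null] AE_space
  proof eventually_elim
    case (elim \<omega>)
    then show ?case using leader_in(2)[of \<omega>] unfolding regular_at_def by blast
  qed
qed measurable

end


section \<open>Comparing two pairs of coordinates\<close>

context storm_model begin

lemma locate_eq:
  "is_branch a b f j1 j2 \<Longrightarrow> p \<in> strip f j1 j2 \<Longrightarrow> heights p = z \<Longrightarrow> locate a b f j1 j2 z = p"
  using locate_heights by blast

lemma I_set_heights:
  "z \<in> space V \<Longrightarrow> p \<in> I_set G l t z \<longleftrightarrow> p \<in> space \<Lambda> \<and> heights p = z"
  by (cases p) (auto simp: I_set_def heights_def vec_space_def space_PiM PiE_def extensional_def fun_eq_iff)

text \<open>At a storm with heights \<open>z\<close> the numerators of the Jacobian can be written with \<open>z\<close> in place of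
  the profile.\<close>

lemma jacobian_weight:
  assumes p: "(s, u, f) \<in> I_set G l t z" and i: "a \<in> L" "b \<in> L"
  shows "z a * deriv f (t b - s) - z b * deriv f (t a - s) = u * wronskian f (t a) (t b) s"
    and "(1 / u\<^sup>2) * measure PF {f} / \<bar>z a * deriv f (t b - s) - z b * deriv f (t a - s)\<bar> = weight a b (s, u, f)"
proof -
  have z: "z a = u * f (t a - s)" "z b = u * f (t b - s)" and u: "u > 0"
    using p i by (auto simp: I_set_def)
  show eq: "z a * deriv f (t b - s) - z b * deriv f (t a - s) = u * wronskian f (t a) (t b) s"
    unfolding z wronskian_def by (simp add: algebra_simps)
  show "(1 / u\<^sup>2) * measure PF {f} / \<bar>z a * deriv f (t b - s) - z b * deriv f (t a - s)\<bar> = weight a b (s, u, f)"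
    unfolding eq weight_def using u by (simp add: abs_mult)
qed

text \<open>Comparing two pairs of indices requires one and the same strip for both, hence a small enough interval.\<close>

lemma common_branch:
  assumes p: "(s, u, f) \<in> I_set G l t z" and z: "\<And>i. i \<in> L \<Longrightarrow> z i > 0"
    and i: "a \<in> L" "b \<in> L" "c \<in> L" "d \<in> L"
    and C1: "\<And>i. i \<in> L \<Longrightarrow> C1_near f (t i - s)"
    and nz: "z a * deriv f (t b - s) \<noteq> z b * deriv f (t a - s)" "z c * deriv f (t d - s) \<noteq> z d * deriv f (t c - s)"
  shows "\<exists>j1 j2. (f, j1, j2) \<in> branches a b \<and> (f, j1, j2) \<in> branches c d \<and> (s, u, f) \<in> strip f j1 j2"
proof -
  have sp: "(s, u, f) \<in> space \<Lambda>" and u: "u > 0" using p by (auto simp: I_set_def)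
  have pos: "f (t i - s) > 0" if "i \<in> L" for i
  proof -
    have "u * f (t i - s) = z i" using p that by (auto simp: I_set_def)
    then show ?thesis using z[OF that] u zero_less_mult_pos by metis
  qed
  have w: "wronskian f (t a) (t b) s \<noteq> 0" "wronskian f (t c) (t d) s \<noteq> 0"
    using jacobian_weight(1)[OF p i(1,2)] jacobian_weight(1)[OF p i(3,4)] nz by auto
  obtain e1 where e1: "e1 > 0" "\<forall>j1 j2. s - e1 < j1 \<longrightarrow> j1 < s \<longrightarrow> s < j2 \<longrightarrow> j2 < s + e1 \<longrightarrow>
    is_branch a b f j1 j2 \<and> (s, u, f) \<in> strip f j1 j2"
    using C1_regular_at[OF i(1,2) sp C1[OF i(1)] C1[OF i(2)] pos[OF i(1)] w(1)] by blast
  obtain e2 where e2: "e2 > 0" "\<forall>j1 j2. s - e2 < j1 \<longrightarrow> j1 < s \<longrightarrow> s < j2 \<longrightarrow> j2 < s + e2 \<longrightarrow>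
    is_branch c d f j1 j2 \<and> (s, u, f) \<in> strip f j1 j2"
    using C1_regular_at[OF i(3,4) sp C1[OF i(3)] C1[OF i(4)] pos[OF i(3)] w(2)] by blast
  obtain j1 where j1: "j1 \<in> \<rat>" "s - min e1 e2 < j1" "j1 < s"
    using Rats_dense_in_real[of "s - min e1 e2" s] e1(1) e2(1) by auto
  obtain j2 where j2: "j2 \<in> \<rat>" "s < j2" "j2 < s + min e1 e2"
    using Rats_dense_in_real[of s "s + min e1 e2"] e1(1) e2(1) by auto
  have "is_branch a b f j1 j2 \<and> (s, u, f) \<in> strip f j1 j2" using e1(2) j1 j2 by simp
  moreover have "is_branch c d f j1 j2" using e2(2) j1 j2 by simp
  ultimately show ?thesis using j1(1) j2(1) unfolding branches_def by blast
qed

lemma branches_regular_at: "(f, j1, j2) \<in> branches a b \<Longrightarrow> p \<in> strip f j1 j2 \<Longrightarrow> p \<in> regular_at a b"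
  unfolding regular_at_def by force

end

context storm_process begin

abbreviation "P\<^sub>Z \<equiv> distr \<Omega> V Z"

lemma prob_space_PZ: "prob_space P\<^sub>Z" by (rule prob_space_distr) measurable

lemma restricted_law_finite:
  assumes "is_branch a b f j1 j2" "A \<in> sets V" "A \<subseteq> strip_image f j1 j2"
  shows "finite_measure (density (law_on (strip f j1 j2)) (indicator A))"
proof (rule finite_measureI)
  have AV: "A \<in> sets (law_on (strip f j1 j2))" using assms(2) by simp
  have "emeasure (density (law_on (strip f j1 j2)) (indicator A)) (space (law_on (strip f j1 j2)))
      = emeasure (law_on (strip f j1 j2)) A"
    unfolding emeasure_restricted[OF AV sets.top] using sets.sets_into_space[OF AV] by (simp only: Int_absorb2)
  also have "\<dots> \<le> 1"
    unfolding emeasure_law_on[OF strip_sets[OF idx(3)[OF assms(1)]] assms(2) subset_trans[OF assms(3) strip_image_positive]]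
    by (rule emeasure_le_1)
  finally show "emeasure (density (law_on (strip f j1 j2)) (indicator A)) (space (density (law_on (strip f j1 j2)) (indicator A))) \<noteq> \<infinity>"
    by (auto simp: top_unique)
qed

text \<open>The weights for \<open>(a, b)\<close> and those for \<open>(c, d)\<close> both express the density of the same measure with respect
  to the same other one, so their ratios agree outside a null set of the law on the first strip. For the law of the
  maxima itself this leaves only vectors that some irregular storm attains.\<close>

lemma weight_ratio_independent:
  assumes B: "is_branch a b f j1 j2" "is_branch a b f' i1 i2"
    and C: "is_branch c d f j1 j2" "is_branch c d f' i1 i2"
  shows "AE z in P\<^sub>Z. z \<in> strip_image f j1 j2 \<inter> strip_image f' i1 i2 \<longrightarrow>
     weight c d (locate c d f j1 j2 z) * weight a b (locate a b f' i1 i2 z)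
       = weight a b (locate a b f j1 j2 z) * weight c d (locate c d f' i1 i2 z)
     \<or> (\<exists>p\<in>space \<Lambda> - regular_at a b. heights p = z)"
proof -
  let ?A = "strip_image f j1 j2 \<inter> strip_image f' i1 i2"
  let ?m = "law_on (strip f j1 j2)" and ?m' = "law_on (strip f' i1 i2)"
  let ?w = "\<lambda>z. weight a b (locate a b f j1 j2 z)" and ?w' = "\<lambda>z. weight a b (locate a b f' i1 i2 z)"
  let ?x = "\<lambda>z. weight c d (locate c d f j1 j2 z)" and ?x' = "\<lambda>z. weight c d (locate c d f' i1 i2 z)"
  note [measurable] = strip_image_sets[OF B(1)] strip_image_sets[OF B(2)]
    weight_measurable[OF B(1)] weight_measurable[OF B(2)] weight_measurable[OF C(1)] weight_measurable[OF C(2)]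
  have A [measurable]: "?A \<in> sets V" by measurable
  let ?M = "density ?m (indicator ?A)"
  interpret M: finite_measure ?M by (rule restricted_law_finite[OF B(1) A]) auto
  have integral: "(\<integral>\<^sup>+z\<in>X. g z \<partial>?M) = (\<integral>\<^sup>+z. indicator ?A z * (indicator X z * g z) \<partial>?m)"
    if [measurable]: "g \<in> borel_measurable V" "X \<in> sets V" for g X
    by (subst nn_integral_density) (auto simp: mult_ac)
  have "AE z in ?M. ennreal (?x z) * ennreal (?w' z) = ennreal (?w z) * ennreal (?x' z)"
  proof (rule M.density_unique2)
    fix X assume "X \<in> sets ?M"
    then have [measurable]: "X \<in> sets V" by simp
    have "(\<integral>\<^sup>+z\<in>X. (ennreal (?x z) * ennreal (?w' z)) \<partial>?M)
        = (\<integral>\<^sup>+z. indicator ?A z * ((indicator X z * ennreal (?x z)) * ennreal (?w' z)) \<partial>?m)"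
      by (subst integral) (auto simp: mult.assoc)
    also have "\<dots> = (\<integral>\<^sup>+z. indicator ?A z * ((indicator X z * ennreal (?x z)) * ennreal (?w z)) \<partial>?m')"
      by (rule weight_exchange[OF B]) measurable
    also have "\<dots> = (\<integral>\<^sup>+z. indicator ?A z * ((indicator X z * ennreal (?w z)) * ennreal (?x z)) \<partial>?m')"
      by (simp add: mult_ac)
    also have "\<dots> = (\<integral>\<^sup>+z. indicator ?A z * ((indicator X z * ennreal (?w z)) * ennreal (?x' z)) \<partial>?m)"
      by (rule weight_exchange[OF C, symmetric]) measurable
    also have "\<dots> = (\<integral>\<^sup>+z\<in>X. (ennreal (?w z) * ennreal (?x' z)) \<partial>?M)"
      by (subst integral) (auto simp: mult.assoc)
    finally show "(\<integral>\<^sup>+z\<in>X. (ennreal (?x z) * ennreal (?w' z)) \<partial>?M) = (\<integral>\<^sup>+z\<in>X. (ennreal (?w z) * ennreal (?x' z)) \<partial>?M)" .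
  qed simp_all
  then have ae: "AE z in ?m. 0 < (indicator ?A z :: ennreal) \<longrightarrow> ennreal (?x z) * ennreal (?w' z) = ennreal (?w z) * ennreal (?x' z)"
    by (subst (asm) AE_density) auto
  define D where "D = {z \<in> space V. z \<in> ?A \<and> ?x z * ?w' z \<noteq> ?w z * ?x' z}"
  have "{z \<in> space V. ?x z * ?w' z = ?w z * ?x' z} \<in> sets V"
    by (rule borel_measurable_eq) (intro borel_measurable_times weight_measurable B C)+
  then have "?A - {z \<in> space V. ?x z * ?w' z = ?w z * ?x' z} \<in> sets V" by (rule sets.Diff[OF A])
  moreover have "D = ?A - {z \<in> space V. ?x z * ?w' z = ?w z * ?x' z}"
    using sets.sets_into_space[OF A] by (auto simp: D_def)
  ultimately have D [measurable]: "D \<in> sets V" by (simp only:)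
  have "AE z in ?m. z \<notin> D"
    using ae
  proof eventually_elim
    case (elim z)
    show ?case
    proof
      assume z: "z \<in> D"
      then have in1: "z \<in> strip_image f j1 j2" and in2: "z \<in> strip_image f' i1 i2" by (auto simp: D_def)
      have nn: "?w z > 0" "?w' z > 0" "?x z > 0" "?x' z > 0"
        using weight_pos[OF B(1) strip_image_locate(1)[OF B(1) in1]] weight_pos[OF B(2) strip_image_locate(1)[OF B(2) in2]]
          weight_pos[OF C(1) strip_image_locate(1)[OF C(1) in1]] weight_pos[OF C(2) strip_image_locate(1)[OF C(2) in2]]
        by auto
      have "ennreal (?x z) * ennreal (?w' z) = ennreal (?w z) * ennreal (?x' z)" using elim z by (auto simp: D_def)
      then have "?x z * ?w' z = ?w z * ?x' z" using nn by (simp add: ennreal_mult[symmetric])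
      then show False using z by (simp add: D_def)
    qed
  qed
  then have "D \<in> null_sets ?m" using D by (subst AE_iff_null_sets) simp_all
  then have "emeasure ?m D = 0" by (rule null_setsD1)
  then have "AE z in P\<^sub>Z. z \<in> D \<longrightarrow> (\<exists>p\<in>space \<Lambda> - regular_at a b. heights p = z)"
    by (intro AE_irregular_of_null_image[OF B(1) D]) (auto simp: D_def)
  then show ?thesis using AE_space
    by eventually_elim (auto simp: D_def)
qed

section \<open>Disintegration along the vector of maxima\<close>

lemma space_sigma_process: "space (sigma_process \<Omega> \<Lambda> \<Phi>) = space \<Omega>"
  unfolding sigma_process_def by (rule space_measure_of) auto

text \<open>The kernel measures only events of the \<open>\<sigma>\<close>-algebra of the process, so the events about leaders must
  be shown to lie in it.\<close>

lemma counting_sigma_process: "counting G PF l (sigma_process \<Omega> \<Lambda> \<Phi>) \<Phi>"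
proof unfold_locales
  fix A assume A: "A \<in> sets \<Lambda>"
  show "cnt A \<in> borel_measurable (sigma_process \<Omega> \<Lambda> \<Phi>)"
  proof (rule measurableI)
    fix B assume B: "B \<in> sets (borel :: ennreal measure)"
    have "cnt A -` B \<inter> space \<Omega> \<in> sigma_sets (space \<Omega>)
      {(\<lambda>\<omega>. num_points (\<Phi> \<omega> \<inter> A)) -` B \<inter> space \<Omega> | A B. A \<in> sets \<Lambda> \<and> B \<in> sets borel}"
      using A B by (intro sigma_sets.Basic) blast
    then show "cnt A -` B \<inter> space (sigma_process \<Omega> \<Lambda> \<Phi>) \<in> sets (sigma_process \<Omega> \<Lambda> \<Phi>)"
      unfolding space_sigma_process by (simp add: sigma_process_def sets_measure_of_conv, auto)
  qed simp
qed (auto simp: space_sigma_process \<Phi>_space lf)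

context
  fixes K assumes K: "regular_cond_prob \<Omega> (sigma_process \<Omega> \<Lambda> \<Phi>) V Z K"
begin

abbreviation "\<A> \<equiv> sigma_process \<Omega> \<Lambda> \<Phi>"

interpretation A: counting G PF l t \<A> \<Phi> Z by (rule counting_sigma_process) (rule Z_def)
interpretation PZ: prob_space P\<^sub>Z by (rule prob_space_PZ)

lemma kernel_measurable: "E \<in> sets \<A> \<Longrightarrow> (\<lambda>z. emeasure (K z) E) \<in> borel_measurable V"
  using K measurable_emeasure_kernel[OF measurable_prob_algebraD] unfolding regular_cond_prob_def by blast

lemma kernel_prob: "z \<in> space V \<Longrightarrow> prob_space (K z)" and kernel_sets: "z \<in> space V \<Longrightarrow> sets (K z) = sets \<A>"
  using K measurable_space[of K V "prob_algebra \<A>" z]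
  unfolding regular_cond_prob_def by (auto simp: space_prob_algebra)

lemma kernel_space: "z \<in> space V \<Longrightarrow> space (K z) = space \<Omega>"
  using sets_eq_imp_space_eq[OF kernel_sets] by (simp add: space_sigma_process)

lemma disintegrate:
  assumes "E \<in> sets \<A>" "B \<in> sets V"
  shows "(\<integral>\<^sup>+z\<in>B. emeasure (K z) E \<partial>P\<^sub>Z) = emeasure \<Omega> (E \<inter> {\<omega> \<in> space \<Omega>. Z \<omega> \<in> B})"
proof -
  have "emeasure \<Omega> (E \<inter> (Z -` B \<inter> space \<Omega>)) = (\<integral>\<^sup>+z\<in>B. emeasure (K z) E \<partial>P\<^sub>Z)"
    using K assms unfolding regular_cond_prob_def by blast
  moreover have "Z -` B \<inter> space \<Omega> = {\<omega> \<in> space \<Omega>. Z \<omega> \<in> B}" by auto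
  ultimately show ?thesis by simp
qed

lemma kernel_event:
  assumes [measurable]: "B \<in> sets V"
  shows "AE z in P\<^sub>Z. emeasure (K z) {\<omega> \<in> space \<Omega>. Z \<omega> \<in> B} = indicator B z"
proof (rule PZ.density_unique2)
  have E: "{\<omega> \<in> space \<Omega>. Z \<omega> \<in> B} \<in> sets \<A>"
    using measurable_sets[OF A.Z_measurable assms] by (simp add: vimage_def Int_def space_sigma_process conj_commute)
  show "(\<lambda>z. emeasure (K z) {\<omega> \<in> space \<Omega>. Z \<omega> \<in> B}) \<in> borel_measurable P\<^sub>Z"
    using kernel_measurable[OF E] by simp
  fix X assume "X \<in> sets P\<^sub>Z"
  then have [measurable]: "X \<in> sets V" by simp
  have "(\<integral>\<^sup>+z\<in>X. emeasure (K z) {\<omega> \<in> space \<Omega>. Z \<omega> \<in> B} \<partial>P\<^sub>Z)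
      = emeasure \<Omega> ({\<omega> \<in> space \<Omega>. Z \<omega> \<in> B} \<inter> {\<omega> \<in> space \<Omega>. Z \<omega> \<in> X})"
    by (rule disintegrate[OF E]) measurable
  also have "{\<omega> \<in> space \<Omega>. Z \<omega> \<in> B} \<inter> {\<omega> \<in> space \<Omega>. Z \<omega> \<in> X} = Z -` (B \<inter> X) \<inter> space \<Omega>" by auto
  also have "emeasure \<Omega> \<dots> = emeasure P\<^sub>Z (B \<inter> X)" by (rule emeasure_distr[symmetric]) measurable
  also have "\<dots> = (\<integral>\<^sup>+z. indicator (B \<inter> X) z \<partial>P\<^sub>Z)" by (rule nn_integral_indicator[symmetric]) simp
  also have "\<dots> = (\<integral>\<^sup>+z\<in>X. indicator B z \<partial>P\<^sub>Z)"
    by (intro nn_integral_cong) (auto split: split_indicator)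
  finally show "(\<integral>\<^sup>+z\<in>X. emeasure (K z) {\<omega> \<in> space \<Omega>. Z \<omega> \<in> B} \<partial>P\<^sub>Z) = (\<integral>\<^sup>+z\<in>X. indicator B z \<partial>P\<^sub>Z)" .
qed measurable

text \<open>The events \<open>Z i \<le> q\<close> with rational \<open>q\<close> have kernel probability zero or one, as they should, and
  countably many of them separate vectors.\<close>

lemma kernel_fibre: "AE z in P\<^sub>Z. AE \<omega> in K z. Z \<omega> = z"
proof -
  define B where "B i q = {z \<in> space V. z i \<le> q}" for i and q :: real
  have Bm [measurable]: "B i q \<in> sets V" if "i \<in> L" for i q
    unfolding B_def using coordinates_measurable[OF that that that, of "\<lambda>(x, y, w). w \<le> q" "count_space UNIV"] by simp
  have "AE z in P\<^sub>Z. \<forall>i\<in>L. \<forall>q\<in>\<rat>. emeasure (K z) {\<omega> \<in> space \<Omega>. Z \<omega> \<in> B i q} = indicator (B i q) z"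
    by (intro AE_finite_allI AE_ball_countable[OF countable_rat, THEN iffD2] ballI kernel_event Bm) auto
  then show ?thesis using AE_space
  proof eventually_elim
    case (elim z)
    then have z: "z \<in> space V" by simp
    interpret Kz: prob_space "K z" using kernel_prob[OF z] .
    have sp: "space (K z) = space \<Omega>" using kernel_space[OF z] .
    have "AE \<omega> in K z. Z \<omega> \<in> B i q \<longleftrightarrow> z \<in> B i q" if i: "i \<in> L" and q: "q \<in> \<rat>" for i q
    proof -
      have E: "{\<omega> \<in> space \<Omega>. Z \<omega> \<in> B i q} \<in> sets (K z)"
        using measurable_sets[OF A.Z_measurable Bm[OF i], of q] kernel_sets[OF z]
        by (simp add: vimage_def Int_def space_sigma_process conj_commute)
      have e: "emeasure (K z) {\<omega> \<in> space \<Omega>. Z \<omega> \<in> B i q} = indicator (B i q) z" using elim(1) i q by blast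
      show ?thesis
      proof (cases "z \<in> B i q")
        case True
        then have "AE \<omega> in K z. \<omega> \<in> {\<omega> \<in> space \<Omega>. Z \<omega> \<in> B i q}"
          using e E by (subst Kz.AE_in_set_eq_1) (auto simp: Kz.emeasure_eq_measure)
        then show ?thesis by eventually_elim (use True in auto)
      next
        case False
        then have "AE \<omega> in K z. \<omega> \<notin> {\<omega> \<in> space \<Omega>. Z \<omega> \<in> B i q}"
          using e E by (intro AE_not_in) (auto simp: null_sets_def)
        then show ?thesis using AE_space by eventually_elim (use False sp in auto)
      qed
    qed
    then have "AE \<omega> in K z. \<forall>i\<in>L. \<forall>q\<in>\<rat>. Z \<omega> \<in> B i q \<longleftrightarrow> z \<in> B i q"
      by (intro AE_finite_allI AE_ball_countable[OF countable_rat, THEN iffD2] ballI) auto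
    then show ?case using AE_space
    proof eventually_elim
      case (elim \<omega>)
      have ZV: "Z \<omega> \<in> space V" using elim(2) measurable_space[OF Z_measurable, of \<omega>] sp by simp
      have "Z \<omega> i = z i" if i: "i \<in> L" for i
      proof (rule ccontr)
        assume "Z \<omega> i \<noteq> z i"
        then consider "Z \<omega> i < z i" | "z i < Z \<omega> i" by linarith
        then show False
        proof cases
          case 1
          obtain q where "q \<in> \<rat>" "Z \<omega> i < q" "q < z i" using Rats_dense_in_real[OF 1] by blast
          then show False using bspec[OF bspec[OF elim(1) i], of q] ZV z by (auto simp: B_def)
        next
          case 2
          obtain q where "q \<in> \<rat>" "z i < q" "q < Z \<omega> i" using Rats_dense_in_real[OF 2] by blast
          then show False using bspec[OF bspec[OF elim(1) i], of q] ZV z by (auto simp: B_def)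
        qed
      qed
      then show "Z \<omega> = z" using ZV z by (auto simp: vec_space_def space_PiM intro: PiE_ext)
    qed
  qed
qed

definition mass :: "storm set \<Rightarrow> (nat \<Rightarrow> real) \<Rightarrow> ennreal" where
  "mass U z = emeasure (K z) {\<omega> \<in> space \<Omega>. single \<omega> \<and> leader \<omega> \<in> U}"

lemma single_leader_event: "U \<in> sets \<Lambda> \<Longrightarrow> {\<omega> \<in> space \<Omega>. single \<omega> \<and> leader \<omega> \<in> U} \<in> sets \<A>"
  using A.single_leader_measurable[of U] by (simp add: pred_def space_sigma_process)

lemma mass_measurable [measurable]: "U \<in> sets \<Lambda> \<Longrightarrow> mass U \<in> borel_measurable V"
  unfolding mass_def by (rule kernel_measurable[OF single_leader_event])

lemma mass_integral:
  assumes U: "U \<in> sets \<Lambda>" and A: "A \<in> sets V" "A \<subseteq> positive_vecs"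
  shows "(\<integral>\<^sup>+z\<in>A. mass U z \<partial>P\<^sub>Z) = emeasure (law_on U) A"
  unfolding mass_def disintegrate[OF single_leader_event[OF U] A(1)] emeasure_law_on[OF U A]
  by (rule arg_cong[where f = "emeasure \<Omega>"]) auto

text \<open>On strips, the conditional masses are the densities of the laws \<open>law_on\<close> with respect to the law of
  the maxima, so they inherit the ratio of the weights.\<close>

lemma mass_exchange:
  assumes B: "is_branch a b f j1 j2" and B': "is_branch a b f' i1 i2"
  shows "AE z in P\<^sub>Z. z \<in> strip_image f j1 j2 \<inter> strip_image f' i1 i2 \<longrightarrow>
    mass (strip f j1 j2) z * ennreal (weight a b (locate a b f' i1 i2 z))
      = mass (strip f' i1 i2) z * ennreal (weight a b (locate a b f j1 j2 z))"
proof -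
  let ?A = "strip_image f j1 j2 \<inter> strip_image f' i1 i2"
  note [measurable] = strip_image_sets[OF B] strip_image_sets[OF B'] weight_measurable[OF B] weight_measurable[OF B']
    mass_measurable[OF strip_sets[OF idx(3)[OF B]]] mass_measurable[OF strip_sets[OF idx(3)[OF B']]]
  have transfer: "(\<integral>\<^sup>+z. indicator ?A z * g z \<partial>law_on U) = (\<integral>\<^sup>+z. indicator ?A z * (mass U z * g z) \<partial>P\<^sub>Z)"
    if U: "U \<in> sets \<Lambda>" and g [measurable]: "g \<in> borel_measurable V" for U g
  proof -
    note [measurable] = mass_measurable[OF U]
    have eq: "density (law_on U) (indicator ?A) = density P\<^sub>Z (\<lambda>z. indicator ?A z * mass U z)"
    proof (rule measure_eqI)
      fix X assume "X \<in> sets (density (law_on U) (indicator ?A))"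
      then have [measurable]: "X \<in> sets V" by simp
      have "emeasure (density (law_on U) (indicator ?A)) X = emeasure (law_on U) (?A \<inter> X)"
        by (subst emeasure_restricted) auto
      also have "\<dots> = (\<integral>\<^sup>+z\<in>?A \<inter> X. mass U z \<partial>P\<^sub>Z)"
        using strip_image_positive by (intro mass_integral[OF U, symmetric]) (measurable, blast)
      also have "\<dots> = (\<integral>\<^sup>+z\<in>X. (indicator ?A z * mass U z) \<partial>P\<^sub>Z)"
        by (intro nn_integral_cong) (auto split: split_indicator)
      also have "\<dots> = emeasure (density P\<^sub>Z (\<lambda>z. indicator ?A z * mass U z)) X"
        by (subst emeasure_density) auto
      finally show "emeasure (density (law_on U) (indicator ?A)) X = emeasure (density P\<^sub>Z (\<lambda>z. indicator ?A z * mass U z)) X" .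
    qed simp
    have "(\<integral>\<^sup>+z. indicator ?A z * g z \<partial>law_on U) = (\<integral>\<^sup>+z. g z \<partial>density (law_on U) (indicator ?A))"
      by (subst nn_integral_density) auto
    also have "\<dots> = (\<integral>\<^sup>+z. indicator ?A z * (mass U z * g z) \<partial>P\<^sub>Z)"
      unfolding eq by (subst nn_integral_density) (auto simp: mult.assoc)
    finally show ?thesis .
  qed
  have "AE z in P\<^sub>Z. indicator ?A z * (mass (strip f j1 j2) z * ennreal (weight a b (locate a b f' i1 i2 z)))
      = indicator ?A z * (mass (strip f' i1 i2) z * ennreal (weight a b (locate a b f j1 j2 z)))"
  proof (rule PZ.density_unique2)
    fix X assume "X \<in> sets P\<^sub>Z"
    then have [measurable]: "X \<in> sets V" by simp
    have "(\<integral>\<^sup>+z\<in>X. (indicator ?A z * (mass (strip f j1 j2) z * ennreal (weight a b (locate a b f' i1 i2 z)))) \<partial>P\<^sub>Z)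
       = (\<integral>\<^sup>+z. indicator ?A z * (indicator X z * ennreal (weight a b (locate a b f' i1 i2 z))) \<partial>law_on (strip f j1 j2))"
      by (subst transfer[OF strip_sets[OF idx(3)[OF B]]]) (auto simp: mult_ac)
    also have "\<dots> = (\<integral>\<^sup>+z. indicator ?A z * (indicator X z * ennreal (weight a b (locate a b f j1 j2 z))) \<partial>law_on (strip f' i1 i2))"
      by (rule weight_exchange[OF B B']) measurable
    also have "\<dots> = (\<integral>\<^sup>+z\<in>X. (indicator ?A z * (mass (strip f' i1 i2) z * ennreal (weight a b (locate a b f j1 j2 z)))) \<partial>P\<^sub>Z)"
      by (subst transfer[OF strip_sets[OF idx(3)[OF B']]]) (auto simp: mult_ac)
    finally show "(\<integral>\<^sup>+z\<in>X. (indicator ?A z * (mass (strip f j1 j2) z * ennreal (weight a b (locate a b f' i1 i2 z)))) \<partial>P\<^sub>Z)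
       = (\<integral>\<^sup>+z\<in>X. (indicator ?A z * (mass (strip f' i1 i2) z * ennreal (weight a b (locate a b f j1 j2 z)))) \<partial>P\<^sub>Z)" .
  qed simp_all
  then show ?thesis
  proof eventually_elim
    case (elim z)
    show ?case
    proof
      assume "z \<in> ?A"
      then have "indicator ?A z = (1 :: ennreal)" by (rule indicator_simps(1))
      then show "mass (strip f j1 j2) z * ennreal (weight a b (locate a b f' i1 i2 z))
          = mass (strip f' i1 i2) z * ennreal (weight a b (locate a b f j1 j2 z))"
        using elim by (simp only: mult_1_left)
    qed
  qed
qed

text \<open>Where the mass of a strip vanishes, the law on the strip vanishes, and such vectors arise only
  through irregular storms. This makes the conditioning event of the main result non-degenerate.\<close>

lemma mass_positive:
  assumes B: "is_branch a b f j1 j2"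
  shows "AE z in P\<^sub>Z. z \<in> strip_image f j1 j2 \<longrightarrow> mass (strip f j1 j2) z > 0 \<or> (\<exists>p\<in>space \<Lambda> - regular_at a b. heights p = z)"
proof -
  note U = strip_sets[OF idx(3)[OF B]]
  note [measurable] = strip_image_sets[OF B] mass_measurable[OF U]
  define D where "D = {z \<in> space V. z \<in> strip_image f j1 j2 \<and> mass (strip f j1 j2) z = 0}"
  have D [measurable]: "D \<in> sets V" unfolding D_def by measurable
  have "emeasure (law_on (strip f j1 j2)) D = (\<integral>\<^sup>+z\<in>D. mass (strip f j1 j2) z \<partial>P\<^sub>Z)"
    using strip_image_positive by (intro mass_integral[OF U D, symmetric]) (auto simp: D_def)
  also have "\<dots> = (\<integral>\<^sup>+z. 0 \<partial>P\<^sub>Z)" by (intro nn_integral_cong) (auto simp: D_def split: split_indicator)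
  finally have "AE z in P\<^sub>Z. z \<in> D \<longrightarrow> (\<exists>p\<in>space \<Lambda> - regular_at a b. heights p = z)"
    by (intro AE_irregular_of_null_image[OF B D]) (auto simp: D_def)
  then show ?thesis using AE_space
    by eventually_elim (auto simp: D_def zero_less_iff_neq_zero)
qed

end

end


section \<open>The conditional law of the leading storm\<close>

context storm_model begin

lemma singleton_sets:
  assumes "p \<in> space \<Lambda>" shows "{p} \<in> sets \<Lambda>"
proof -
  have "{p} = {q \<in> space \<Lambda>. fst q = fst p \<and> fst (snd q) = fst (snd p) \<and> snd (snd q) = snd (snd p)}"
    using assms by (auto simp: prod_eq_iff)
  also have "\<dots> \<in> sets \<Lambda>"
    using assms by (cases p) (simp, measurable)
  finally show ?thesis .
qed

lemma regular_strip:
  assumes z: "z \<in> positive_vecs" and p: "heights p = z" "p \<in> space \<Lambda>" and st: "p \<in> strip f j1 j2"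
  shows "z \<in> strip_image f j1 j2"
proof -
  have "height p i > 0" if "i \<in> L" for i
    using z that heights_apply[OF that, of p] unfolding p(1)[symmetric] positive_vecs_def by auto
  then have "p \<in> positive_heights" using p(2) by (simp add: positive_heights_def)
  then show ?thesis using p(1) st unfolding strip_image_def by blast
qed

end

context storm_process begin

context
  fixes K assumes K: "regular_cond_prob \<Omega> (sigma_process \<Omega> \<Lambda> \<Phi>) V Z K"
begin

interpretation A: counting G PF l t "\<A>" \<Phi> Z by (rule counting_sigma_process) (rule Z_def)

text \<open>Given \<open>Z = z\<close>, the leader is one of the finitely many storms in the fibre over \<open>z\<close>. Each of them is the
  only point of the fibre in one of its strips, so its conditional probability is the mass of this strip. These
  masses are positive and in the ratio of the weights; normalising gives the result.\<close>

lemma conditional_weight: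
  "AE z in P\<^sub>Z. z \<in> positive_vecs \<longrightarrow> finite (I_set G l t z) \<longrightarrow> I_set G l t z \<subseteq> regular_at a b \<longrightarrow>
     (\<forall>p\<in>I_set G l t z. measure (K z) {\<omega> \<in> space \<Omega>. p \<in> \<Phi> \<omega> \<and> single \<omega>} / measure (K z) {\<omega> \<in> space \<Omega>. single \<omega>}
        = weight a b p / (\<Sum>q\<in>I_set G l t z. weight a b q))"
proof -
  have exch: "AE z in P\<^sub>Z. \<forall>x\<in>branches a b. \<forall>y\<in>branches a b.
    z \<in> on_branch strip_image x \<inter> on_branch strip_image y \<longrightarrow>
    mass K (on_branch strip x) z * ennreal (weight a b (on_branch (locate a b) y z))
      = mass K (on_branch strip y) z * ennreal (weight a b (on_branch (locate a b) x z))"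
    by (intro AE_ball_countable[OF countable_branches, THEN iffD2] ballI mass_exchange[OF K])
       (auto simp: branches_def)
  have pos: "AE z in P\<^sub>Z. \<forall>x\<in>branches a b. z \<in> on_branch strip_image x \<longrightarrow>
      mass K (on_branch strip x) z > 0 \<or> (\<exists>p\<in>space \<Lambda> - regular_at a b. heights p = z)"
    by (intro AE_ball_countable[OF countable_branches, THEN iffD2] ballI mass_positive[OF K])
       (auto simp: branches_def)
  from exch pos kernel_fibre[OF K] AE_space show ?thesis
  proof eventually_elim
    case (elim z)
    show ?case
    proof (intro impI)
      let ?I = "I_set G l t z"
      assume zpos: "z \<in> positive_vecs" and fin: "finite ?I" and reg: "?I \<subseteq> regular_at a b"
      have z: "z \<in> space V" using elim(4) by simp
      interpret Kz: prob_space "K z" by (rule kernel_prob[OF K z])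
      note sp = kernel_space[OF K z] and sets = kernel_sets[OF K z]
      have I: "p \<in> ?I \<longleftrightarrow> p \<in> space \<Lambda> \<and> heights p = z" for p by (rule I_set_heights[OF z])
      have no_irreg: "\<not> (\<exists>p\<in>space \<Lambda> - regular_at a b. heights p = z)" using reg I by blast
      define E where "E p = {\<omega> \<in> space \<Omega>. single \<omega> \<and> leader \<omega> \<in> {p}}" for p
      define \<kappa> where "\<kappa> p = measure (K z) (E p)" for p
      have Em: "E p \<in> sets (K z)" if "p \<in> ?I" for p
        unfolding E_def sets using that I by (intro single_leader_event[OF K] singleton_sets) simp
      have lead: "AE \<omega> in K z. single \<omega> \<longrightarrow> leader \<omega> \<in> ?I"
        using elim(3) AE_space
      proof eventually_elim
        case (elim \<omega>)
        show ?case using leader_in(2,3)[of \<omega>] elim sp I by auto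
      qed
      have branch: "\<exists>x\<in>branches a b. p \<in> on_branch strip x \<and>
          z \<in> on_branch strip_image x \<and>
          on_branch (locate a b) x z = p \<and>
          mass K (on_branch strip x) z = ennreal (\<kappa> p)" if p: "p \<in> ?I" for p
      proof -
        have p': "p \<in> space \<Lambda>" "heights p = z" using p I by auto
        obtain x where x: "x \<in> branches a b" "p \<in> on_branch strip x"
          using reg p unfolding regular_at_def by blast
        let ?U = "on_branch strip x"
        have B: "is_branch a b (fst x) (fst (snd x)) (snd (snd x))" using x(1) by (auto simp: branches_def)
        have img: "z \<in> on_branch strip_image x"
          by (rule regular_strip[OF zpos p'(2,1) x(2)])
        have "mass K ?U z = emeasure (K z) (E p)"
          unfolding mass_def[OF K]
        proof (rule emeasure_eq_AE)
          show "AE \<omega> in K z. \<omega> \<in> {\<omega> \<in> space \<Omega>. single \<omega> \<and> leader \<omega> \<in> ?U} \<longleftrightarrow> \<omega> \<in> E p"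
            using elim(3) AE_space
          proof eventually_elim
            case (elim \<omega>)
            show ?case
            proof
              assume "\<omega> \<in> {\<omega> \<in> space \<Omega>. single \<omega> \<and> leader \<omega> \<in> ?U}"
              then have *: "\<omega> \<in> space \<Omega>" "single \<omega>" "leader \<omega> \<in> ?U" by auto
              then have "heights (leader \<omega>) = z" using leader_in(3) elim(1) by simp
              then have "leader \<omega> = p"
                using locate_eq[OF B *(3)] locate_eq[OF B x(2) p'(2)] by metis
              then show "\<omega> \<in> E p" using * by (simp add: E_def)
            next
              assume "\<omega> \<in> E p"
              then show "\<omega> \<in> {\<omega> \<in> space \<Omega>. single \<omega> \<and> leader \<omega> \<in> ?U}" using x(2) by (simp add: E_def)
            qed
          qed
          show "{\<omega> \<in> space \<Omega>. single \<omega> \<and> leader \<omega> \<in> ?U} \<in> sets (K z)"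
            unfolding sets by (rule single_leader_event[OF K strip_sets[OF idx(3)[OF B]]])
        qed (rule Em[OF p])
        then have "mass K ?U z = ennreal (\<kappa> p)" by (simp only: \<kappa>_def Kz.emeasure_eq_measure)
        then show ?thesis using x img locate_eq[OF B x(2) p'(2)] by (intro bexI[of _ x]) simp_all
      qed
      have w: "weight a b p > 0" if p: "p \<in> ?I" for p
      proof -
        obtain x where x: "x \<in> branches a b" "p \<in> on_branch strip x" using branch[OF p] by blast
        then show ?thesis by (intro weight_pos[of a b "fst x" "fst (snd x)" "snd (snd x)"]) (auto simp: branches_def)
      qed
      have \<kappa>pos: "\<kappa> p > 0" if p: "p \<in> ?I" for p
      proof -
        obtain x where "x \<in> branches a b" "z \<in> on_branch strip_image x"
          "mass K (on_branch strip x) z = ennreal (\<kappa> p)" using branch[OF p] by blast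
        then have "ennreal (\<kappa> p) > 0" using bspec[OF elim(2)] no_irreg by metis
        then show ?thesis by simp
      qed
      have ex: "\<kappa> p * weight a b q = \<kappa> q * weight a b p" if p: "p \<in> ?I" and q: "q \<in> ?I" for p q
      proof -
        obtain x where x: "x \<in> branches a b" "z \<in> on_branch strip_image x"
          "on_branch (locate a b) x z = p"
          "mass K (on_branch strip x) z = ennreal (\<kappa> p)" using branch[OF p] by blast
        obtain y where y: "y \<in> branches a b" "z \<in> on_branch strip_image y"
          "on_branch (locate a b) y z = q"
          "mass K (on_branch strip y) z = ennreal (\<kappa> q)" using branch[OF q] by blast
        have "ennreal (\<kappa> p) * ennreal (weight a b q) = ennreal (\<kappa> q) * ennreal (weight a b p)"
          using bspec[OF bspec[OF elim(1) x(1)] y(1)] x(2-4) y(2-4) by simp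
        then show ?thesis
          using \<kappa>pos[OF p] \<kappa>pos[OF q] w[OF p] w[OF q] by (simp add: ennreal_mult[symmetric])
      qed
      have member: "measure (K z) {\<omega> \<in> space \<Omega>. p \<in> \<Phi> \<omega> \<and> single \<omega>} = \<kappa> p" if p: "p \<in> ?I" for p
        unfolding \<kappa>_def
      proof (rule Kz.finite_measure_eq_AE)
        show "AE \<omega> in K z. \<omega> \<in> {\<omega> \<in> space \<Omega>. p \<in> \<Phi> \<omega> \<and> single \<omega>} \<longleftrightarrow> \<omega> \<in> E p"
          using elim(3)
        proof eventually_elim
          case (elim \<omega>)
          show ?case
          proof
            assume "\<omega> \<in> {\<omega> \<in> space \<Omega>. p \<in> \<Phi> \<omega> \<and> single \<omega>}"
            then have *: "\<omega> \<in> space \<Omega>" "p \<in> \<Phi> \<omega>" "single \<omega>" by auto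
            then have "p \<in> hits \<omega>" using p elim by (simp add: hits_def)
            then have "leader \<omega> = p" using hits_single[OF *(3)] by simp
            then show "\<omega> \<in> E p" using * by (simp add: E_def)
          next
            assume "\<omega> \<in> E p"
            then show "\<omega> \<in> {\<omega> \<in> space \<Omega>. p \<in> \<Phi> \<omega> \<and> single \<omega>}" using leader_in(1)[of \<omega>] by (auto simp: E_def)
          qed
        qed
        have [measurable]: "{p} \<in> sets \<Lambda>" using p I by (intro singleton_sets) simp
        have "{\<omega> \<in> space \<A>. cnt {p} \<omega> \<noteq> 0 \<and> single \<omega>} \<in> sets \<A>"
          using A.single_measurable A.pred_count_0[of "{p}"] by measurable
        also have "{\<omega> \<in> space \<A>. cnt {p} \<omega> \<noteq> 0 \<and> single \<omega>} = {\<omega> \<in> space \<Omega>. p \<in> \<Phi> \<omega> \<and> single \<omega>}"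
          by (auto simp: num_points_eq_0_iff space_sigma_process)
        finally show "{\<omega> \<in> space \<Omega>. p \<in> \<Phi> \<omega> \<and> single \<omega>} \<in> sets (K z)" by (simp only: sets)
      qed (rule Em[OF p])
      have total: "measure (K z) {\<omega> \<in> space \<Omega>. single \<omega>} = (\<Sum>p\<in>?I. \<kappa> p)"
      proof -
        have "measure (K z) {\<omega> \<in> space \<Omega>. single \<omega>} = measure (K z) (\<Union>p\<in>?I. E p)"
        proof (rule Kz.finite_measure_eq_AE)
          show "AE \<omega> in K z. \<omega> \<in> {\<omega> \<in> space \<Omega>. single \<omega>} \<longleftrightarrow> \<omega> \<in> (\<Union>p\<in>?I. E p)"
            using lead by eventually_elim (auto simp: E_def)
          have "{\<omega> \<in> space \<A>. single \<omega>} \<in> sets \<A>" using A.single_measurable by measurable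
          then show "{\<omega> \<in> space \<Omega>. single \<omega>} \<in> sets (K z)" by (simp only: sets space_sigma_process)
          show "(\<Union>p\<in>?I. E p) \<in> sets (K z)" using Em fin by (intro sets.finite_UN) auto
        qed
        also have "\<dots> = (\<Sum>p\<in>?I. \<kappa> p)" unfolding \<kappa>_def
          by (rule Kz.finite_measure_finite_Union[OF fin])
             (use Em in \<open>auto simp: disjoint_family_on_def E_def\<close>)
        finally show ?thesis .
      qed
      show "\<forall>p\<in>?I. measure (K z) {\<omega> \<in> space \<Omega>. p \<in> \<Phi> \<omega> \<and> single \<omega>} / measure (K z) {\<omega> \<in> space \<Omega>. single \<omega>}
        = weight a b p / (\<Sum>q\<in>?I. weight a b q)"
      proof
        fix p assume p: "p \<in> ?I"
        have "\<kappa> p * (\<Sum>q\<in>?I. weight a b q) = weight a b p * (\<Sum>q\<in>?I. \<kappa> q)"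
          unfolding sum_distrib_left using ex[OF p] by (intro sum.cong) (auto simp: mult.commute)
        moreover have "(\<Sum>q\<in>?I. weight a b q) > 0" "(\<Sum>q\<in>?I. \<kappa> q) > 0"
          using p w \<kappa>pos fin by (auto intro!: sum_pos)
        ultimately show "measure (K z) {\<omega> \<in> space \<Omega>. p \<in> \<Phi> \<omega> \<and> single \<omega>} / measure (K z) {\<omega> \<in> space \<Omega>. single \<omega>}
          = weight a b p / (\<Sum>q\<in>?I. weight a b q)"
          unfolding member[OF p] total by (simp add: field_simps)
      qed
    qed
  qed
qed

end

lemma weight_ratio_independent_everywhere:
  "AE z in P\<^sub>Z. \<forall>a\<in>L. \<forall>b\<in>L. \<forall>c\<in>L. \<forall>d\<in>L. \<forall>x\<in>branches a b \<inter> branches c d. \<forall>y\<in>branches a b \<inter> branches c d.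
     z \<in> on_branch strip_image x \<inter> on_branch strip_image y \<longrightarrow>
     weight c d (on_branch (locate c d) x z) * weight a b (on_branch (locate a b) y z)
       = weight a b (on_branch (locate a b) x z) * weight c d (on_branch (locate c d) y z)
     \<or> (\<exists>p\<in>space \<Lambda> - regular_at a b. heights p = z)"
  by (intro AE_finite_allI AE_ball_countable[OF countable_Int1[OF countable_branches], THEN iffD2] ballI weight_ratio_independent)
     (auto simp: branches_def)

text \<open>Equal ratios of weights within the fibre have equal normalisations.\<close>

lemma labelling_independent:
  "AE z in P\<^sub>Z. z \<in> positive_vecs \<longrightarrow> finite (I_set G l t z) \<longrightarrow>
     (\<forall>a\<in>L. \<forall>b\<in>L. \<forall>c\<in>L. \<forall>d\<in>L.
       (\<forall>p\<in>I_set G l t z. \<exists>j1 j2. (snd (snd p), j1, j2) \<in> branches a b \<and> (snd (snd p), j1, j2) \<in> branches c d \<and> p \<in> strip (snd (snd p)) j1 j2) \<longrightarrow>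
       (\<forall>p\<in>I_set G l t z. weight a b p / (\<Sum>q\<in>I_set G l t z. weight a b q) = weight c d p / (\<Sum>q\<in>I_set G l t z. weight c d q)))"
  using weight_ratio_independent_everywhere AE_space
proof eventually_elim
  case (elim z)
  show ?case
  proof (intro impI ballI)
    let ?I = "I_set G l t z"
    fix a b c d p
    assume zpos: "z \<in> positive_vecs" and fin: "finite ?I" and i: "a \<in> L" "b \<in> L" "c \<in> L" "d \<in> L"
      and br: "\<forall>p\<in>?I. \<exists>j1 j2. (snd (snd p), j1, j2) \<in> branches a b \<and> (snd (snd p), j1, j2) \<in> branches c d \<and> p \<in> strip (snd (snd p)) j1 j2"
      and p: "p \<in> ?I"
    have z: "z \<in> space V" using elim(2) by simp
    have I: "p \<in> ?I \<longleftrightarrow> p \<in> space \<Lambda> \<and> heights p = z" for p by (rule I_set_heights[OF z])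
    have no_irreg: "\<not> (\<exists>p\<in>space \<Lambda> - regular_at a b. heights p = z)"
      using br I branches_regular_at by blast
    have w: "weight a b q > 0 \<and> weight c d q > 0" if q: "q \<in> ?I" for q
    proof -
      obtain j1 j2 where x: "is_branch a b (snd (snd q)) j1 j2" "is_branch c d (snd (snd q)) j1 j2" "q \<in> strip (snd (snd q)) j1 j2"
        using bspec[OF br q] by (auto simp: branches_def)
      show ?thesis using weight_pos[OF x(1,3)] weight_pos[OF x(2,3)] ..
    qed
    have ex: "weight c d p * weight a b q = weight a b p * weight c d q" if q: "q \<in> ?I" for q
    proof -
      obtain j1 j2 where x: "(snd (snd p), j1, j2) \<in> branches a b \<inter> branches c d" "p \<in> strip (snd (snd p)) j1 j2"
        using bspec[OF br p] by blast
      obtain i1 i2 where y: "(snd (snd q), i1, i2) \<in> branches a b \<inter> branches c d" "q \<in> strip (snd (snd q)) i1 i2"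
        using bspec[OF br q] by blast
      have bx: "is_branch a b (snd (snd p)) j1 j2" "is_branch c d (snd (snd p)) j1 j2"
        and by': "is_branch a b (snd (snd q)) i1 i2" "is_branch c d (snd (snd q)) i1 i2"
        using x(1) y(1) by (auto simp: branches_def)
      have hp: "heights p = z" "p \<in> space \<Lambda>" and hq: "heights q = z" "q \<in> space \<Lambda>" using p q I by auto
      have "z \<in> strip_image (snd (snd p)) j1 j2 \<inter> strip_image (snd (snd q)) i1 i2"
        using regular_strip[OF zpos hp x(2)] regular_strip[OF zpos hq y(2)] by blast
      then show ?thesis
        using bspec[OF bspec[OF bspec[OF bspec[OF bspec[OF bspec[OF elim(1) i(1)] i(2)] i(3)] i(4)] x(1)] y(1)] no_irreg
          locate_eq[OF bx(1) x(2) hp(1)] locate_eq[OF bx(2) x(2) hp(1)] locate_eq[OF by'(1) y(2) hq(1)] locate_eq[OF by'(2) y(2) hq(1)]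
        by simp
    qed
    have "weight a b p * (\<Sum>q\<in>?I. weight c d q) = weight c d p * (\<Sum>q\<in>?I. weight a b q)"
      unfolding sum_distrib_left using ex by (intro sum.cong) auto
    moreover have "(\<Sum>q\<in>?I. weight a b q) > 0" "(\<Sum>q\<in>?I. weight c d q) > 0"
      using p w fin by (auto intro!: sum_pos)
    ultimately show "weight a b p / (\<Sum>q\<in>?I. weight a b q) = weight c d p / (\<Sum>q\<in>?I. weight c d q)"
      by (simp add: field_simps)
  qed
qed

end

text \<open>The random profile enters only through its law.\<close>

lemma storm_processI:
  assumes "finite G" "\<And>f. f \<in> G \<Longrightarrow> f \<in> borel_measurable borel" "\<And>f x. f \<in> G \<Longrightarrow> f x \<ge> 0"
    and "prob_space N" and F: "F \<in> measurable N (count_space G)" and PF: "PF = distr N (count_space G) F"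
    and "\<And>f. f \<in> G \<Longrightarrow> measure PF {f} > 0"
    and mean: "(\<integral>\<^sup>+\<omega>. (\<integral>\<^sup>+x. ennreal (F \<omega> x) \<partial>lborel) \<partial>N) = 1"
    and PPP: "poisson_process M (storm_intensity PF) \<Phi>"
    and "\<And>\<omega>. \<omega> \<in> space M \<Longrightarrow> locally_finite_storms (\<Phi> \<omega>)"
    and "l \<ge> 1"
  shows "storm_process G PF l M \<Phi>"
proof (intro storm_process.intro counting.intro storm_model.intro storm_process_axioms.intro counting_axioms.intro)
  show "prob_space PF" unfolding PF using assms(4) F by (rule prob_space.prob_space_distr)
  show "sets PF = Pow G" by (simp add: PF)
  show "(\<integral>\<^sup>+f. (\<integral>\<^sup>+x. ennreal (f x) \<partial>lborel) \<partial>PF) = 1"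
    unfolding PF using F mean by (subst nn_integral_distr) auto
qed (use assms PPP in \<open>auto simp: poisson_process_def\<close>)


theorem proposition4:
  fixes G :: "(real \<Rightarrow> real) set"
    and N :: "'b measure" and F :: "'b \<Rightarrow> real \<Rightarrow> real"
    and PF :: "(real \<Rightarrow> real) measure"
    and M :: "'a measure" and \<Phi> :: "'a \<Rightarrow> storm set"
    and l :: nat and t :: "nat \<Rightarrow> real"
    and Z :: "'a \<Rightarrow> nat \<Rightarrow> real"
  assumes G_fin: "finite G"
    and G_meas: "\<And>f. f \<in> G \<Longrightarrow> f \<in> borel_measurable borel"
    and G_nonneg: "\<And>f x. f \<in> G \<Longrightarrow> f x \<ge> 0"
    and G_ratio: "\<And>f c t0. f \<in> G \<Longrightarrow> c > 0 \<Longrightarrow> t0 \<noteq> 0 \<Longrightarrow>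
                    finite {x. f x = c * f (t0 + x) \<and> f x > 0}"
    and N_prob: "prob_space N"
    and F_rv: "F \<in> measurable N (count_space G)"
    and PF_def: "PF = distr N (count_space G) F"
    and PF_pos: "\<And>f. f \<in> G \<Longrightarrow> measure PF {f} > 0"
    and F_mean: "(\<integral>\<^sup>+\<omega>. (\<integral>\<^sup>+x. ennreal (F \<omega> x) \<partial>lborel) \<partial>N) = 1"
    and PPP: "poisson_process M (storm_intensity PF) \<Phi>"
    and PPP_lf: "\<And>\<omega>. \<omega> \<in> space M \<Longrightarrow> locally_finite_storms (\<Phi> \<omega>)"
    and l: "l \<ge> 3"
    and Z_def: "Z = (\<lambda>\<omega>. max_vec l t (\<Phi> \<omega>))"
  shows
    "(\<forall>K. regular_cond_prob M (sigma_process M (storm_intensity PF) \<Phi>) (vec_space l) Z K \<longrightarrow>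
       (AE z in distr M (vec_space l) Z. (\<forall>i\<in>{1..l}. z i > 0) \<longrightarrow>
         (\<forall>(k::nat) s u g.
            k \<ge> 1 \<longrightarrow>
            bij_betw (\<lambda>j. (s j, u j, g j)) {1..k} (I_set G l t z) \<longrightarrow>
            (\<forall>i\<in>{1..l}. \<forall>j\<in>{1..k}. C1_near (g j) (t i - s j)) \<longrightarrow>
            (\<forall>j\<in>{1..k}. z 1 * deriv (g j) (t 2 - s j) \<noteq> z 2 * deriv (g j) (t 1 - s j)) \<longrightarrow>
            (\<forall>(t0, y0, f)\<in>I_set G l t z.
               \<P>(\<omega> in K z. (t0, y0, f) \<in> \<Phi> \<omega> \<bar> card (\<Phi> \<omega> \<inter> I_set G l t (Z \<omega>)) = 1)
               = storm_weight PF t z (t0, y0, f)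
                 * inverse (\<Sum>j=1..k. storm_weight PF t z (s j, u j, g j)))))) \<and>
     (AE z in distr M (vec_space l) Z. (\<forall>i\<in>{1..l}. z i > 0) \<longrightarrow>
         (\<forall>(k::nat) s u g \<sigma> \<tau>.
            k \<ge> 1 \<longrightarrow>
            bij_betw (\<lambda>j. (s j, u j, g j)) {1..k} (I_set G l t z) \<longrightarrow>
            (\<forall>i\<in>{1..l}. \<forall>j\<in>{1..k}. C1_near (g j) (t i - s j)) \<longrightarrow>
            \<sigma> permutes {1..l} \<longrightarrow> \<tau> permutes {1..l} \<longrightarrow>
            (\<forall>j\<in>{1..k}. jac (t \<circ> \<sigma>) (z \<circ> \<sigma>) (s j) (g j) \<noteq> 0) \<longrightarrow>
            (\<forall>j\<in>{1..k}. jac (t \<circ> \<tau>) (z \<circ> \<tau>) (s j) (g j) \<noteq> 0) \<longrightarrow>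
            (\<forall>p\<in>I_set G l t z.
               storm_weight PF (t \<circ> \<sigma>) (z \<circ> \<sigma>) p
                 * inverse (\<Sum>j=1..k. storm_weight PF (t \<circ> \<sigma>) (z \<circ> \<sigma>) (s j, u j, g j))
               = storm_weight PF (t \<circ> \<tau>) (z \<circ> \<tau>) p
                 * inverse (\<Sum>j=1..k. storm_weight PF (t \<circ> \<tau>) (z \<circ> \<tau>) (s j, u j, g j)))))"
proof -
  have l1: "l \<ge> 1" using l by simp
  have sp: "storm_process G PF l M \<Phi>"
    by (rule storm_processI[where N = N and F = F])
       (fact G_fin G_meas G_nonneg N_prob F_rv PF_def PF_pos F_mean PPP PPP_lf l1)+
  interpret S: storm_process G PF l t M \<Phi> Z
    by (rule sp) (simp only: Z_def)
  have idx: "1 \<in> {1..l}" "2 \<in> {1..l}" using l by auto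
  have posI: "z \<in> S.positive_vecs \<longleftrightarrow> (\<forall>i\<in>{1..l}. z i > 0)" if "z \<in> space (distr M (vec_space l) Z)" for z
    using that by (simp add: S.positive_vecs_def)
  have branch: "\<exists>j1 j2. (snd (snd p), j1, j2) \<in> S.branches a b \<and> (snd (snd p), j1, j2) \<in> S.branches c d
        \<and> p \<in> S.strip (snd (snd p)) j1 j2"
    if p: "p \<in> I_set G l t z" and bij: "bij_betw (\<lambda>j. (s j, u j, g j)) {1..k} (I_set G l t z)"
      and zpos: "\<forall>i\<in>{1..l}. z i > 0"
      and C1: "\<forall>i\<in>{1..l}. \<forall>j\<in>{1..k}. C1_near (g j) (t i - s j)"
      and i: "a \<in> {1..l}" "b \<in> {1..l}" "c \<in> {1..l}" "d \<in> {1..l}"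
      and nz: "\<forall>j\<in>{1..k}. z a * deriv (g j) (t b - s j) \<noteq> z b * deriv (g j) (t a - s j)"
        "\<forall>j\<in>{1..k}. z c * deriv (g j) (t d - s j) \<noteq> z d * deriv (g j) (t c - s j)"
    for p z s u and g :: "nat \<Rightarrow> real \<Rightarrow> real" and k a b c d
  proof -
    have "p \<in> (\<lambda>j. (s j, u j, g j)) ` {1..k}" using p unfolding bij_betw_imp_surj_on[OF bij] .
    then obtain j where j: "j \<in> {1..k}" "p = (s j, u j, g j)" by blast
    show ?thesis unfolding j(2) snd_conv
      by (rule S.common_branch[of "s j" "u j" "g j" z]) (use p zpos C1 i nz j in auto)
  qed
  show ?thesis
  proof (intro conjI allI impI, goal_cases)
    case (1 K)
    note K = 1
    show ?case
      using S.conditional_weight[OF K, of 1 2] AE_space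
    proof eventually_elim
      case (elim z)
      have z: "z \<in> space (vec_space l)" using elim(2) by simp
      show ?case
      proof (intro impI allI ballI)
        fix k :: nat and s u g p
        assume zpos: "\<forall>i\<in>{1..l}. z i > 0" and bij: "bij_betw (\<lambda>j. (s j, u j, g j)) {1..k} (I_set G l t z)"
          and C1: "\<forall>i\<in>{1..l}. \<forall>j\<in>{1..k}. C1_near (g j) (t i - s j)"
          and nz: "\<forall>j\<in>{1..k}. z 1 * deriv (g j) (t 2 - s j) \<noteq> z 2 * deriv (g j) (t 1 - s j)"
          and p: "p \<in> I_set G l t z"
        have fin: "finite (I_set G l t z)" using bij bij_betw_finite by blast
        have "I_set G l t z \<subseteq> S.regular_at 1 2"
          using branch[OF _ bij zpos C1 idx idx nz nz] S.branches_regular_at by blast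
        then have cond: "measure (K z) {\<omega> \<in> space M. p \<in> \<Phi> \<omega> \<and> S.single \<omega>} / measure (K z) {\<omega> \<in> space M. S.single \<omega>}
          = S.weight 1 2 p / (\<Sum>q\<in>I_set G l t z. S.weight 1 2 q)"
          using elim(1) zpos fin p posI[OF elim(2)] by blast
        have weight: "storm_weight PF t z q = S.weight 1 2 q" if "q \<in> I_set G l t z" for q
          using that S.jacobian_weight(2)[OF _ idx] by (cases q) (simp add: storm_weight_def jac_def)
        have "(\<Sum>j=1..k. storm_weight PF t z (s j, u j, g j)) = (\<Sum>q\<in>I_set G l t z. storm_weight PF t z q)"
          by (rule sum.reindex_bij_betw[OF bij])
        also have "\<dots> = (\<Sum>q\<in>I_set G l t z. S.weight 1 2 q)" by (rule sum.cong) (simp_all add: weight)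
        finally have sum: "(\<Sum>j=1..k. storm_weight PF t z (s j, u j, g j)) = (\<Sum>q\<in>I_set G l t z. S.weight 1 2 q)" .
        have single: "S.single \<omega> \<longleftrightarrow> card (\<Phi> \<omega> \<inter> I_set G l t (Z \<omega>)) = 1" for \<omega>
          by (simp add: S.single_def S.hits_def)
        have "\<P>(\<omega> in K z. p \<in> \<Phi> \<omega> \<bar> card (\<Phi> \<omega> \<inter> I_set G l t (Z \<omega>)) = 1)
               = storm_weight PF t z p * inverse (\<Sum>j=1..k. storm_weight PF t z (s j, u j, g j))"
          unfolding cond_prob_def S.kernel_space[OF K z] sum weight[OF p] single[symmetric] cond by (simp only: divide_inverse)
        then show "case p of (t0, y0, f) \<Rightarrow>
              \<P>(\<omega> in K z. (t0, y0, f) \<in> \<Phi> \<omega> \<bar> card (\<Phi> \<omega> \<inter> I_set G l t (Z \<omega>)) = 1)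
               = storm_weight PF t z (t0, y0, f)
                 * inverse (\<Sum>j=1..k. storm_weight PF t z (s j, u j, g j))"
          by (cases p) simp
      qed
    qed
  next
    case 2
    show ?case
      using S.labelling_independent AE_space
    proof eventually_elim
      case (elim z)
      show ?case
      proof (intro impI allI ballI)
        fix k :: nat and s u g \<sigma> \<tau> p
        assume zpos: "\<forall>i\<in>{1..l}. z i > 0" and bij: "bij_betw (\<lambda>j. (s j, u j, g j)) {1..k} (I_set G l t z)"
          and C1: "\<forall>i\<in>{1..l}. \<forall>j\<in>{1..k}. C1_near (g j) (t i - s j)"
          and perm: "\<sigma> permutes {1..l}" "\<tau> permutes {1..l}"
          and nz: "\<forall>j\<in>{1..k}. jac (t \<circ> \<sigma>) (z \<circ> \<sigma>) (s j) (g j) \<noteq> 0" "\<forall>j\<in>{1..k}. jac (t \<circ> \<tau>) (z \<circ> \<tau>) (s j) (g j) \<noteq> 0"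
          and p: "p \<in> I_set G l t z"
        have fin: "finite (I_set G l t z)" using bij bij_betw_finite by blast
        have i: "\<sigma> 1 \<in> {1..l}" "\<sigma> 2 \<in> {1..l}" "\<tau> 1 \<in> {1..l}" "\<tau> 2 \<in> {1..l}"
          unfolding permutes_in_image[OF perm(1)] permutes_in_image[OF perm(2)] by (rule idx)+
        have nz': "\<forall>j\<in>{1..k}. z (\<sigma> 1) * deriv (g j) (t (\<sigma> 2) - s j) \<noteq> z (\<sigma> 2) * deriv (g j) (t (\<sigma> 1) - s j)"
          "\<forall>j\<in>{1..k}. z (\<tau> 1) * deriv (g j) (t (\<tau> 2) - s j) \<noteq> z (\<tau> 2) * deriv (g j) (t (\<tau> 1) - s j)"
          using nz by (simp_all add: jac_def)
        have eq: "S.weight (\<sigma> 1) (\<sigma> 2) p / (\<Sum>q\<in>I_set G l t z. S.weight (\<sigma> 1) (\<sigma> 2) q)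
          = S.weight (\<tau> 1) (\<tau> 2) p / (\<Sum>q\<in>I_set G l t z. S.weight (\<tau> 1) (\<tau> 2) q)"
          using elim(1) posI[OF elim(2)] zpos fin i p branch[OF _ bij zpos C1 i nz'] by blast
        have weight: "storm_weight PF (t \<circ> \<rho>) (z \<circ> \<rho>) q = S.weight (\<rho> 1) (\<rho> 2) q"
          if "q \<in> I_set G l t z" "\<rho> 1 \<in> {1..l}" "\<rho> 2 \<in> {1..l}" for q and \<rho> :: "nat \<Rightarrow> nat"
          using that S.jacobian_weight(2)[OF _ that(2,3)] by (cases q) (simp add: storm_weight_def jac_def)
        have sum: "(\<Sum>j=1..k. storm_weight PF (t \<circ> \<rho>) (z \<circ> \<rho>) (s j, u j, g j)) = (\<Sum>q\<in>I_set G l t z. S.weight (\<rho> 1) (\<rho> 2) q)"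
          if "\<rho> 1 \<in> {1..l}" "\<rho> 2 \<in> {1..l}" for \<rho> :: "nat \<Rightarrow> nat"
        proof -
          have "(\<Sum>j=1..k. storm_weight PF (t \<circ> \<rho>) (z \<circ> \<rho>) (s j, u j, g j)) = (\<Sum>q\<in>I_set G l t z. storm_weight PF (t \<circ> \<rho>) (z \<circ> \<rho>) q)"
            by (rule sum.reindex_bij_betw[OF bij])
          then show ?thesis using weight[OF _ that] by simp
        qed
        show "storm_weight PF (t \<circ> \<sigma>) (z \<circ> \<sigma>) p
                 * inverse (\<Sum>j=1..k. storm_weight PF (t \<circ> \<sigma>) (z \<circ> \<sigma>) (s j, u j, g j))
               = storm_weight PF (t \<circ> \<tau>) (z \<circ> \<tau>) p
                 * inverse (\<Sum>j=1..k. storm_weight PF (t \<circ> \<tau>) (z \<circ> \<tau>) (s j, u j, g j))"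
          using eq unfolding sum[OF i(1,2)] sum[OF i(3,4)] weight[OF p i(1,2)] weight[OF p i(3,4)]
          by (simp only: divide_inverse)
      qed
    qed
  qed
qed

end
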